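(* Consider the weighted recursive tree with i.i.d. vertex-weights $(W_i)_{i\in\mathbb N}$ distributed as $W$, where $W$ satisfies: (1) $W$ takes values in $(0,1]$ and $\sup\{x\in\mathbb R:\mathbb P(W\le x)<1\}=1$; (2) there exist $C,\rho>0$ and $x_1\in(0,1)$ such that $\mathbb P(W\le x)\le Cx^\rho$ for all $x\in[0,x_1]$; (3) $\mathbb P(W=1)=q_0$ for some $q_0\in(0,1]$. Fix $\varepsilon\in[0,1]$ and let $(n_\ell)_{\ell\in\mathbb N}$ be a sequence of positive integers with $n_\ell\to\infty$ and $\varepsilon_{n_\ell}\to\varepsilon$ as $\ell\to\infty$. Then $\mathcal P^{(n_\ell)}$ converges weakly in $\mathcal M^{\#}_{\mathbb Z^*}$ to $\mathcal P^{\varepsilon}$ as $\ell\to\infty$. Equivalently, for any integers $i<i'$, jointly as $\ell\to\infty$, $$\big(X^{(n_\ell)}_i,X^{(n_\ell)}_{i+1},\ldots,X^{(n_\ell)}_{i'-1},X^{(n_\ell)}_{\ge i'}\big)\xrightarrow{d}\big(\mathcal P^\varepsilon(i),\mathcal P^\varepsilon(i+1),\ldots,\mathcal P^\varepsilon(i'-1),\mathcal P^\varepsilon([i',\infty))\big).$$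
   Context: Weighted recursive tree (WRT): let $(W_i)_{i\ge1}$ be i.i.d. copies of a random variable $W$ with $\mathbb P(W>0)=1$ and $S_n:=\sum_{i=1}^nW_i$. $T_1$ consists of the single vertex $1$ (the root) with vertex-weight $W_1$. For $n\ge1$, $T_{n+1}$ is obtained from $T_n$ by adding vertex $n+1$ with vertex-weight $W_{n+1}$ and, conditionally on $T_n$ (including its vertex-weights), connecting it to one vertex $i\in[n]:=\{1,\ldots,n\}$ chosen with probability $W_i/S_n$, by an edge directed from $n+1$ to $i$. $\mathcal Z_n(i)$ denotes the in-degree of vertex $i$ in $T_n$. Set $\theta:=1+\mathbb E[W]$; $\log_\theta$ is the logarithm to base $\theta$. Define $\varepsilon_n:=\log_\theta n-\lfloor\log_\theta n\rfloor$, $X^{(n)}_i:=|\{j\in[n]:\mathcal Z_n(j)=\lfloor\log_\theta n\rfloor+i\}|$ and $X^{(n)}_{\ge i}:=|\{j\in[n]:\mathcal Z_n(j)\ge\lfloor\log_\theta n\rfloor+i\}|$ for $i\in\mathbb Z$. Let $\mathcal P$ be a Poisson point process on $\mathbb R$ with intensity measure $\lambda(\mathrm dx)=q_0\theta^{-x}\log\theta\,\mathrm dx$, and let $$\mathcal P^\varepsilon:=\sum_{x\in\mathcal P}\delta_{\lfloor x+\varepsilon\rfloor},\qquad \mathcal P^{(n)}:=\sum_{i\in[n]}\delta_{\mathcal Z_n(i)-\lfloor\log_\theta n\rfloor}.$$ Write $\mathcal P^\varepsilon(i):=\mathcal P^\varepsilon(\{i\})$. $\mathbb Z^*:=\mathbb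 Z\cup\{\infty\}$ is endowed with the metric $d(i,j)=|2^{-i}-2^{-j}|$, $d(i,\infty)=2^{-i}$ for $i,j\in\mathbb Z$ (so that $[i,\infty]$ is compact), and $\mathcal M^{\#}_{\mathbb Z^*}$ is the space of boundedly finite measures on $\mathbb Z^*$ equipped with the vague topology; $\mathcal P^\varepsilon$ and $\mathcal P^{(n)}$ are regarded as random elements of it. *)

theory Defs
  imports "HOL-Probability.Probability" "Graph_Theory.Digraph"
begin

section \<open>The space \<open>\<int>\<^sup>*\<close>\<close>

datatype zstar = Fin int | Infty

instantiation zstar :: metric_space
begin

fun dist_zstar :: "zstar \<Rightarrow> zstar \<Rightarrow> real" where
  "dist_zstar (Fin i) (Fin j) = \<bar>2 powi (- i) - 2 powi (- j)\<bar>"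
| "dist_zstar (Fin i) Infty = 2 powi (- i)"
| "dist_zstar Infty (Fin j) = 2 powi (- j)"
| "dist_zstar Infty Infty = 0"

definition uniformity_zstar :: "(zstar \<times> zstar) filter" where
  "uniformity_zstar = (INF e\<in>{0<..}. principal {(x, y). dist x y < e})"

definition open_zstar :: "zstar set \<Rightarrow> bool" where
  "open_zstar U \<longleftrightarrow> (\<forall>x\<in>U. eventually (\<lambda>(x', y). x' = x \<longrightarrow> y \<in> U) uniformity)"

instance
proof
  fix x y z :: zstar
  have powi_eq: "2 powi (- i) = (2 powi (- j) :: real) \<longleftrightarrow> i = j" for i j :: int
  proof -
    have "2 powi k = (2 powr of_int k :: real)" for k :: int
      by (simp add: powr_real_of_int')
    then show ?thesis by (simp add: powr_inj)
  qed
  show "dist x y = 0 \<longleftrightarrow> x = y"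
    by (cases x; cases y) (auto simp: powi_eq)
  have emb: "dist u v = \<bar>(case u of Fin i \<Rightarrow> 2 powi (- i) | Infty \<Rightarrow> 0)
      - (case v of Fin i \<Rightarrow> 2 powi (- i) | Infty \<Rightarrow> 0)\<bar>" for u v :: zstar
    by (cases u; cases v) auto
  show "dist x y \<le> dist x z + dist y z"
    unfolding emb by arith
qed (simp_all add: uniformity_zstar_def open_zstar_def)

end

section \<open>Boundedly finite measures and convergence in distribution\<close>

definition boundedly_finite_measures :: "'x::metric_space measure set" where
  "boundedly_finite_measures =
     {\<mu>. sets \<mu> = sets borel \<and> (\<forall>B\<in>sets borel. bounded B \<longrightarrow> emeasure \<mu> B < \<infinity>)}"

text \<open>The coarsest topology making \<open>\<mu> \<mapsto> \<integral>f d\<mu>\<close> continuous for every bounded continuous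
  \<open>f\<close> that vanishes outside a bounded set.\<close>

definition vague_topology :: "'x::metric_space measure topology" where
  "vague_topology = topology_generated_by
     {{\<mu> \<in> boundedly_finite_measures. (\<integral>x. f x \<partial>\<mu>) \<in> U} | (f :: 'x \<Rightarrow> real) U.
        continuous_on UNIV f \<and> bounded (range f) \<and> (\<exists>B. bounded B \<and> (\<forall>x. x \<notin> B \<longrightarrow> f x = 0)) \<and>
        open U}"

definition borel_of_topology :: "'s topology \<Rightarrow> 's measure" where
  "borel_of_topology T = sigma (topspace T) {U. openin T U}"

text \<open>Convergence in distribution, that is, weak convergence of the laws, of random elements
  \<open>X n\<close> of the topological space \<open>T\<close> (defined on \<open>M\<close>) to a random element \<open>Y\<close> of \<open>T\<close>
  (defined on \<open>N\<close>).\<close>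

definition converges_in_distribution ::
  "'s topology \<Rightarrow> 'a measure \<Rightarrow> (nat \<Rightarrow> 'a \<Rightarrow> 's) \<Rightarrow> 'b measure \<Rightarrow> ('b \<Rightarrow> 's) \<Rightarrow> bool" where
  "converges_in_distribution T M X N Y \<longleftrightarrow>
     (\<forall>n. X n \<in> measurable M (borel_of_topology T)) \<and>
     Y \<in> measurable N (borel_of_topology T) \<and>
     (\<forall>f. continuous_map T euclideanreal f \<and> bounded (f ` topspace T) \<longrightarrow>
        (\<lambda>n. \<integral>\<omega>. f (X n \<omega>) \<partial>M) \<longlonglongrightarrow> (\<integral>\<omega>. f (Y \<omega>) \<partial>N))"

section \<open>Point processes\<close>

text \<open>\<open>point_sum I g\<close> is the measure \<open>\<Sum>x\<in>I. \<delta>\<^bsub>g x\<^esub>\<close>: the image under \<open>g\<close> of the counting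
  measure on \<open>I\<close>.\<close>

definition point_sum :: "'i set \<Rightarrow> ('i \<Rightarrow> 'x::topological_space) \<Rightarrow> 'x measure" where
  "point_sum I g = distr (count_space I) borel g"

text \<open>A Poisson point process with a diffuse intensity measure \<open>\<Lambda>\<close> has almost surely no
  multiple points, so it is represented by the random set \<open>P\<close> of its points. The probabilities
  are those of the Poisson distribution, written out because \<open>poisson_pmf\<close> excludes
  rate \<open>0\<close>.\<close>

definition poisson_point_process :: "'b measure \<Rightarrow> 'x measure \<Rightarrow> ('b \<Rightarrow> 'x set) \<Rightarrow> bool" where
  "poisson_point_process N \<Lambda> P \<longleftrightarrow> prob_space N \<and>
     (\<forall>\<omega>\<in>space N. P \<omega> \<subseteq> space \<Lambda>) \<and>
     (\<forall>A\<in>sets \<Lambda>. (\<lambda>\<omega>. emeasure (count_space UNIV) (P \<omega> \<inter> A)) \<in> borel_measurable N) \<and>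
     (\<forall>A\<in>sets \<Lambda>. emeasure \<Lambda> A < \<infinity> \<longrightarrow>
        (\<forall>k::nat. measure N {\<omega>\<in>space N. emeasure (count_space UNIV) (P \<omega> \<inter> A) = of_nat k} =
           measure \<Lambda> A ^ k / fact k * exp (- measure \<Lambda> A))) \<and>
     (\<forall>(A :: nat \<Rightarrow> 'x set) m.
        disjoint_family_on A {..<m} \<and> (\<forall>k<m. A k \<in> sets \<Lambda>) \<longrightarrow>
        prob_space.indep_vars N (\<lambda>_. borel)
          (\<lambda>k \<omega>. emeasure (count_space UNIV) (P \<omega> \<inter> A k)) {..<m})"

section \<open>Weighted recursive trees\<close>

text \<open>Vertex \<open>j \<ge> 2\<close> has exactly one outgoing edge, directed to \<open>par j\<close>; the edge is named by
  its tail \<open>j\<close>.\<close>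

definition recursive_tree :: "(nat \<Rightarrow> nat) \<Rightarrow> nat \<Rightarrow> (nat, nat) pre_digraph" where
  "recursive_tree par n = \<lparr>verts = {1..n}, arcs = {2..n}, tail = (\<lambda>j. j), head = par\<rparr>"

text \<open>The information given by the weights of \<open>1, \<dots>, n\<close> and the out-edges of \<open>2, \<dots>, m\<close>.
  For \<open>m = n\<close> this is the \<open>\<sigma>\<close>-algebra generated by \<open>T\<^sub>n\<close> including its vertex-weights.\<close>

definition tree_history ::
  "'a measure \<Rightarrow> (nat \<Rightarrow> 'a \<Rightarrow> real) \<Rightarrow> (nat \<Rightarrow> 'a \<Rightarrow> nat) \<Rightarrow> nat \<Rightarrow> nat \<Rightarrow> 'a measure" where
  "tree_history M W par n m = sigma (space M)
     ({W i -` B \<inter> space M | i B. i \<in> {1..n} \<and> B \<in> sets borel} \<union>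
      {par j -` A \<inter> space M | j A. j \<in> {2..m}})"

text \<open>\<open>D\<close> is the law of \<open>W\<close>. The assumption \<open>weight_fresh\<close> makes explicit that
  the weight of the new vertex \<open>n + 1\<close> influences neither \<open>T\<^sub>n\<close> nor the vertex to which
  \<open>n + 1\<close> is connected; without it the joint law would not be determined.\<close>

locale weighted_recursive_tree = prob_space M
  for M :: "'a measure" +
  fixes D :: "real measure" and W :: "nat \<Rightarrow> 'a \<Rightarrow> real" and par :: "nat \<Rightarrow> 'a \<Rightarrow> nat"
  assumes weight_law: "real_distribution D"
    and weight_pos: "AE x in D. 0 < x"
    and weight_measurable: "1 \<le> i \<Longrightarrow> W i \<in> borel_measurable M"
    and weight_distr: "1 \<le> i \<Longrightarrow> distr M borel (W i) = D"
    and weight_indep: "indep_vars (\<lambda>_. borel) W {1..}"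
    and parent_measurable: "1 \<le> n \<Longrightarrow> par (Suc n) \<in> measurable M (count_space UNIV)"
    and parent_range: "1 \<le> n \<Longrightarrow> \<omega> \<in> space M \<Longrightarrow> par (Suc n) \<omega> \<in> {1..n}"
    and weight_fresh: "1 \<le> n \<Longrightarrow>
      indep_set (sets (vimage_algebra (space M) (W (Suc n)) borel))
        (sets (tree_history M W par n (Suc n)))"
    and attachment: "1 \<le> n \<Longrightarrow> i \<in> {1..n} \<Longrightarrow>
      AE \<omega> in M. real_cond_exp M (tree_history M W par n n)
        (indicator {\<omega>\<in>space M. par (Suc n) \<omega> = i}) \<omega> = W i \<omega> / (\<Sum>j=1..n. W j \<omega>)"

text \<open>\<open>\<Z>\<^sub>n(i)\<close>, the in-degree of \<open>i\<close> in \<open>T\<^sub>n\<close>.\<close>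

definition tree_in_degree :: "(nat \<Rightarrow> 'a \<Rightarrow> nat) \<Rightarrow> nat \<Rightarrow> nat \<Rightarrow> 'a \<Rightarrow> nat" where
  "tree_in_degree par n i \<omega> = in_degree (recursive_tree (\<lambda>j. par j \<omega>) n) i"

definition degree_count :: "real \<Rightarrow> (nat \<Rightarrow> 'a \<Rightarrow> nat) \<Rightarrow> nat \<Rightarrow> int \<Rightarrow> 'a \<Rightarrow> nat" where
  "degree_count \<theta> par n i \<omega> =
     card {j\<in>{1..n}. int (tree_in_degree par n j \<omega>) = \<lfloor>log \<theta> (real n)\<rfloor> + i}"

definition degree_count_ge :: "real \<Rightarrow> (nat \<Rightarrow> 'a \<Rightarrow> nat) \<Rightarrow> nat \<Rightarrow> int \<Rightarrow> 'a \<Rightarrow> nat" where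
  "degree_count_ge \<theta> par n i \<omega> =
     card {j\<in>{1..n}. int (tree_in_degree par n j \<omega>) \<ge> \<lfloor>log \<theta> (real n)\<rfloor> + i}"

definition degree_process :: "real \<Rightarrow> (nat \<Rightarrow> 'a \<Rightarrow> nat) \<Rightarrow> nat \<Rightarrow> 'a \<Rightarrow> zstar measure" where
  "degree_process \<theta> par n \<omega> =
     point_sum {1..n} (\<lambda>i. Fin (int (tree_in_degree par n i \<omega>) - \<lfloor>log \<theta> (real n)\<rfloor>))"

section \<open>The limiting process\<close>

definition limit_intensity :: "real \<Rightarrow> real \<Rightarrow> real measure" where
  "limit_intensity q\<^sub>0 \<theta> = density lborel (\<lambda>x. ennreal (q\<^sub>0 * \<theta> powr (- x) * ln \<theta>))"

text \<open>\<open>\<P>\<^sup>\<epsilon>\<close> as a random element of the space of boundedly finite measures. The intensity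
  is finite on each \<open>[a, \<infinity>)\<close>, so the sum is boundedly finite almost surely; on the exceptional
  null set it is replaced by the zero measure.\<close>

definition limit_process :: "real \<Rightarrow> ('b \<Rightarrow> real set) \<Rightarrow> 'b \<Rightarrow> zstar measure" where
  "limit_process \<epsilon> P \<omega> =
     (let \<mu> = point_sum (P \<omega>) (\<lambda>x. Fin \<lfloor>x + \<epsilon>\<rfloor>)
      in if \<mu> \<in> boundedly_finite_measures then \<mu> else null_measure borel)"

end

theory Submission
  imports Defs "HOL-Real_Asymp.Real_Asymp"
begin

text \<open>The argument is quenched: the weights are fixed first and averaged at the very end. Let
  \<open>\<mu> = \<theta> - 1\<close> be the mean weight and \<open>S\<^sub>k\<close> the sum of the first \<open>k\<close> weights.

  Given all weights, the parents of the vertices are independent, and vertex \<open>k + 1\<close> chooses \<open>v\<close> with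
  probability \<open>w\<^sub>v / S\<^sub>k\<close> (\<open>annealed_expectation\<close>). The joint law of the numbers of vertices in finitely
  many degree levels is encoded by its generating function, which is the expectation of a product
  over the vertices of a function of the degree of each vertex.

  Each parent choice hits at most one vertex. Replacing it, one step at a time, by independent
  Bernoulli trials for the different vertices costs a second order term in which two vertices are
  hit at once. As in-degrees are negatively dependent, the total error is bounded by products of
  tail probabilities of single vertices (\<open>quenched_prod\<close>) and vanishes (\<open>swap_error\<close>). After the
  replacement the expectation factorises, and a product of many factors close to \<open>1\<close> converges
  to an exponential, the generating function of independent Poisson variables (\<open>quenched_limit\<close>).

  It remains to find the expected number of vertices with in-degree at least \<open>m\<close>. For the vertices of
  weight \<open>1\<close> these numbers satisfy a linear recursion in \<open>n\<close> and \<open>m\<close>, among whose solutions are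
  \<open>y ^ (- m)\<close> times the product of \<open>1 + (y - 1) / S\<^sub>k\<close> over \<open>k < n\<close>; for \<open>y = \<theta>\<close> the
  product is asymptotic to a multiple of \<open>n\<close>. Comparison with such solutions shows that the number is
  asymptotic to \<open>q\<^sub>0 * n * \<theta> ^ (- m)\<close>, while weights bounded away from \<open>1\<close> give a solution that decays
  faster in \<open>m\<close> (\<open>first_moment\<close>). What is used about the weights holds almost surely by Hoeffding's
  inequality and the Borel-Cantelli lemma (\<open>AE_typical_weights\<close>), and dominated convergence yields the
  limit of the averaged generating functions (\<open>annealed_pgf\<close>), which is that of the limiting Poisson
  process (\<open>limit_pgf\<close>).

  Convergence of joint generating functions gives convergence of joint point probabilities
  (\<open>joint_pgf_tendsto_imp_joint_pmf\<close>). For integer-valued point configurations on \<open>\<int>\<^sup>*\<close>, every vague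
  neighbourhood is decided by the numbers of points in finitely many levels (\<open>vague_neighbourhood\<close>),
  so convergence of these probabilities is convergence in distribution
  (\<open>converges_in_distribution_by_codes\<close>).\<close>

section \<open>Degrees for fixed weights\<close>

text \<open>The probability that vertex \<open>k + 1\<close> connects to \<open>v\<close> when the weights are \<open>w\<close>. It is set to \<open>0\<close> for
  labels \<open>v\<close> outside \<open>{1..k}\<close>, so that sums over \<open>v\<close> may run over any larger set.\<close>

definition attach_prob :: "(nat \<Rightarrow> real) \<Rightarrow> nat \<Rightarrow> nat \<Rightarrow> real" where
  "attach_prob w k v = (if v \<in> {1..k} then w v / (\<Sum>j=1..k. w j) else 0)"

text \<open>A function \<open>z\<close> from labels to naturals records the in-degrees. \<open>attach_step w k\<close> is the
  transition operator of the arrival of vertex \<open>k + 1\<close>: it averages \<open>F\<close> over the in-degrees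
  after that step. Written with increments, it is the identity for \<open>k = 0\<close>, when the root arrives.\<close>

definition attach_step :: "(nat \<Rightarrow> real) \<Rightarrow> nat \<Rightarrow> ((nat \<Rightarrow> nat) \<Rightarrow> real) \<Rightarrow> (nat \<Rightarrow> nat) \<Rightarrow> real" where
  "attach_step w k F z =
     F z + (\<Sum>v=1..k. attach_prob w k v * (F (z(v := Suc (z v))) - F z))"

text \<open>The expectation of \<open>F\<close> of the in-degrees in the tree with \<open>n\<close> vertices and fixed weights \<open>w\<close>,
  started from the in-degrees in the last argument. The last operator applied is that of the
  first step, since operators compose backwards in time.\<close>

primrec quenched_expectation ::
  "(nat \<Rightarrow> real) \<Rightarrow> nat \<Rightarrow> ((nat \<Rightarrow> nat) \<Rightarrow> real) \<Rightarrow> (nat \<Rightarrow> nat) \<Rightarrow> real" where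
  "quenched_expectation w 0 F = F"
| "quenched_expectation w (Suc n) F = quenched_expectation w n (attach_step w n F)"

text \<open>The analogous operators for a single vertex \<open>v\<close>, whose in-degree is a sum of independent
  Bernoulli variables.\<close>

definition vertex_step :: "(nat \<Rightarrow> real) \<Rightarrow> nat \<Rightarrow> nat \<Rightarrow> (nat \<Rightarrow> real) \<Rightarrow> nat \<Rightarrow> real" where
  "vertex_step w k v f x = f x + attach_prob w k v * (f (Suc x) - f x)"

primrec vertex_expectation ::
  "(nat \<Rightarrow> real) \<Rightarrow> nat \<Rightarrow> nat \<Rightarrow> (nat \<Rightarrow> real) \<Rightarrow> nat \<Rightarrow> real" where
  "vertex_expectation w v 0 f = f"
| "vertex_expectation w v (Suc n) f = vertex_expectation w v n (vertex_step w n v f)"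

locale positive_weights =
  fixes w :: "nat \<Rightarrow> real"
  assumes weight_pos: "1 \<le> v \<Longrightarrow> 0 < w v"
begin

lemma weight_sum_pos: "1 \<le> k \<Longrightarrow> 0 < (\<Sum>j=1..k. w j)"
  by (intro sum_pos) (auto intro: weight_pos)

lemma attach_prob_nonneg: "0 \<le> attach_prob w k v"
  using weight_sum_pos[of k] weight_pos[of v] by (auto simp: attach_prob_def)

lemma sum_attach_prob: "1 \<le> k \<Longrightarrow> (\<Sum>v=1..k. attach_prob w k v) = 1"
proof -
  assume k: "1 \<le> k"
  have "(\<Sum>v=1..k. attach_prob w k v) = (\<Sum>v=1..k. w v / (\<Sum>j=1..k. w j))"
    by (intro sum.cong) (auto simp: attach_prob_def)
  also have "\<dots> = 1"
    using weight_sum_pos[OF k] by (simp flip: sum_divide_distrib)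
  finally show ?thesis .
qed

lemma sum_attach_prob_le: "(\<Sum>v=1..k. attach_prob w k v) \<le> 1"
  by (cases "1 \<le> k") (auto simp: sum_attach_prob simp del: One_nat_def)

lemma attach_prob_le_1: "attach_prob w k v \<le> 1"
proof (cases "v \<in> {1..k}")
  case True
  then have "attach_prob w k v \<le> (\<Sum>v=1..k. attach_prob w k v)"
    by (intro member_le_sum) (auto simp: attach_prob_nonneg)
  then show ?thesis using sum_attach_prob_le[of k] by simp
qed (auto simp: attach_prob_def)

lemma attach_step_altdef:
  "attach_step w k F z = (1 - (\<Sum>v=1..k. attach_prob w k v)) * F z
     + (\<Sum>v=1..k. attach_prob w k v * F (z(v := Suc (z v))))"
  by (simp add: attach_step_def algebra_simps sum_subtractf sum_distrib_left)

lemma attach_step_mono: "(\<And>z. F z \<le> G z) \<Longrightarrow> attach_step w k F z \<le> attach_step w k G z"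
  unfolding attach_step_altdef using sum_attach_prob_le[of k]
  by (intro add_mono sum_mono mult_left_mono) (auto simp: attach_prob_nonneg)

lemma attach_step_add:
  "attach_step w k (\<lambda>z. F z + G z) z = attach_step w k F z + attach_step w k G z"
  by (simp add: attach_step_altdef algebra_simps sum.distrib)

lemma attach_step_scale: "attach_step w k (\<lambda>z. c * F z) z = c * attach_step w k F z"
  by (simp add: attach_step_altdef algebra_simps sum_distrib_left)

lemma attach_step_const: "attach_step w k (\<lambda>z. c) z = c"
  by (simp add: attach_step_def)

lemma quenched_mono:
  "(\<And>z. F z \<le> G z) \<Longrightarrow> quenched_expectation w n F z \<le> quenched_expectation w n G z"
proof (induction n arbitrary: F G)
  case (Suc n)
  show ?case
    unfolding quenched_expectation.simps by (rule Suc.IH, rule attach_step_mono, rule Suc.prems)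
qed simp

lemma quenched_add:
  "quenched_expectation w n (\<lambda>z. F z + G z) z
     = quenched_expectation w n F z + quenched_expectation w n G z"
proof (induction n arbitrary: F G)
  case (Suc n)
  have "attach_step w n (\<lambda>z. F z + G z) = (\<lambda>z. attach_step w n F z + attach_step w n G z)"
    by (intro ext attach_step_add)
  then show ?case by (simp add: Suc)
qed simp

lemma quenched_scale:
  "quenched_expectation w n (\<lambda>z. c * F z) z = c * quenched_expectation w n F z"
proof (induction n arbitrary: F)
  case (Suc n)
  have "attach_step w n (\<lambda>z. c * F z) = (\<lambda>z. c * attach_step w n F z)"
    by (intro ext attach_step_scale)
  then show ?case by (simp add: Suc)
qed simp

lemma quenched_const: "quenched_expectation w n (\<lambda>z. c) z = c"
proof (induction n)
  case (Suc n)
  have "attach_step w n (\<lambda>z. c) = (\<lambda>z. c)"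
    by (intro ext attach_step_const)
  then show ?case using Suc by simp
qed simp

lemma quenched_sum:
  "quenched_expectation w n (\<lambda>z. \<Sum>i\<in>I. F i z) z = (\<Sum>i\<in>I. quenched_expectation w n (F i) z)"
  by (induction I rule: infinite_finite_induct) (simp_all add: quenched_const quenched_add)

lemma quenched_abs_diff:
  assumes "\<And>z. \<bar>F z - G z\<bar> \<le> H z"
  shows "\<bar>quenched_expectation w n F z - quenched_expectation w n G z\<bar> \<le> quenched_expectation w n H z"
proof -
  have le: "F z \<le> G z + H z" "G z \<le> F z + H z" for z using assms[of z] by linarith+
  have "quenched_expectation w n F z \<le> quenched_expectation w n (\<lambda>z. G z + H z) z"
    by (rule quenched_mono) (rule le)
  moreover have "quenched_expectation w n G z \<le> quenched_expectation w n (\<lambda>z. F z + H z) z"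
    by (rule quenched_mono) (rule le)
  ultimately show ?thesis by (simp add: quenched_add)
qed

lemma vertex_step_altdef:
  "vertex_step w k v f x = (1 - attach_prob w k v) * f x + attach_prob w k v * f (Suc x)"
  by (simp add: vertex_step_def algebra_simps)

lemma vertex_step_mono: "(\<And>x. f x \<le> g x) \<Longrightarrow> vertex_step w k v f x \<le> vertex_step w k v g x"
  unfolding vertex_step_altdef
  by (intro add_mono mult_left_mono) (auto simp: attach_prob_nonneg attach_prob_le_1)

lemma vertex_step_const: "vertex_step w k v (\<lambda>_. c) x = c"
  by (simp add: vertex_step_def)

lemma vertex_mono:
  "(\<And>x. f x \<le> g x) \<Longrightarrow> vertex_expectation w v n f x \<le> vertex_expectation w v n g x"
proof (induction n arbitrary: f g)
  case (Suc n)
  show ?case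
    unfolding vertex_expectation.simps by (rule Suc.IH, rule vertex_step_mono, rule Suc.prems)
qed simp

lemma vertex_const: "vertex_expectation w v n (\<lambda>x. c) x = c"
proof (induction n)
  case (Suc n)
  have "vertex_step w n v (\<lambda>x. c) = (\<lambda>x. c)"
    by (intro ext vertex_step_const)
  then show ?case using Suc by simp
qed simp

lemma vertex_add:
  "vertex_expectation w v n (\<lambda>z. F z + G z) z
     = vertex_expectation w v n F z + vertex_expectation w v n G z"
proof (induction n arbitrary: F G)
  case (Suc n)
  have "vertex_step w n v (\<lambda>z. F z + G z) = (\<lambda>z. vertex_step w n v F z + vertex_step w n v G z)"
    by (intro ext) (simp add: vertex_step_altdef algebra_simps)
  then show ?case by (simp add: Suc)
qed simp

lemma vertex_scale:
  "vertex_expectation w v n (\<lambda>z. c * F z) z = c * vertex_expectation w v n F z"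
proof (induction n arbitrary: F)
  case (Suc n)
  have "vertex_step w n v (\<lambda>z. c * F z) = (\<lambda>z. c * vertex_step w n v F z)"
    by (intro ext) (simp add: vertex_step_altdef algebra_simps)
  then show ?case by (simp add: Suc)
qed simp

lemma vertex_sum:
  "vertex_expectation w v n (\<lambda>z. \<Sum>i\<in>I. F i z) z = (\<Sum>i\<in>I. vertex_expectation w v n (F i) z)"
  by (induction I rule: infinite_finite_induct) (simp_all add: vertex_const vertex_add)

lemma vertex_step_preserves_mono:
  assumes "mono h" shows "mono (vertex_step w k v h)"
proof -
  have "vertex_step w k v h x \<le> vertex_step w k v h (Suc x)" for x
    unfolding vertex_step_altdef using assms
    by (intro add_mono mult_left_mono) (auto simp: attach_prob_nonneg attach_prob_le_1 mono_def)
  then show ?thesis by (simp add: mono_iff_le_Suc)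
qed

lemma vertex_step_ge: "mono h \<Longrightarrow> h x \<le> vertex_step w k v h x"
  by (simp add: vertex_step_def attach_prob_nonneg mono_def)

lemma vertex_nonneg: "(\<And>x. 0 \<le> f x) \<Longrightarrow> 0 \<le> vertex_expectation w v n f x"
  using vertex_mono[of "\<lambda>_. 0" f v n x] by (simp add: vertex_const)

text \<open>Negative dependence: one arriving vertex cannot raise the in-degrees of \<open>u\<close> and \<open>v\<close> at the same
  time, so the product of nonnegative increasing functions of the two in-degrees has at most the
  expectation that it would have if they were independent.\<close>

lemma quenched_pair_le:
  assumes "u \<noteq> v" "mono h" "mono k" "\<And>x. 0 \<le> h x" "\<And>x. 0 \<le> k x"
  shows "quenched_expectation w n (\<lambda>z. h (z u) * k (z v)) z
           \<le> vertex_expectation w u n h (z u) * vertex_expectation w v n k (z v)"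
  using assms(2-)
proof (induction n arbitrary: h k)
  case (Suc n)
  have "attach_step w n (\<lambda>z. h (z u) * k (z v)) z
          \<le> vertex_step w n u h (z u) * vertex_step w n v k (z v)" (is "?L \<le> ?R") for z
  proof -
    let ?q = "attach_prob w n"
    let ?F = "\<lambda>z. h (z u) * k (z v)"
    have "(\<Sum>x=1..n. ?q x * (?F (z(x := Suc (z x))) - ?F z))
            = (\<Sum>x\<in>{u,v}. ?q x * (?F (z(x := Suc (z x))) - ?F z))"
      by (rule sum.mono_neutral_cong) (auto simp: attach_prob_def)
    also have "\<dots> = ?q u * ((h (Suc (z u)) - h (z u)) * k (z v))
                   + ?q v * (h (z u) * (k (Suc (z v)) - k (z v)))"
      using \<open>u \<noteq> v\<close> by (simp add: algebra_simps)
    finally have L: "?L = ?F z + \<dots>" by (simp add: attach_step_def)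
    have "0 \<le> (?q u * (h (Suc (z u)) - h (z u))) * (?q v * (k (Suc (z v)) - k (z v)))"
      using Suc.prems by (intro mult_nonneg_nonneg) (auto simp: attach_prob_nonneg mono_def)
    then show ?thesis unfolding L vertex_step_def by (simp add: algebra_simps)
  qed
  then have "quenched_expectation w (Suc n) (\<lambda>z. h (z u) * k (z v)) z
      \<le> quenched_expectation w n (\<lambda>z. vertex_step w n u h (z u) * vertex_step w n v k (z v)) z"
    by (auto intro: quenched_mono)
  also have "\<dots> \<le> vertex_expectation w u (Suc n) h (z u) * vertex_expectation w v (Suc n) k (z v)"
    unfolding vertex_expectation.simps
    using Suc.prems
    by (intro Suc.IH vertex_step_preserves_mono)
      (auto simp: vertex_step_altdef attach_prob_nonneg attach_prob_le_1)
  finally show ?case .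
qed simp

text \<open>Averaging a product over the change of at most one factor agrees with changing the factors
  independently, up to terms in which two factors change.\<close>

lemma prod_perturb:
  fixes a d q :: "'i \<Rightarrow> real"
  assumes "finite V" "\<And>v. v \<in> V \<Longrightarrow> 0 \<le> a v \<and> a v \<le> 1" "\<And>v. v \<in> V \<Longrightarrow> 0 \<le> a v + d v \<and> a v + d v \<le> 1"
    "\<And>v. v \<in> V \<Longrightarrow> 0 \<le> q v \<and> q v \<le> 1"
  shows "\<bar>(\<Prod>v\<in>V. a v) + (\<Sum>v\<in>V. q v * (d v * (\<Prod>u\<in>V-{v}. a u))) - (\<Prod>v\<in>V. a v + q v * d v)\<bar>
           \<le> (\<Sum>u\<in>V. \<Sum>v\<in>V-{u}. (q u * \<bar>d u\<bar>) * (q v * \<bar>d v\<bar>))"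
  using assms
proof (induction V rule: finite_induct)
  case (insert x V)
  define P where "P = (\<Prod>v\<in>V. a v)"
  define L where "L = (\<Sum>v\<in>V. q v * (d v * (\<Prod>u\<in>V-{v}. a u)))"
  define R where "R = (\<Prod>v\<in>V. a v + q v * d v)"
  define E where "E = (\<Sum>u\<in>V. \<Sum>v\<in>V-{u}. (q u * \<bar>d u\<bar>) * (q v * \<bar>d v\<bar>))"
  define K where "K = (\<Sum>v\<in>V. q v * \<bar>d v\<bar>)"
  have IH: "\<bar>P + L - R\<bar> \<le> E"
    using insert by (auto simp: P_def L_def R_def E_def)
  have "(\<Prod>u\<in>insert x V-{v}. a u) = a x * (\<Prod>u\<in>V-{v}. a u)" if "v \<in> V" for v
  proof -
    have "insert x V - {v} = insert x (V - {v})" using that insert(2) by auto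
    then show ?thesis using insert(1,2) by simp
  qed
  then have "(\<Sum>v\<in>V. q v * (d v * (\<Prod>u\<in>insert x V-{v}. a u))) = a x * L"
    by (simp add: L_def sum_distrib_left mult_ac cong: sum.cong)
  moreover have "insert x V - {x} = V" using insert(2) by auto
  ultimately have eq: "(\<Prod>v\<in>insert x V. a v)
        + (\<Sum>v\<in>insert x V. q v * (d v * (\<Prod>u\<in>insert x V-{v}. a u)))
        - (\<Prod>v\<in>insert x V. a v + q v * d v)
      = (a x + q x * d x) * (P + L - R) - q x * d x * L"
    using insert(1,2) by (simp add: P_def R_def distrib_left distrib_right right_diff_distrib mult_ac)
  have c: "a x + q x * d x = (1 - q x) * a x + q x * (a x + d x)" by (simp add: algebra_simps)
  have "\<bar>a x + q x * d x\<bar> \<le> 1"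
  proof -
    have "0 \<le> a x + q x * d x"
      unfolding c using insert.prems[of x] by (auto intro!: add_nonneg_nonneg[OF mult_nonneg_nonneg mult_nonneg_nonneg])
    moreover have "(1 - q x) * a x \<le> (1 - q x) * 1"
      using insert.prems[of x] by (intro mult_left_mono) auto
    moreover have "q x * (a x + d x) \<le> q x * 1"
      using insert.prems[of x] by (intro mult_left_mono) auto
    ultimately have "0 \<le> a x + q x * d x" "a x + q x * d x \<le> 1"
      by (simp_all add: algebra_simps)
    then show ?thesis by simp
  qed
  then have "\<bar>(a x + q x * d x) * (P + L - R)\<bar> \<le> 1 * E"
    unfolding abs_mult using IH by (intro mult_mono) auto
  moreover have "\<bar>L\<bar> \<le> K"
  proof -
    have "\<bar>L\<bar> \<le> (\<Sum>v\<in>V. \<bar>q v * (d v * (\<Prod>u\<in>V-{v}. a u))\<bar>)"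
      unfolding L_def by (rule sum_abs)
    also have "\<dots> \<le> K" unfolding K_def
    proof (intro sum_mono)
      fix v assume v: "v \<in> V"
      have "0 \<le> (\<Prod>u\<in>V-{v}. a u)" "(\<Prod>u\<in>V-{v}. a u) \<le> 1"
        using insert.prems(1) by (auto intro!: prod_nonneg prod_le_1)
      then have "\<bar>d v * (\<Prod>u\<in>V-{v}. a u)\<bar> \<le> \<bar>d v\<bar> * 1"
        unfolding abs_mult by (intro mult_left_mono) auto
      then have "q v * \<bar>d v * (\<Prod>u\<in>V-{v}. a u)\<bar> \<le> q v * \<bar>d v\<bar>"
        using insert.prems(3)[of v] v by (intro mult_left_mono) auto
      then show "\<bar>q v * (d v * (\<Prod>u\<in>V-{v}. a u))\<bar> \<le> q v * \<bar>d v\<bar>"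
        using insert.prems(3)[of v] v by (simp add: abs_mult)
    qed
    finally show ?thesis .
  qed
  then have "\<bar>q x * d x * L\<bar> \<le> (q x * \<bar>d x\<bar>) * K"
    using insert.prems(3)[of x] by (auto simp: abs_mult intro!: mult_mono)
  moreover have "(\<Sum>u\<in>insert x V. \<Sum>v\<in>insert x V-{u}. (q u * \<bar>d u\<bar>) * (q v * \<bar>d v\<bar>)) \<ge> E + (q x * \<bar>d x\<bar>) * K"
  proof -
    have "(\<Sum>u\<in>V. \<Sum>v\<in>insert x V-{u}. (q u * \<bar>d u\<bar>) * (q v * \<bar>d v\<bar>)) \<ge> E"
      unfolding E_def using insert by (intro sum_mono sum_mono2) (auto intro!: mult_nonneg_nonneg)
    moreover have "(\<Sum>v\<in>insert x V-{x}. (q x * \<bar>d x\<bar>) * (q v * \<bar>d v\<bar>)) = (q x * \<bar>d x\<bar>) * K"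
      using \<open>insert x V - {x} = V\<close> by (simp add: K_def sum_distrib_left)
    ultimately show ?thesis using insert(1,2) by simp
  qed
  ultimately show ?case unfolding eq by linarith
qed simp

lemma attach_step_prod:
  assumes V: "{1..n} \<subseteq> V" "finite V" and f: "\<And>v x. 0 \<le> f v x \<and> f v x \<le> 1"
    and h: "\<And>v x. \<bar>f v (Suc x) - f v x\<bar> \<le> h v x"
  shows "\<bar>attach_step w n (\<lambda>z. \<Prod>v\<in>V. f v (z v)) z - (\<Prod>v\<in>V. vertex_step w n v (f v) (z v))\<bar>
     \<le> (\<Sum>u\<in>V. \<Sum>v\<in>V-{u}. attach_prob w n u * attach_prob w n v * (h u (z u) * h v (z v)))"
proof -
  let ?q = "attach_prob w n"
  let ?F = "\<lambda>z. \<Prod>v\<in>V. f v (z v)"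
  let ?d = "\<lambda>v. f v (Suc (z v)) - f v (z v)"
  have step: "?F (z(v := Suc (z v))) - ?F z = ?d v * (\<Prod>u\<in>V-{v}. f u (z u))" if "v \<in> V" for v
  proof -
    have "?F (z(v := Suc (z v))) = f v (Suc (z v)) * (\<Prod>u\<in>V-{v}. f u ((z(v := Suc (z v))) u))"
      using that V by (simp add: prod.remove)
    also have "(\<Prod>u\<in>V-{v}. f u ((z(v := Suc (z v))) u)) = (\<Prod>u\<in>V-{v}. f u (z u))"
      by (intro prod.cong) auto
    finally show ?thesis using that V by (simp add: prod.remove[of V v] algebra_simps)
  qed
  have "(\<Sum>v=1..n. ?q v * (?F (z(v := Suc (z v))) - ?F z)) = (\<Sum>v\<in>V. ?q v * (?F (z(v := Suc (z v))) - ?F z))"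
    using V by (intro sum.mono_neutral_left) (auto simp: attach_prob_def)
  also have "\<dots> = (\<Sum>v\<in>V. ?q v * (?d v * (\<Prod>u\<in>V-{v}. f u (z u))))"
    by (intro sum.cong refl arg_cong2[where f = "(*)"] step)
  finally have eq: "attach_step w n ?F z = ?F z + \<dots>" by (simp add: attach_step_def)
  have "\<bar>attach_step w n ?F z - (\<Prod>v\<in>V. vertex_step w n v (f v) (z v))\<bar>
          \<le> (\<Sum>u\<in>V. \<Sum>v\<in>V-{u}. (?q u * \<bar>?d u\<bar>) * (?q v * \<bar>?d v\<bar>))"
    unfolding eq vertex_step_def using V f
    by (intro prod_perturb) (auto simp: attach_prob_nonneg attach_prob_le_1)
  also have "\<dots> \<le> (\<Sum>u\<in>V. \<Sum>v\<in>V-{u}. (?q u * h u (z u)) * (?q v * h v (z v)))"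
    using h by (intro sum_mono mult_mono) (auto simp: attach_prob_nonneg intro!: mult_nonneg_nonneg order_trans[OF abs_ge_zero h])
  finally show ?thesis by (simp add: mult_ac)
qed

text \<open>Lindeberg-type replacement of the multinomial choices by independent Bernoulli choices, one
  step at a time. The error of step \<open>k\<close> requires both \<open>u\<close> and \<open>v\<close> to be hit at that step and to have
  in-degrees at which their factors still vary; negative dependence bounds that probability by a product.\<close>

lemma quenched_prod:
  assumes V: "{1..n} \<subseteq> V" "finite V" and f: "\<And>v x. 0 \<le> f v x \<and> f v x \<le> 1"
    and h: "\<And>v x. \<bar>f v (Suc x) - f v x\<bar> \<le> h v x" "\<And>v. mono (h v)"
  shows "\<bar>quenched_expectation w n (\<lambda>z. \<Prod>v\<in>V. f v (z v)) z - (\<Prod>v\<in>V. vertex_expectation w v n (f v) (z v))\<bar>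
     \<le> (\<Sum>k<n. \<Sum>u\<in>V. \<Sum>v\<in>V-{u}. attach_prob w k u * attach_prob w k v *
          (vertex_expectation w u n (h u) (z u) * vertex_expectation w v n (h v) (z v)))"
  using V(1) f h
proof (induction n arbitrary: f h)
  case (Suc n)
  let ?q = "attach_prob w"
  let ?G = "\<lambda>v. vertex_expectation w v (Suc n) (h v) (z v)"
  have h0: "0 \<le> h v x" for v x using order_trans[OF abs_ge_zero Suc.prems(3)] .
  have IH: "\<bar>quenched_expectation w n (\<lambda>z. \<Prod>v\<in>V. vertex_step w n v (f v) (z v)) z
        - (\<Prod>v\<in>V. vertex_expectation w v (Suc n) (f v) (z v))\<bar>
     \<le> (\<Sum>k<n. \<Sum>u\<in>V. \<Sum>v\<in>V-{u}. ?q k u * ?q k v * (?G u * ?G v))"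
    unfolding vertex_expectation.simps
  proof (rule Suc.IH)
    show "{1..n} \<subseteq> V" using Suc.prems(1) by auto
    show "0 \<le> vertex_step w n v (f v) x \<and> vertex_step w n v (f v) x \<le> 1" for v x
      using vertex_step_mono[of "\<lambda>_. 0" "f v" n v x] vertex_step_mono[of "f v" "\<lambda>_. 1" n v x] Suc.prems(2)
      by (auto simp: vertex_step_const)
    show "mono (vertex_step w n v (h v))" for v by (rule vertex_step_preserves_mono) fact
    show "\<bar>vertex_step w n v (f v) (Suc x) - vertex_step w n v (f v) x\<bar> \<le> vertex_step w n v (h v) x" for v x
    proof -
      have "vertex_step w n v (f v) (Suc x) - vertex_step w n v (f v) x
          = (1 - ?q n v) * (f v (Suc x) - f v x) + ?q n v * (f v (Suc (Suc x)) - f v (Suc x))"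
        by (simp add: vertex_step_def algebra_simps)
      also have "\<bar>\<dots>\<bar> \<le> \<bar>(1 - ?q n v) * (f v (Suc x) - f v x)\<bar> + \<bar>?q n v * (f v (Suc (Suc x)) - f v (Suc x))\<bar>"
        by (rule abs_triangle_ineq)
      also have "\<dots> \<le> (1 - ?q n v) * h v x + ?q n v * h v (Suc x)"
        using Suc.prems(3)
        by (auto simp: abs_mult attach_prob_nonneg attach_prob_le_1 intro!: add_mono mult_left_mono)
      finally show ?thesis by (simp add: vertex_step_altdef)
    qed
  qed
  have "\<bar>quenched_expectation w (Suc n) (\<lambda>z. \<Prod>v\<in>V. f v (z v)) z
        - quenched_expectation w n (\<lambda>z. \<Prod>v\<in>V. vertex_step w n v (f v) (z v)) z\<bar>
      \<le> quenched_expectation w n (\<lambda>z. \<Sum>u\<in>V. \<Sum>v\<in>V-{u}. ?q n u * ?q n v * (h u (z u) * h v (z v))) z"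
    unfolding quenched_expectation.simps
    using V Suc.prems by (intro quenched_abs_diff attach_step_prod) auto
  also have "\<dots> = (\<Sum>u\<in>V. \<Sum>v\<in>V-{u}. ?q n u * ?q n v * quenched_expectation w n (\<lambda>z. h u (z u) * h v (z v)) z)"
    by (simp add: quenched_sum quenched_scale)
  also have "\<dots> \<le> (\<Sum>u\<in>V. \<Sum>v\<in>V-{u}. ?q n u * ?q n v * (?G u * ?G v))"
  proof (intro sum_mono mult_left_mono)
    fix u v assume "u \<in> V" "v \<in> V - {u}"
    have le: "vertex_expectation w v n (h v) (z v) \<le> ?G v" for v
      unfolding vertex_expectation.simps using Suc.prems(4) by (intro vertex_mono vertex_step_ge)
    have "quenched_expectation w n (\<lambda>z. h u (z u) * h v (z v)) z
        \<le> vertex_expectation w u n (h u) (z u) * vertex_expectation w v n (h v) (z v)"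
      using \<open>v \<in> V - {u}\<close> Suc.prems(4) h0 by (intro quenched_pair_le) auto
    also have "\<dots> \<le> ?G u * ?G v"
      using le by (intro mult_mono vertex_nonneg h0) (auto simp del: vertex_expectation.simps intro: vertex_nonneg h0)
    finally show "quenched_expectation w n (\<lambda>z. h u (z u) * h v (z v)) z \<le> ?G u * ?G v" .
  qed (auto simp: attach_prob_nonneg)
  finally have D: "\<bar>quenched_expectation w (Suc n) (\<lambda>z. \<Prod>v\<in>V. f v (z v)) z
        - quenched_expectation w n (\<lambda>z. \<Prod>v\<in>V. vertex_step w n v (f v) (z v)) z\<bar>
      \<le> (\<Sum>u\<in>V. \<Sum>v\<in>V-{u}. ?q n u * ?q n v * (?G u * ?G v))" .
  show ?case
    using D IH by (simp del: vertex_expectation.simps quenched_expectation.simps)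
qed simp

end

section \<open>Tail probabilities of the degrees\<close>

text \<open>The probability that \<open>v\<close> has in-degree at least \<open>m\<close> in the tree with \<open>n\<close> vertices and weights \<open>w\<close>.\<close>

definition degree_tail :: "(nat \<Rightarrow> real) \<Rightarrow> nat \<Rightarrow> nat \<Rightarrow> nat \<Rightarrow> real" where
  "degree_tail w n v m = vertex_expectation w v n (\<lambda>x. if m \<le> x then 1 else 0) 0"

text \<open>With \<open>S\<^sub>k = w\<^sub>1 + \<dots> + w\<^sub>k\<close>, the function \<open>growth w y n / y ^ m\<close> is an exact solution of the recursion
  \<open>a (n + 1) (m + 1) = (1 - 1 / S\<^sub>n) * a n (m + 1) + a n m / S\<^sub>n\<close>.\<close>

definition growth :: "(nat \<Rightarrow> real) \<Rightarrow> real \<Rightarrow> nat \<Rightarrow> real" where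
  "growth w y n = (\<Prod>k\<in>{1..<n}. 1 + (y - 1) / (\<Sum>j=1..k. w j))"

context positive_weights begin

lemma degree_tail_init: "degree_tail w 0 v m = (if m = 0 then 1 else 0)"
  by (simp add: degree_tail_def)

lemma degree_tail_zero: "degree_tail w n v 0 = 1"
  by (simp add: degree_tail_def vertex_const)

lemma degree_tail_step:
  "degree_tail w (Suc n) v (Suc m) = degree_tail w n v (Suc m)
     + attach_prob w n v * (degree_tail w n v m - degree_tail w n v (Suc m))"
proof -
  let ?I = "\<lambda>m x. (if m \<le> x then 1 else 0 :: real)"
  have "vertex_step w n v (?I (Suc m))
          = (\<lambda>x. (1 - attach_prob w n v) * ?I (Suc m) x + attach_prob w n v * ?I m x)"
    by (auto simp: vertex_step_def fun_eq_iff)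
  then have "degree_tail w (Suc n) v (Suc m)
      = (1 - attach_prob w n v) * degree_tail w n v (Suc m) + attach_prob w n v * degree_tail w n v m"
    by (simp add: degree_tail_def vertex_add vertex_scale)
  then show ?thesis by (simp add: algebra_simps)
qed

lemma degree_tail_nonneg: "0 \<le> degree_tail w n v m"
  unfolding degree_tail_def by (rule vertex_nonneg) auto

lemma degree_tail_le_1: "degree_tail w n v m \<le> 1"
  using vertex_mono[of "\<lambda>x. if m \<le> x then 1 else 0" "\<lambda>_. 1" v n 0]
  by (simp add: degree_tail_def vertex_const)

lemma degree_tail_antimono: "degree_tail w n v (Suc m) \<le> degree_tail w n v m"
  unfolding degree_tail_def by (rule vertex_mono) auto

lemma degree_tail_eq_0: "0 < m \<Longrightarrow> n \<le> v \<or> n < m \<Longrightarrow> degree_tail w n v m = 0"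
proof (induction n arbitrary: m)
  case (Suc n)
  then obtain m' where m: "m = Suc m'" by (cases m) auto
  show ?case
  proof (cases "Suc n \<le> v")
    case True
    then show ?thesis using Suc.IH[of m] Suc.prems(1) by (simp add: m degree_tail_step attach_prob_def)
  next
    case False
    then have "n < m'" using Suc.prems m by auto
    then show ?thesis using Suc.IH[of m] Suc.IH[of m'] Suc.prems(1) by (simp add: m degree_tail_step)
  qed
qed (simp add: degree_tail_init)

lemma growth_ge_1: "1 \<le> y \<Longrightarrow> 1 \<le> growth w y n"
  unfolding growth_def using weight_sum_pos by (intro prod_ge_1) (auto simp: less_imp_le)

lemma growth_Suc: "1 \<le> n \<Longrightarrow> growth w y (Suc n) = growth w y n * (1 + (y - 1) / (\<Sum>j=1..n. w j))"
  by (simp add: growth_def)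

end

text \<open>Comparison principle for the linear recursion satisfied by expected tail counts: a
  supersolution that dominates at the initial time \<open>k0\<close> and on the boundary \<open>m = 0\<close> dominates
  everywhere.\<close>

lemma recursion_comparison:
  fixes A B :: "nat \<Rightarrow> nat \<Rightarrow> real"
  assumes c: "\<And>k. k0 \<le> k \<Longrightarrow> 0 \<le> c k \<and> c k \<le> 1"
    and A: "\<And>k m. k0 \<le> k \<Longrightarrow> A (Suc k) (Suc m) \<le> (1 - c k) * A k (Suc m) + c k * A k m"
    and B: "\<And>k m. k0 \<le> k \<Longrightarrow> (1 - c k) * B k (Suc m) + c k * B k m \<le> B (Suc k) (Suc m)"
    and init: "\<And>m. A k0 m \<le> B k0 m" and bdry: "\<And>k. k0 \<le> k \<Longrightarrow> A k 0 \<le> B k 0"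
    and "k0 \<le> n"
  shows "A n m \<le> B n m"
  using \<open>k0 \<le> n\<close>
proof (induction n arbitrary: m rule: dec_induct)
  case (step k)
  show ?case
  proof (cases m)
    case 0
    then show ?thesis using bdry[of "Suc k"] step by simp
  next
    case (Suc j)
    have "A (Suc k) (Suc j) \<le> (1 - c k) * A k (Suc j) + c k * A k j" using A step by simp
    also have "\<dots> \<le> (1 - c k) * B k (Suc j) + c k * B k j"
      using c[of k] step by (intro add_mono mult_left_mono) auto
    also have "\<dots> \<le> B (Suc k) (Suc j)" using B step by simp
    finally show ?thesis by (simp add: Suc)
  qed
qed (rule init)

text \<open>The properties of a weight sequence that hold almost surely and suffice for the quenched
  limit: the partial sums obey a law of large numbers with a polynomial rate, weight \<open>1\<close> has
  frequency \<open>q0\<close>, and weights close to \<open>1\<close> are hardly more frequent.\<close>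

locale typical_weights = positive_weights +
  fixes \<mu> q0 :: real
  assumes weight_le_1: "1 \<le> v \<Longrightarrow> w v \<le> 1"
    and mu_pos: "0 < \<mu>" and q0_pos: "0 < q0"
    and weight_sum_rate: "eventually (\<lambda>k. \<bar>(\<Sum>j=1..k. w j) - \<mu> * real k\<bar> \<le> real k powr (2/3)) sequentially"
    and frequency_one: "(\<lambda>k. real (card {v\<in>{1..k}. w v = 1}) / real k) \<longlonglongrightarrow> q0"
    and frequency_near_one: "0 < \<delta> \<Longrightarrow> \<exists>b. 0 < b \<and> b < 1 \<and>
      eventually (\<lambda>k. real (card {v\<in>{1..k}. b < w v}) \<le> (q0 + \<delta>) * real k) sequentially"
begin

abbreviation S :: "nat \<Rightarrow> real" where "S k \<equiv> (\<Sum>j=1..k. w j)"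

lemma weight_sum_lower: "eventually (\<lambda>k. \<mu> / 2 * real k \<le> S k) sequentially"
proof -
  have "eventually (\<lambda>k. real k powr (2/3) \<le> \<mu> / 2 * real k) sequentially"
    using mu_pos by real_asymp
  with weight_sum_rate show ?thesis
    by eventually_elim (auto simp: abs_le_iff)
qed

lemma weight_sum_ge: "eventually (\<lambda>k. C \<le> S k) sequentially"
proof -
  have "eventually (\<lambda>k. C \<le> \<mu> / 2 * real k) sequentially"
    using mu_pos by real_asymp
  with weight_sum_lower show ?thesis by eventually_elim simp
qed

text \<open>The rate in the law of large numbers makes \<open>ln (1 + (y - 1) / S k) - (y - 1) / \<mu> * ln (1 + 1 / k)\<close>
  summable, so \<open>growth\<close> has the exact order of a power, with a limiting constant.\<close>

lemma growth_asymp: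
  assumes y: "1 \<le> y"
  shows "\<exists>c>0. (\<lambda>n. growth w y n / real n powr ((y - 1) / \<mu>)) \<longlonglongrightarrow> c"
proof -
  define a where "a = (y - 1) / \<mu>"
  define t where "t k = ln (1 + (y - 1) / S k) - a * ln (1 + 1 / real k)" for k
  have a: "0 \<le> a" using y mu_pos by (simp add: a_def)
  define K where "K = (y - 1) * 2 / \<mu>^2 + (2 * a)^2 + a"
  have bound: "eventually (\<lambda>k. norm (t k) \<le> K * real k powr (-4/3)) sequentially"
  proof -
    have "eventually (\<lambda>k. 2 * a / real k \<le> 1) sequentially" by real_asymp
    moreover have "eventually (\<lambda>k. real k powr (-2) \<le> real k powr (-4/3)) sequentially" by real_asymp
    ultimately show ?thesis using weight_sum_rate weight_sum_lower eventually_ge_at_top[of 1]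
    proof eventually_elim
      case (elim k)
      have k: "0 < real k" using elim by simp
      have S: "0 < S k" using weight_sum_pos elim by simp
      have r: "(y - 1) / S k \<le> 2 * a / real k"
      proof -
        have "(y - 1) / S k \<le> (y - 1) / (\<mu> / 2 * real k)"
          using elim k y mu_pos S by (intro divide_left_mono) auto
        then show ?thesis using k mu_pos by (simp add: a_def field_simps)
      qed
      have r0: "0 \<le> (y - 1) / S k" using S y by simp
      have 1: "\<bar>ln (1 + (y - 1) / S k) - (y - 1) / S k\<bar> \<le> (2 * a)^2 * real k powr (-2)"
      proof -
        have "\<bar>ln (1 + (y - 1) / S k) - (y - 1) / S k\<bar> \<le> ((y - 1) / S k)^2"
          using order_trans[OF r elim(1)] r0 by (intro abs_ln_one_plus_x_minus_x_bound_nonneg)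
        also have "\<dots> \<le> (2 * a / real k)^2" using r r0 by (intro power_mono)
        also have "\<dots> = (2 * a)^2 * real k powr (-2)"
          using k by (simp add: powr_minus field_simps)
        finally show ?thesis .
      qed
      have 2: "\<bar>a * ln (1 + 1 / real k) - a / real k\<bar> \<le> a * real k powr (-2)"
      proof -
        have "\<bar>ln (1 + 1 / real k) - 1 / real k\<bar> \<le> (1 / real k)^2"
          using elim by (intro abs_ln_one_plus_x_minus_x_bound_nonneg) auto
        also have "\<dots> = real k powr (-2)" using k by (simp add: powr_minus field_simps)
        finally have "a * \<bar>ln (1 + 1 / real k) - 1 / real k\<bar> \<le> a * real k powr (-2)"
          using a by (intro mult_left_mono)
        also have "a * \<bar>ln (1 + 1 / real k) - 1 / real k\<bar> = \<bar>a * (ln (1 + 1 / real k) - 1 / real k)\<bar>"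
          using a by (simp add: abs_mult)
        finally show ?thesis by (simp add: right_diff_distrib)
      qed
      have 3: "\<bar>(y - 1) / S k - a / real k\<bar> \<le> (y - 1) * 2 / \<mu>^2 * real k powr (-4/3)"
      proof -
        have "(y - 1) / S k - a / real k = (y - 1) * (\<mu> * real k - S k) / (S k * (\<mu> * real k))"
          using S k mu_pos by (simp add: a_def field_simps)
        also have "\<bar>\<dots>\<bar> = (y - 1) * \<bar>S k - \<mu> * real k\<bar> / (S k * (\<mu> * real k))"
          using S k mu_pos y by (simp add: abs_mult abs_minus_commute)
        also have "\<dots> \<le> (y - 1) * real k powr (2/3) / ((\<mu> / 2 * real k) * (\<mu> * real k))"
          using elim S k mu_pos y by (intro frac_le mult_left_mono mult_right_mono) auto
        also have "\<dots> = (y - 1) * 2 / \<mu>^2 * (real k powr (2/3) / real k ^ 2)"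
          using k mu_pos by (simp add: field_simps power2_eq_square)
        also have "real k powr (2/3) / real k ^ 2 = real k powr (2/3 - 2)"
          unfolding powr_diff using k by simp
        finally show ?thesis by simp
      qed
      have "norm (t k) \<le> \<bar>ln (1 + (y - 1) / S k) - (y - 1) / S k\<bar> + \<bar>(y - 1) / S k - a / real k\<bar>
             + \<bar>a * ln (1 + 1 / real k) - a / real k\<bar>"
        unfolding t_def real_norm_def by linarith
      also have "\<dots> \<le> (2 * a)^2 * real k powr (-2) + (y - 1) * 2 / \<mu>^2 * real k powr (-4/3) + a * real k powr (-2)"
        using 1 2 3 by linarith
      also have "\<dots> \<le> (2 * a)^2 * real k powr (-4/3) + (y - 1) * 2 / \<mu>^2 * real k powr (-4/3) + a * real k powr (-4/3)"
        using elim a y by (intro add_mono mult_left_mono order_refl) auto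
      finally show ?case by (simp add: K_def algebra_simps)
    qed
  qed
  have "summable (\<lambda>k. K * real k powr (-4/3))"
    by (intro summable_mult) (simp add: summable_real_powr_iff)
  then have "summable t"
    using bound by (rule summable_comparison_test_ev[rotated])
  then have "summable (\<lambda>k. t (Suc k))" by (subst summable_Suc_iff)
  then obtain L where "(\<lambda>k. t (Suc k)) sums L" by (auto simp: summable_def)
  then have "(\<lambda>n. exp (\<Sum>k<n. t (Suc k))) \<longlonglongrightarrow> exp L"
    unfolding sums_def by (intro tendsto_intros)
  moreover have eq: "exp (\<Sum>k<n. t (Suc k)) = growth w y (Suc n) / real (Suc n) powr a" for n
  proof (induction n)
    case 0 show ?case by (simp add: growth_def)
  next
    case (Suc n)
    have S: "0 < S (Suc n)" by (rule weight_sum_pos) simp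
    have "exp (t (Suc n)) = (1 + (y - 1) / S (Suc n)) / exp (a * ln (1 + 1 / real (Suc n)))"
    proof -
      have "0 < 1 + (y - 1) / S (Suc n)" using S y by (intro add_pos_nonneg) auto
      then show ?thesis by (simp add: t_def exp_diff)
    qed
    also have "exp (a * ln (1 + 1 / real (Suc n))) = (1 + 1 / real (Suc n)) powr a"
      using less_imp_neq[of 0 "1 + 1 / real (Suc n)"] by (simp add: powr_def add_pos_pos)
    also have "1 + 1 / real (Suc n) = real (Suc (Suc n)) / real (Suc n)"
      by (simp add: field_simps)
    also have "\<dots> powr a = real (Suc (Suc n)) powr a / real (Suc n) powr a"
      by (rule powr_divide)
    finally have e: "exp (t (Suc n)) = (1 + (y - 1) / S (Suc n)) * (real (Suc n) powr a / real (Suc (Suc n)) powr a)"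
      by simp
    have "exp (\<Sum>k<Suc n. t (Suc k)) = growth w y (Suc n) / real (Suc n) powr a * exp (t (Suc n))"
      using Suc by (simp add: exp_add)
    also have "\<dots> = growth w y (Suc n) * (1 + (y - 1) / S (Suc n)) / real (Suc (Suc n)) powr a"
      unfolding e by simp
    also have "\<dots> = growth w y (Suc (Suc n)) / real (Suc (Suc n)) powr a"
      by (simp add: growth_Suc)
    finally show ?case .
  qed
  ultimately have "(\<lambda>n. growth w y (Suc n) / real (Suc n) powr a) \<longlonglongrightarrow> exp L" by simp
  then have "(\<lambda>n. growth w y n / real n powr a) \<longlonglongrightarrow> exp L"
    by (rule LIMSEQ_imp_Suc)
  then show ?thesis unfolding a_def by (intro exI[of _ "exp L"]) auto
qed

text \<open>The expected number of vertices in the class \<open>C\<close> with in-degree at least \<open>m\<close>.\<close>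

definition class_tail :: "nat set \<Rightarrow> nat \<Rightarrow> nat \<Rightarrow> real" where
  "class_tail C n m = (\<Sum>v\<in>C\<inter>{1..n}. degree_tail w n v m)"

lemma class_tail_zero: "class_tail C n 0 = real (card (C \<inter> {1..n}))"
  by (simp add: class_tail_def degree_tail_zero)

lemma class_tail_step:
  assumes "1 \<le> n"
  shows "class_tail C (Suc n) (Suc m) = class_tail C n (Suc m)
    + (\<Sum>v\<in>C\<inter>{1..n}. w v / S n * (degree_tail w n v m - degree_tail w n v (Suc m)))"
proof -
  have "class_tail C (Suc n) (Suc m) = (\<Sum>v\<in>C\<inter>{1..n}. degree_tail w (Suc n) v (Suc m))"
    unfolding class_tail_def
    by (intro sum.mono_neutral_right) (auto simp: not_le intro!: degree_tail_eq_0)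
  also have "\<dots> = (\<Sum>v\<in>C\<inter>{1..n}. degree_tail w n v (Suc m)
      + w v / S n * (degree_tail w n v m - degree_tail w n v (Suc m)))"
    by (intro sum.cong) (auto simp: degree_tail_step attach_prob_def)
  finally show ?thesis by (simp add: class_tail_def sum.distrib)
qed

lemma class_tail_step_le:
  assumes "1 \<le> n" "\<And>v. v \<in> C \<Longrightarrow> w v \<le> b"
  shows "class_tail C (Suc n) (Suc m) \<le> (1 - b / S n) * class_tail C n (Suc m) + b / S n * class_tail C n m"
proof -
  have "(\<Sum>v\<in>C\<inter>{1..n}. w v / S n * (degree_tail w n v m - degree_tail w n v (Suc m)))
      \<le> (\<Sum>v\<in>C\<inter>{1..n}. b / S n * (degree_tail w n v m - degree_tail w n v (Suc m)))"
    using assms weight_sum_pos[OF assms(1)] degree_tail_antimono[of n _ m]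
    by (intro sum_mono mult_right_mono divide_right_mono) auto
  also have "\<dots> = b / S n * (class_tail C n m - class_tail C n (Suc m))"
    by (simp add: class_tail_def sum_distrib_left sum_subtractf right_diff_distrib)
  finally show ?thesis by (simp add: class_tail_step[OF assms(1)] algebra_simps)
qed

lemma class_tail_step_eq:
  assumes "1 \<le> n" "\<And>v. v \<in> C \<Longrightarrow> w v = 1"
  shows "class_tail C (Suc n) (Suc m) = (1 - 1 / S n) * class_tail C n (Suc m) + 1 / S n * class_tail C n m"
proof -
  have "(\<Sum>v\<in>C\<inter>{1..n}. w v / S n * (degree_tail w n v m - degree_tail w n v (Suc m)))
      = (\<Sum>v\<in>C\<inter>{1..n}. 1 / S n * (degree_tail w n v m - degree_tail w n v (Suc m)))"
    using assms by (intro sum.cong) auto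
  also have "\<dots> = 1 / S n * (class_tail C n m - class_tail C n (Suc m))"
    by (simp add: class_tail_def sum_distrib_left sum_subtractf right_diff_distrib)
  finally show ?thesis by (simp add: class_tail_step[OF assms(1)] algebra_simps)
qed

lemma class_tail_nonneg: "0 \<le> class_tail C n m"
  unfolding class_tail_def by (intro sum_nonneg degree_tail_nonneg)

lemma class_tail_le: "class_tail C n m \<le> real n"
proof -
  have "class_tail C n m \<le> (\<Sum>v\<in>C\<inter>{1..n}. 1)"
    unfolding class_tail_def by (intro sum_mono degree_tail_le_1)
  also have "\<dots> = real (card (C\<inter>{1..n}))" by simp
  also have "\<dots> \<le> real (card {1..n})" by (intro of_nat_mono card_mono) auto
  finally show ?thesis by simp
qed

lemma class_tail_eq_0: "n < m \<Longrightarrow> class_tail C n m = 0"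
  unfolding class_tail_def by (intro sum.neutral) (auto intro!: degree_tail_eq_0)

text \<open>\<open>error_bound\<close> is the solution with base \<open>sqrt (1 + \<mu>)\<close>. It decays more slowly in \<open>m\<close> than the main
  solution with base \<open>1 + \<mu>\<close>, so that a constant multiple of it dominates the initial values at a
  fixed time. Yet it vanishes if \<open>(1 + \<mu>) ^ m\<close> is of order \<open>n\<close>: there it is of order
  \<open>n powr (1 / (sqrt (1 + \<mu>) + 1) - 1 / 2)\<close>, with a negative exponent.\<close>

definition x0 :: real where "x0 = sqrt (1 + \<mu>)"

definition error_bound :: "nat \<Rightarrow> nat \<Rightarrow> real" where
  "error_bound n m = growth w x0 n / x0 ^ m"

lemma x0_gt_1: "1 < x0" using mu_pos by (simp add: x0_def)

lemma x0_sq: "x0 ^ 2 = 1 + \<mu>" using mu_pos by (simp add: x0_def)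

lemma x0_le: "x0 \<le> 1 + \<mu>"
proof -
  have "x0 * 1 \<le> x0 * x0" using x0_gt_1 by (intro mult_left_mono) auto
  then show ?thesis using x0_sq by (simp add: power2_eq_square)
qed

lemma error_bound_pos: "0 < error_bound n m"
  using growth_ge_1[of x0 n] x0_gt_1 by (simp add: error_bound_def)

lemma error_bound_zero: "1 \<le> error_bound n 0"
  using growth_ge_1[of x0 n] x0_gt_1 by (simp add: error_bound_def)

lemma power_solution:
  assumes "1 \<le> n" "0 < y"
  shows "(1 - c / S n) * (g / y ^ Suc m) + c / S n * (g / y ^ m) = g * (1 + (y - 1) * c / S n) / y ^ Suc m"
  using assms weight_sum_pos[of n] by (simp add: field_simps)

lemma error_bound_step:
  assumes "1 \<le> n" "0 \<le> b" "b \<le> 1"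
  shows "(1 - b / S n) * error_bound n (Suc m) + b / S n * error_bound n m \<le> error_bound (Suc n) (Suc m)"
proof -
  have "(1 - b / S n) * error_bound n (Suc m) + b / S n * error_bound n m
      = growth w x0 n * (1 + (x0 - 1) * b / S n) / x0 ^ Suc m"
    unfolding error_bound_def using assms x0_gt_1 by (intro power_solution) auto
  also have "\<dots> \<le> growth w x0 n * (1 + (x0 - 1) / S n) / x0 ^ Suc m"
  proof -
    have "(x0 - 1) * b \<le> (x0 - 1) * 1" using assms x0_gt_1 by (intro mult_left_mono) auto
    then show ?thesis
      using growth_ge_1[of x0 n] x0_gt_1 weight_sum_pos[OF assms(1)]
      by (intro divide_right_mono mult_left_mono add_left_mono) auto
  qed
  finally show ?thesis using assms by (simp add: error_bound_def growth_Suc)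
qed

lemma error_bound_step_eq:
  assumes "1 \<le> n"
  shows "(1 - 1 / S n) * error_bound n (Suc m) + 1 / S n * error_bound n m = error_bound (Suc n) (Suc m)"
  using power_solution[of n x0 1 "growth w x0 n" m] assms x0_gt_1
  by (simp add: error_bound_def growth_Suc)

lemma error_bound_init:
  assumes "m \<le> k"
  shows "1 \<le> x0 ^ k * error_bound k m"
proof -
  have "1 * 1 \<le> growth w x0 k * x0 ^ (k - m)"
    using growth_ge_1[of x0 k] x0_gt_1 by (intro mult_mono) auto
  also have "\<dots> = x0 ^ k * error_bound k m"
    using assms x0_gt_1 by (simp add: error_bound_def power_diff)
  finally show ?thesis by simp
qed

lemma main_solution_step:
  assumes "1 \<le> n" "0 < b"
  shows "(1 - b / S n) * (growth w (1 + \<mu>) n / (1 + \<mu> / b) ^ Suc m) + b / S n * (growth w (1 + \<mu>) n / (1 + \<mu> / b) ^ m)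
    = growth w (1 + \<mu>) (Suc n) / (1 + \<mu> / b) ^ Suc m"
proof -
  have "0 < 1 + \<mu> / b" using assms mu_pos by (simp add: add_pos_pos)
  then show ?thesis
    using power_solution[of n "1 + \<mu> / b" b "growth w (1 + \<mu>) n" m] assms by (simp add: growth_Suc)
qed

text \<open>For weights at most \<open>b\<close>, the tail counts are subsolutions of the recursion with \<open>b / S n\<close> in place of
  \<open>1 / S n\<close>. The base \<open>1 + \<mu> / b\<close> then gives a solution with the same factor \<open>growth w (1 + \<mu>)\<close>, so
  that weights bounded away from \<open>1\<close> are negligible at the scale \<open>(1 + \<mu>) ^ m\<close>.\<close>

lemma class_tail_upper:
  assumes b: "0 < b" "b \<le> 1" "\<And>v. v \<in> C \<Longrightarrow> w v \<le> b" and "0 \<le> \<kappa>"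
    and freq: "eventually (\<lambda>k. real (card (C \<inter> {1..k})) \<le> \<kappa> * growth w (1 + \<mu>) k) sequentially"
  shows "\<exists>K. eventually (\<lambda>n. \<forall>m. class_tail C n m
           \<le> \<kappa> * (growth w (1 + \<mu>) n / (1 + \<mu> / b) ^ m) + K * error_bound n m) sequentially"
proof -
  from eventually_conj[OF freq eventually_conj[OF weight_sum_ge[of 1] eventually_ge_at_top[of 1]]]
  obtain k0 where k0: "\<And>k. k0 \<le> k \<Longrightarrow> real (card (C \<inter> {1..k})) \<le> \<kappa> * growth w (1 + \<mu>) k"
      "\<And>k. k0 \<le> k \<Longrightarrow> 1 \<le> S k" "\<And>k. k0 \<le> k \<Longrightarrow> 1 \<le> k"
    unfolding eventually_at_top_linorder by blast
  define K where "K = real k0 * x0 ^ k0"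
  have K: "0 \<le> K" using x0_gt_1 by (simp add: K_def)
  let ?g = "\<lambda>n m. growth w (1 + \<mu>) n / (1 + \<mu> / b) ^ m"
  have g0: "0 \<le> ?g n m" for n m
    using growth_ge_1[of "1 + \<mu>" n] mu_pos b by (intro divide_nonneg_nonneg zero_le_power) auto
  have "class_tail C n m \<le> \<kappa> * ?g n m + K * error_bound n m" if "k0 \<le> n" for n m
  proof (rule recursion_comparison[where A = "class_tail C" and c = "\<lambda>k. b / S k" and ?k0.0 = k0])
    show "0 \<le> b / S k \<and> b / S k \<le> 1" if "k0 \<le> k" for k
      using k0(2)[OF that] b by (auto simp: divide_le_eq)
    show "class_tail C (Suc k) (Suc m) \<le> (1 - b / S k) * class_tail C k (Suc m) + b / S k * class_tail C k m"
      if "k0 \<le> k" for k m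
      using k0(3)[OF that] b by (intro class_tail_step_le) auto
    show "(1 - b / S k) * (\<kappa> * ?g k (Suc m) + K * error_bound k (Suc m)) + b / S k * (\<kappa> * ?g k m + K * error_bound k m)
        \<le> \<kappa> * ?g (Suc k) (Suc m) + K * error_bound (Suc k) (Suc m)" if "k0 \<le> k" for k m
    proof -
      have k: "1 \<le> k" using k0(3)[OF that] .
      have "(1 - b / S k) * (\<kappa> * ?g k (Suc m) + K * error_bound k (Suc m)) + b / S k * (\<kappa> * ?g k m + K * error_bound k m)
        = \<kappa> * ((1 - b / S k) * ?g k (Suc m) + b / S k * ?g k m)
          + K * ((1 - b / S k) * error_bound k (Suc m) + b / S k * error_bound k m)"
        by (simp only: distrib_left mult_ac)
      also have "\<dots> \<le> \<kappa> * ?g (Suc k) (Suc m) + K * error_bound (Suc k) (Suc m)"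
        unfolding main_solution_step[OF k b(1)] using error_bound_step[OF k, of b m] b K
        by (intro add_mono mult_left_mono order_refl) auto
      finally show ?thesis .
    qed
    show "class_tail C k0 m \<le> \<kappa> * ?g k0 m + K * error_bound k0 m" for m
    proof (cases "m \<le> k0")
      case True
      have "real k0 * 1 \<le> real k0 * (x0 ^ k0 * error_bound k0 m)"
        using error_bound_init[OF True] by (intro mult_left_mono) auto
      then have "class_tail C k0 m \<le> K * error_bound k0 m"
        using class_tail_le[of C k0 m] by (simp add: K_def)
      then show ?thesis using mult_nonneg_nonneg[OF \<open>0 \<le> \<kappa>\<close> g0[of k0 m]] by linarith
    next
      case False
      then show ?thesis
        using mult_nonneg_nonneg[OF \<open>0 \<le> \<kappa>\<close> g0[of k0 m]] mult_nonneg_nonneg[OF K less_imp_le[OF error_bound_pos[of k0 m]]]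
        by (simp add: class_tail_eq_0)
    qed
    show "class_tail C k 0 \<le> \<kappa> * ?g k 0 + K * error_bound k 0" if "k0 \<le> k" for k
      using k0(1)[OF that] K error_bound_pos[of k 0] by (simp add: class_tail_zero add_increasing2)
  qed (fact that)
  then show ?thesis
    unfolding eventually_at_top_linorder by blast
qed

lemma class_tail_lower:
  assumes C: "\<And>v. v \<in> C \<Longrightarrow> w v = 1" and "0 \<le> \<kappa>"
    and freq: "eventually (\<lambda>k. \<kappa> * growth w (1 + \<mu>) k \<le> real (card (C \<inter> {1..k}))) sequentially"
  shows "\<exists>K. eventually (\<lambda>n. \<forall>m. 
           \<kappa> * (growth w (1 + \<mu>) n / (1 + \<mu>) ^ m) - K * error_bound n m \<le> class_tail C n m) sequentially"
proof -
  from eventually_conj[OF freq eventually_conj[OF weight_sum_ge[of 1] eventually_ge_at_top[of 1]]]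
  obtain k0 where k0: "\<And>k. k0 \<le> k \<Longrightarrow> \<kappa> * growth w (1 + \<mu>) k \<le> real (card (C \<inter> {1..k}))"
      "\<And>k. k0 \<le> k \<Longrightarrow> 1 \<le> S k" "\<And>k. k0 \<le> k \<Longrightarrow> 1 \<le> k"
    unfolding eventually_at_top_linorder by blast
  define K where "K = \<kappa> * growth w (1 + \<mu>) k0"
  have K: "0 \<le> K" using \<open>0 \<le> \<kappa>\<close> growth_ge_1[of "1 + \<mu>" k0] mu_pos by (simp add: K_def)
  let ?g = "\<lambda>n m. growth w (1 + \<mu>) n / (1 + \<mu>) ^ m"
  have "\<kappa> * ?g n m - K * error_bound n m \<le> class_tail C n m" if "k0 \<le> n" for n m
  proof (rule recursion_comparison[where B = "class_tail C" and c = "\<lambda>k. 1 / S k" and ?k0.0 = k0])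
    show "0 \<le> 1 / S k \<and> 1 / S k \<le> 1" if "k0 \<le> k" for k
      using k0(2)[OF that] by (auto simp: divide_le_eq)
    show "(1 - 1 / S k) * class_tail C k (Suc m) + 1 / S k * class_tail C k m \<le> class_tail C (Suc k) (Suc m)"
      if "k0 \<le> k" for k m
      using class_tail_step_eq[OF k0(3)[OF that], of C m] C by simp
    show "\<kappa> * ?g (Suc k) (Suc m) - K * error_bound (Suc k) (Suc m)
        \<le> (1 - 1 / S k) * (\<kappa> * ?g k (Suc m) - K * error_bound k (Suc m)) + 1 / S k * (\<kappa> * ?g k m - K * error_bound k m)"
      if "k0 \<le> k" for k m
    proof -
      have k: "1 \<le> k" using k0(3)[OF that] .
      have "(1 - 1 / S k) * (\<kappa> * ?g k (Suc m) - K * error_bound k (Suc m)) + 1 / S k * (\<kappa> * ?g k m - K * error_bound k m)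
        = \<kappa> * ((1 - 1 / S k) * ?g k (Suc m) + 1 / S k * ?g k m)
          - K * ((1 - 1 / S k) * error_bound k (Suc m) + 1 / S k * error_bound k m)"
        by (simp only: right_diff_distrib distrib_left mult_ac add_diff_eq diff_add_eq diff_diff_add)
      also have "\<dots> = \<kappa> * ?g (Suc k) (Suc m) - K * error_bound (Suc k) (Suc m)"
        using error_bound_step_eq[OF k, of m] main_solution_step[OF k, of 1 m] by simp
      finally show ?thesis by simp
    qed
    show "\<kappa> * ?g k0 m - K * error_bound k0 m \<le> class_tail C k0 m" for m
    proof -
      have "\<kappa> * ?g k0 m = K * (1 / (1 + \<mu>) ^ m)" by (simp add: K_def)
      also have "\<dots> \<le> K * error_bound k0 m"
        unfolding error_bound_def using K x0_gt_1 x0_le growth_ge_1[of x0 k0]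
        by (intro mult_left_mono frac_le power_mono) auto
      finally show ?thesis using class_tail_nonneg[of C k0 m] by simp
    qed
    show "\<kappa> * ?g k 0 - K * error_bound k 0 \<le> class_tail C k 0" if "k0 \<le> k" for k
      using k0(1)[OF that] mult_nonneg_nonneg[OF K less_imp_le[OF error_bound_pos[of k 0]]]
      by (simp add: class_tail_zero)
  qed (fact that)
  then show ?thesis
    unfolding eventually_at_top_linorder by blast
qed

text \<open>Since \<open>error_bound\<close> vanishes on the relevant scale, no single vertex contributes to the limit.\<close>

lemma degree_tail_uniform:
  "\<exists>K\<ge>0. eventually (\<lambda>n. \<forall>v m. degree_tail w n v m \<le> K * error_bound n m) sequentially"
proof -
  from eventually_conj[OF weight_sum_ge[of 1] eventually_ge_at_top[of 1]]
  obtain k0 where k0: "\<And>k. k0 \<le> k \<Longrightarrow> 1 \<le> S k" "\<And>k. k0 \<le> k \<Longrightarrow> 1 \<le> k"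
    unfolding eventually_at_top_linorder by blast
  define K where "K = x0 ^ k0"
  have K: "1 \<le> K" using x0_gt_1 by (simp add: K_def)
  have "degree_tail w n v m \<le> K * error_bound n m" if "k0 \<le> n" for n v m
  proof (rule recursion_comparison[where A = "\<lambda>n m. degree_tail w n v m" and c = "\<lambda>k. 1 / S k" and ?k0.0 = k0])
    show "0 \<le> 1 / S k \<and> 1 / S k \<le> 1" if "k0 \<le> k" for k
      using k0(1)[OF that] by (auto simp: divide_le_eq)
    show "degree_tail w (Suc k) v (Suc m) \<le> (1 - 1 / S k) * degree_tail w k v (Suc m) + 1 / S k * degree_tail w k v m"
      if "k0 \<le> k" for k m
    proof -
      have "attach_prob w k v \<le> 1 / S k"
        using k0(1)[OF that] weight_le_1[of v] by (auto simp: attach_prob_def intro: divide_right_mono)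
      then have "attach_prob w k v * (degree_tail w k v m - degree_tail w k v (Suc m))
          \<le> 1 / S k * (degree_tail w k v m - degree_tail w k v (Suc m))"
        using degree_tail_antimono[of k v m] by (intro mult_right_mono) auto
      then show ?thesis by (simp add: degree_tail_step algebra_simps)
    qed
    show "(1 - 1 / S k) * (K * error_bound k (Suc m)) + 1 / S k * (K * error_bound k m) \<le> K * error_bound (Suc k) (Suc m)"
      if "k0 \<le> k" for k m
      unfolding error_bound_step_eq[OF k0(2)[OF that], of m, symmetric] by (simp add: algebra_simps)
    show "degree_tail w k0 v m \<le> K * error_bound k0 m" for m
    proof (cases "m \<le> k0")
      case True
      then show ?thesis using error_bound_init[OF True] degree_tail_le_1[of k0 v m] by (simp add: K_def)
    next
      case False
      then show ?thesis using K error_bound_pos[of k0 m] by (simp add: degree_tail_eq_0)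
    qed
    show "degree_tail w k v 0 \<le> K * error_bound k 0" if "k0 \<le> k" for k
      using mult_mono[OF K error_bound_zero[of k]] K by (simp add: degree_tail_zero)
  qed (fact that)
  then have "\<forall>n\<ge>k0. \<forall>v m. degree_tail w n v m \<le> K * error_bound n m" by blast
  then show ?thesis
    using K unfolding eventually_at_top_linorder by (intro exI[of _ K]) auto
qed

end

context typical_weights begin

lemma error_bound_rate:
  "\<exists>C. \<forall>B\<ge>0. eventually (\<lambda>n. \<forall>m. real n / (1 + \<mu>) ^ m \<le> B \<longrightarrow>
       error_bound n m \<le> C * sqrt B * real n powr (1 / (x0 + 1) - 1 / 2)) sequentially"
proof -
  have a: "(x0 - 1) / \<mu> = 1 / (x0 + 1)"
  proof -
    have "(x0 - 1) * (x0 + 1) = \<mu>" using x0_sq by (simp add: algebra_simps power2_eq_square)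
    then show ?thesis using mu_pos x0_gt_1 by (simp add: field_simps)
  qed
  obtain c where c: "0 < c" "(\<lambda>n. growth w x0 n / real n powr (1 / (x0 + 1))) \<longlonglongrightarrow> c"
    using growth_asymp[of x0] x0_gt_1 unfolding a by auto
  then have ev: "eventually (\<lambda>n. growth w x0 n / real n powr (1 / (x0 + 1)) < c + 1) sequentially"
    by (intro order_tendstoD(2)) auto
  have "eventually (\<lambda>n. \<forall>m. real n / (1 + \<mu>) ^ m \<le> B \<longrightarrow>
       error_bound n m \<le> (c + 1) * sqrt B * real n powr (1 / (x0 + 1) - 1 / 2)) sequentially"
    if B: "0 \<le> B" for B
    using ev eventually_gt_at_top[of 0]
  proof eventually_elim
    case (elim n)
    show ?case
    proof (intro allI impI)
      fix m assume m: "real n / (1 + \<mu>) ^ m \<le> B"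
      have n: "0 < real n" using elim by simp
      have 1: "growth w x0 n \<le> (c + 1) * real n powr (1 / (x0 + 1))"
        using elim n by (simp add: divide_less_eq)
      have "(x0 ^ m) ^ 2 = (1 + \<mu>) ^ m" by (metis x0_sq power_mult mult.commute)
      then have "x0 ^ m = sqrt ((1 + \<mu>) ^ m)" using x0_gt_1 by (simp add: real_sqrt_unique)
      then have "1 / x0 ^ m = sqrt (1 / (1 + \<mu>) ^ m)" by (simp add: real_sqrt_divide)
      also have "\<dots> \<le> sqrt (B / real n)"
        using m n by (intro real_sqrt_le_mono) (simp add: field_simps)
      also have "\<dots> = sqrt B * real n powr (- 1 / 2)"
        using n by (simp add: real_sqrt_divide powr_minus powr_half_sqrt divide_simps)
      finally have 2: "1 / x0 ^ m \<le> sqrt B * real n powr (- 1 / 2)" .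
      have "error_bound n m = growth w x0 n * (1 / x0 ^ m)" by (simp add: error_bound_def)
      also have "\<dots> \<le> ((c + 1) * real n powr (1 / (x0 + 1))) * (sqrt B * real n powr (- 1 / 2))"
        using 1 2 c(1) x0_gt_1 by (intro mult_mono) auto
      also have "\<dots> = (c + 1) * sqrt B * (real n powr (1 / (x0 + 1)) * real n powr (- 1 / 2))"
        by (simp only: mult_ac)
      also have "real n powr (1 / (x0 + 1)) * real n powr (- 1 / 2) = real n powr (1 / (x0 + 1) - 1 / 2)"
        by (simp flip: powr_add)
      finally show "error_bound n m \<le> (c + 1) * sqrt B * real n powr (1 / (x0 + 1) - 1 / 2)" .
    qed
  qed
  then show ?thesis by blast
qed

context
  fixes nn mm :: "nat \<Rightarrow> nat" and L :: real
  assumes nn: "filterlim nn at_top sequentially" and mm: "filterlim mm at_top sequentially"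
    and L: "0 < L" "(\<lambda>l. real (nn l) / (1 + \<mu>) ^ mm l) \<longlonglongrightarrow> L"
begin

lemma error_bound_vanishes:
  "(\<lambda>l. error_bound (nn l) (mm l) * (1 + ln (real (nn l)))) \<longlonglongrightarrow> 0"
proof -
  obtain C where C: "\<And>B. 0 \<le> B \<Longrightarrow> eventually (\<lambda>n. \<forall>m. real n / (1 + \<mu>) ^ m \<le> B \<longrightarrow>
       error_bound n m \<le> C * sqrt B * real n powr (1 / (x0 + 1) - 1 / 2)) sequentially"
    using error_bound_rate by blast
  define \<gamma> where "\<gamma> = 1 / (x0 + 1) - 1 / 2"
  have \<gamma>: "\<gamma> < 0" using x0_gt_1 by (simp add: \<gamma>_def field_simps)
  define B where "B = L + 1"
  have "eventually (\<lambda>l. real (nn l) / (1 + \<mu>) ^ mm l < B) sequentially"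
    using L by (intro order_tendstoD(2)[OF L(2)]) (auto simp: B_def)
  moreover have "eventually (\<lambda>l. \<forall>m. real (nn l) / (1 + \<mu>) ^ m \<le> B \<longrightarrow>
       error_bound (nn l) m \<le> C * sqrt B * real (nn l) powr \<gamma>) sequentially"
    using filterlim_iff[THEN iffD1, OF nn, rule_format, OF C[of B]] L by (simp add: B_def \<gamma>_def)
  moreover have "eventually (\<lambda>l. 1 \<le> nn l) sequentially"
    using nn by (simp add: filterlim_at_top)
  ultimately have ev: "eventually (\<lambda>l. norm (error_bound (nn l) (mm l) * (1 + ln (real (nn l))))
       \<le> C * sqrt B * real (nn l) powr \<gamma> * (1 + ln (real (nn l)))) sequentially"
  proof eventually_elim
    case (elim l)
    have "error_bound (nn l) (mm l) \<le> C * sqrt B * real (nn l) powr \<gamma>" using elim by simp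
    moreover have "0 \<le> ln (real (nn l))" using elim by simp
    ultimately show ?case using error_bound_pos[of "nn l" "mm l"]
      by (simp add: abs_mult mult_right_mono)
  qed
  have "(\<lambda>n. C * sqrt B * real n powr \<gamma> * (1 + ln (real n))) \<longlonglongrightarrow> 0"
    using \<gamma> by real_asymp
  from filterlim_compose[OF this nn]
  have "(\<lambda>l. C * sqrt B * real (nn l) powr \<gamma> * (1 + ln (real (nn l)))) \<longlonglongrightarrow> 0"
    by simp
  with ev show ?thesis by (rule Lim_null_comparison)
qed

lemma error_bound_vanishes': "(\<lambda>l. error_bound (nn l) (mm l)) \<longlonglongrightarrow> 0"
proof (rule Lim_null_comparison[OF _ error_bound_vanishes])
  have "eventually (\<lambda>l. 1 \<le> nn l) sequentially"
    using nn by (simp add: filterlim_at_top)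
  then show "eventually (\<lambda>l. norm (error_bound (nn l) (mm l)) \<le> error_bound (nn l) (mm l) * (1 + ln (real (nn l)))) sequentially"
  proof eventually_elim
    case (elim l)
    then have "error_bound (nn l) (mm l) * 1 \<le> error_bound (nn l) (mm l) * (1 + ln (real (nn l)))"
      using error_bound_pos[of "nn l" "mm l"] by (intro mult_left_mono) auto
    then show ?case using error_bound_pos[of "nn l" "mm l"] by simp
  qed
qed

text \<open>The expected number of vertices of in-degree at least \<open>m\<close> is asymptotic to \<open>q0 * n / (1 + \<mu>) ^ m\<close>
  when \<open>n / (1 + \<mu>) ^ m\<close> converges to a positive limit: the vertices of weight \<open>1\<close> give the lower bound, those of weight above \<open>b\<close> the upper bound as \<open>b\<close>
  tends to \<open>1\<close>, and the contribution of weights at most \<open>b\<close> vanishes.\<close>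

lemma first_moment:
  "(\<lambda>l. \<Sum>v=1..nn l. degree_tail w (nn l) v (mm l)) \<longlonglongrightarrow> q0 * L"
proof -
  let ?T = "\<lambda>l. \<Sum>v=1..nn l. degree_tail w (nn l) v (mm l)"
  let ?\<phi> = "growth w (1 + \<mu>)"
  obtain c where c: "0 < c" and "(\<lambda>n. ?\<phi> n / real n powr (\<mu> / \<mu>)) \<longlonglongrightarrow> c"
    using growth_asymp[of "1 + \<mu>"] mu_pos by auto
  then have \<phi>: "(\<lambda>n. ?\<phi> n / real n) \<longlonglongrightarrow> c" using mu_pos by simp
  then have \<phi>l: "(\<lambda>l. ?\<phi> (nn l) / real (nn l)) \<longlonglongrightarrow> c"
    by (rule filterlim_compose[OF _ nn])
  have nn1: "eventually (\<lambda>l. 1 \<le> nn l) sequentially"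
    using nn by (simp add: filterlim_at_top)
  have main: "(\<lambda>l. ?\<phi> (nn l) / (1 + \<mu>) ^ mm l) \<longlonglongrightarrow> c * L"
  proof (rule Lim_transform_eventually[OF tendsto_mult[OF \<phi>l L(2)]])
    show "eventually (\<lambda>l. ?\<phi> (nn l) / real (nn l) * (real (nn l) / (1 + \<mu>) ^ mm l) = ?\<phi> (nn l) / (1 + \<mu>) ^ mm l) sequentially"
      using nn1 by eventually_elim auto
  qed
  have low: "eventually (\<lambda>k. x * ?\<phi> k \<le> y * real k) sequentially" if "x * c < y" for x y
  proof -
    have "eventually (\<lambda>k. x * (?\<phi> k / real k) < y) sequentially"
      by (rule order_tendstoD(2)[OF tendsto_mult_left[OF \<phi>] that])
    with eventually_gt_at_top[of 0] show ?thesis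
      by eventually_elim (auto simp: field_simps)
  qed
  have up: "eventually (\<lambda>k. y * real k \<le> x * ?\<phi> k) sequentially" if "y < x * c" for x y
  proof -
    have "eventually (\<lambda>k. y < x * (?\<phi> k / real k)) sequentially"
      by (rule order_tendstoD(1)[OF tendsto_mult_left[OF \<phi>] that])
    with eventually_gt_at_top[of 0] show ?thesis
      by eventually_elim (auto simp: field_simps)
  qed
  have split: "?T l = class_tail {v. 1 \<le> v \<and> b < w v} (nn l) (mm l) + class_tail {v. w v \<le> b} (nn l) (mm l)" for b l
  proof -
    have "{1..nn l} = ({v. 1 \<le> v \<and> b < w v} \<inter> {1..nn l}) \<union> ({v. w v \<le> b} \<inter> {1..nn l})" by auto
    then have "?T l = (\<Sum>v\<in>({v. 1 \<le> v \<and> b < w v} \<inter> {1..nn l}) \<union> ({v. w v \<le> b} \<inter> {1..nn l}). degree_tail w (nn l) v (mm l))"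
      by simp
    also have "\<dots> = class_tail {v. 1 \<le> v \<and> b < w v} (nn l) (mm l) + class_tail {v. w v \<le> b} (nn l) (mm l)"
      unfolding class_tail_def by (rule sum.union_disjoint) auto
    finally show ?thesis .
  qed
  show ?thesis
  proof (rule order_tendstoI)
    fix a assume a: "a < q0 * L"
    define \<delta> where "\<delta> = min (q0 / 2) ((q0 * L - a) / (2 * L))"
    have \<delta>: "0 < \<delta>" "\<delta> < q0" using a L q0_pos by (auto simp: \<delta>_def)
    have "\<delta> * L \<le> (q0 * L - a) / (2 * L) * L" using L by (intro mult_right_mono) (auto simp: \<delta>_def)
    also have "\<dots> = (q0 * L - a) / 2" using L by simp
    finally have aL: "a < (q0 - \<delta>) * L" using a by (simp add: algebra_simps)
    define \<kappa> where "\<kappa> = (q0 - \<delta>) / c"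
    have \<kappa>: "0 \<le> \<kappa>" "\<kappa> * c = q0 - \<delta>" using \<delta> c by (auto simp: \<kappa>_def)
    have "eventually (\<lambda>k. q0 - \<delta> / 2 < real (card {v\<in>{1..k}. w v = 1}) / real k) sequentially"
      using \<delta> by (intro order_tendstoD(1)[OF frequency_one]) auto
    moreover have "eventually (\<lambda>k. \<kappa> * ?\<phi> k \<le> (q0 - \<delta> / 2) * real k) sequentially"
      using \<delta> \<kappa> by (intro low) auto
    ultimately have "eventually (\<lambda>k. \<kappa> * ?\<phi> k \<le> real (card ({v. w v = 1} \<inter> {1..k}))) sequentially"
      using eventually_gt_at_top[of 0]
    proof eventually_elim
      case (elim k)
      have "{v. w v = 1} \<inter> {1..k} = {v\<in>{1..k}. w v = 1}" by auto
      then show ?case using elim by (simp add: less_divide_eq)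
    qed
    from class_tail_lower[OF _ \<kappa>(1) this]
    obtain K where "eventually (\<lambda>n. \<forall>m. \<kappa> * (?\<phi> n / (1 + \<mu>) ^ m) - K * error_bound n m
        \<le> class_tail {v. w v = 1} n m) sequentially" by auto
    with nn have 1: "eventually (\<lambda>l. \<forall>m. \<kappa> * (?\<phi> (nn l) / (1 + \<mu>) ^ m) - K * error_bound (nn l) m
        \<le> class_tail {v. w v = 1} (nn l) m) sequentially"
      by (rule eventually_compose_filterlim[rotated])
    have "(\<lambda>l. \<kappa> * (?\<phi> (nn l) / (1 + \<mu>) ^ mm l) - K * error_bound (nn l) (mm l)) \<longlonglongrightarrow> \<kappa> * (c * L) - K * 0"
      by (intro tendsto_intros main error_bound_vanishes')
    moreover have "a < \<kappa> * (c * L) - K * 0" using aL \<kappa> by (simp flip: mult.assoc)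
    ultimately have "eventually (\<lambda>l. a < \<kappa> * (?\<phi> (nn l) / (1 + \<mu>) ^ mm l) - K * error_bound (nn l) (mm l)) sequentially"
      by (rule order_tendstoD)
    with 1 show "eventually (\<lambda>l. a < ?T l) sequentially"
    proof eventually_elim
      case (elim l)
      have "class_tail {v. w v = 1} (nn l) (mm l) \<le> ?T l"
        unfolding class_tail_def by (intro sum_mono2) (auto simp: degree_tail_nonneg)
      moreover have "\<kappa> * (?\<phi> (nn l) / (1 + \<mu>) ^ mm l) - K * error_bound (nn l) (mm l)
          \<le> class_tail {v. w v = 1} (nn l) (mm l)" using elim(1) by blast
      ultimately show ?case using elim(2) by linarith
    qed
  next
    fix a assume a: "q0 * L < a"
    define \<delta> where "\<delta> = (a - q0 * L) / (2 * L + 1)"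
    have \<delta>: "0 < \<delta>" using a L by (simp add: \<delta>_def)
    have "\<delta> * (2 * L + 1) = a - q0 * L" using L by (simp add: \<delta>_def)
    then have aL: "(q0 + 2 * \<delta>) * L < a" using \<delta> by (simp add: algebra_simps)
    define \<kappa> where "\<kappa> = (q0 + 2 * \<delta>) / c"
    have \<kappa>: "0 \<le> \<kappa>" "\<kappa> * c = q0 + 2 * \<delta>" using \<delta> c q0_pos by (auto simp: \<kappa>_def)
    obtain b where b: "0 < b" "b < 1" "eventually (\<lambda>k. real (card {v\<in>{1..k}. b < w v}) \<le> (q0 + \<delta>) * real k) sequentially"
      using frequency_near_one[OF \<delta>] by blast
    have "eventually (\<lambda>k. (q0 + \<delta>) * real k \<le> \<kappa> * ?\<phi> k) sequentially"
      using \<delta> \<kappa> by (intro up) auto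
    with b(3) have "eventually (\<lambda>k. real (card ({v. 1 \<le> v \<and> b < w v} \<inter> {1..k})) \<le> \<kappa> * ?\<phi> k) sequentially"
    proof eventually_elim
      case (elim k)
      have "{v. 1 \<le> v \<and> b < w v} \<inter> {1..k} = {v\<in>{1..k}. b < w v}" by auto
      then show ?case using elim by simp
    qed
    from class_tail_upper[OF _ _ _ \<kappa>(1) this, of 1] weight_le_1
    obtain K1 where "eventually (\<lambda>n. \<forall>m. class_tail {v. 1 \<le> v \<and> b < w v} n m
        \<le> \<kappa> * (?\<phi> n / (1 + \<mu>) ^ m) + K1 * error_bound n m) sequentially" by auto
    with nn have 1: "eventually (\<lambda>l. \<forall>m. class_tail {v. 1 \<le> v \<and> b < w v} (nn l) m
        \<le> \<kappa> * (?\<phi> (nn l) / (1 + \<mu>) ^ m) + K1 * error_bound (nn l) m) sequentially"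
      by (rule eventually_compose_filterlim[rotated])
    have "eventually (\<lambda>k. 1 * real k \<le> 2 / c * ?\<phi> k) sequentially"
      using c by (intro up) auto
    then have "eventually (\<lambda>k. real (card ({v. w v \<le> b} \<inter> {1..k})) \<le> 2 / c * ?\<phi> k) sequentially"
    proof eventually_elim
      case (elim k)
      have "card ({v. w v \<le> b} \<inter> {1..k}) \<le> card {1..k}" by (intro card_mono) auto
      then show ?case using elim by simp
    qed
    from class_tail_upper[OF b(1) _ _ _ this] b c
    obtain K2 where "eventually (\<lambda>n. \<forall>m. class_tail {v. w v \<le> b} n m
        \<le> 2 / c * (?\<phi> n / (1 + \<mu> / b) ^ m) + K2 * error_bound n m) sequentially" by auto
    with nn have 2: "eventually (\<lambda>l. \<forall>m. class_tail {v. w v \<le> b} (nn l) m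
        \<le> 2 / c * (?\<phi> (nn l) / (1 + \<mu> / b) ^ m) + K2 * error_bound (nn l) m) sequentially"
      by (rule eventually_compose_filterlim[rotated])
    have small: "(\<lambda>l. ?\<phi> (nn l) / (1 + \<mu> / b) ^ mm l) \<longlonglongrightarrow> 0"
    proof -
      define r where "r = (1 + \<mu>) / (1 + \<mu> / b)"
      have "\<mu> < \<mu> / b" using b mu_pos by (simp add: less_divide_eq)
      then have r: "0 \<le> r" "r < 1" using mu_pos b by (auto simp: r_def divide_less_eq intro!: divide_nonneg_nonneg)
      have "(\<lambda>m. r ^ m) \<longlonglongrightarrow> 0" using r by (intro LIMSEQ_power_zero) auto
      then have "(\<lambda>l. r ^ mm l) \<longlonglongrightarrow> 0" using mm by (rule filterlim_compose)
      then have "(\<lambda>l. ?\<phi> (nn l) / (1 + \<mu>) ^ mm l * r ^ mm l) \<longlonglongrightarrow> c * L * 0"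
        by (intro tendsto_mult main)
      moreover have "?\<phi> (nn l) / (1 + \<mu>) ^ mm l * r ^ mm l = ?\<phi> (nn l) / (1 + \<mu> / b) ^ mm l" for l
        using mu_pos by (simp add: r_def power_divide)
      ultimately show ?thesis by simp
    qed
    have "(\<lambda>l. \<kappa> * (?\<phi> (nn l) / (1 + \<mu>) ^ mm l) + K1 * error_bound (nn l) (mm l)
        + (2 / c * (?\<phi> (nn l) / (1 + \<mu> / b) ^ mm l) + K2 * error_bound (nn l) (mm l)))
        \<longlonglongrightarrow> \<kappa> * (c * L) + K1 * 0 + (2 / c * 0 + K2 * 0)"
      by (intro tendsto_intros main error_bound_vanishes' small)
    moreover have "\<kappa> * (c * L) + K1 * 0 + (2 / c * 0 + K2 * 0) < a" using aL \<kappa> by (simp flip: mult.assoc)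
    ultimately have "eventually (\<lambda>l. \<kappa> * (?\<phi> (nn l) / (1 + \<mu>) ^ mm l) + K1 * error_bound (nn l) (mm l)
        + (2 / c * (?\<phi> (nn l) / (1 + \<mu> / b) ^ mm l) + K2 * error_bound (nn l) (mm l)) < a) sequentially"
      by (rule order_tendstoD)
    with 1 2 show "eventually (\<lambda>l. ?T l < a) sequentially"
    proof eventually_elim
      case (elim l)
      from elim(1,2)[rule_format, of "mm l"] elim(3) show ?case unfolding split[of l b] by linarith
    qed
  qed
qed

end
end

section \<open>The quenched limit\<close>

lemma sum_inverse_squares_le:
  assumes "1 \<le> v" "v \<le> n"
  shows "(\<Sum>k\<in>{v..<n}. 1 / real k ^ 2) \<le> 2 / real v - 2 / real n"
  using assms(2)
proof (induction n rule: dec_induct)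
  case (step n)
  have n: "1 \<le> n" using step assms by simp
  have "1 / real n ^ 2 \<le> 2 / real n - 2 / real (Suc n)"
  proof -
    have "2 / real n - 2 / real (Suc n) = 2 / (real n * real (Suc n))" using n by (simp add: field_simps)
    moreover have "1 / (real n * real n) = 2 / (real n * (2 * real n))" using n by simp
    moreover have "2 / (real n * (2 * real n)) \<le> 2 / (real n * real (Suc n))"
      using n by (intro divide_left_mono mult_left_mono) auto
    ultimately show ?thesis by (simp add: power2_eq_square)
  qed
  then show ?case using step by simp
qed simp

lemma exp_minus_approx:
  assumes "0 \<le> p" "p \<le> (1::real)"
  shows "\<bar>(1 - p) - exp (- p)\<bar> \<le> p ^ 2"
proof -
  have "1 - p \<le> exp (- p)" using exp_ge_add_one_self[of "- p"] by simp
  moreover have "exp (- p) \<le> 1 - p + p ^ 2"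
  proof -
    have "exp (- p) = 1 / exp p" by (simp add: exp_minus field_simps)
    also have "\<dots> \<le> 1 / (1 + p)"
      using exp_ge_add_one_self[of p] assms by (intro divide_left_mono) auto
    also have "\<dots> \<le> 1 - p + p ^ 2"
    proof -
      have "1 \<le> (1 - p + p ^ 2) * (1 + p)"
        using assms by (simp add: algebra_simps power2_eq_square power3_eq_cube)
      then show ?thesis using assms by (simp add: divide_le_eq)
    qed
    finally show ?thesis .
  qed
  ultimately show ?thesis by (simp add: abs_le_iff)
qed

context typical_weights begin

lemma attach_prob_rate: "\<exists>C\<ge>0. \<forall>k v. 1 \<le> k \<longrightarrow> attach_prob w k v \<le> C / real k"
proof -
  obtain k0 where k0: "\<And>k. k0 \<le> k \<Longrightarrow> \<mu> / 2 * real k \<le> S k"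
    using weight_sum_lower unfolding eventually_at_top_linorder by blast
  define C where "C = max (2 / \<mu>) (real k0)"
  have "attach_prob w k v \<le> C / real k" if "1 \<le> k" for k v
  proof (cases "k0 \<le> k")
    case True
    have pos: "0 < \<mu> / 2 * real k" using mu_pos that by simp
    have "attach_prob w k v \<le> 1 / S k"
      using weight_le_1[of v] weight_sum_pos[OF that] by (auto simp: attach_prob_def intro: divide_right_mono)
    also have "\<dots> \<le> 1 / (\<mu> / 2 * real k)"
      using k0[OF True] pos weight_sum_pos[OF that] by (intro divide_left_mono) auto
    also have "\<dots> = (2 / \<mu>) / real k" by simp
    also have "\<dots> \<le> C / real k" by (intro divide_right_mono) (auto simp: C_def)
    finally show ?thesis .
  next
    case False
    have "attach_prob w k v \<le> 1" by (rule attach_prob_le_1)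
    also have "1 \<le> C / real k" using False that by (simp add: C_def field_simps)
    finally show ?thesis .
  qed
  moreover have "0 \<le> C" by (simp add: C_def)
  ultimately show ?thesis by blast
qed

context
  fixes nn mm :: "nat \<Rightarrow> nat" and L :: real
  assumes nn: "filterlim nn at_top sequentially" and mm: "filterlim mm at_top sequentially"
    and L: "0 < L" "(\<lambda>l. real (nn l) / (1 + \<mu>) ^ mm l) \<longlonglongrightarrow> L"
begin

text \<open>The replacement error is at most of order \<open>(\<Sum>u. G u) * (\<Sum>v. G v / v)\<close> with \<open>G\<close> the tail probabilities:
  a common hit of \<open>u\<close> and \<open>v\<close> at step \<open>k \<ge> v\<close> has probability of order \<open>1 / k\<^sup>2\<close>. The second
  sum is at most a logarithm times the uniform bound on \<open>G\<close>, which is a negative power of \<open>n\<close>.\<close>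

lemma swap_error:
  fixes f :: "nat \<Rightarrow> nat \<Rightarrow> real"
  assumes f: "\<And>l x. 0 \<le> f l x \<and> f l x \<le> 1" "\<And>l x. x \<le> mm l \<Longrightarrow> f l x = 1"
  shows "(\<lambda>l. quenched_expectation w (nn l) (\<lambda>z. \<Prod>v\<in>{1..nn l}. f l (z v)) (\<lambda>_. 0)
           - (\<Prod>v\<in>{1..nn l}. vertex_expectation w v (nn l) (f l) 0)) \<longlonglongrightarrow> 0"
proof -
  obtain C where C: "0 \<le> C" "\<And>k v. 1 \<le> k \<Longrightarrow> attach_prob w k v \<le> C / real k"
    using attach_prob_rate by blast
  obtain K where K: "0 \<le> K" "eventually (\<lambda>n. \<forall>v m. degree_tail w n v m \<le> K * error_bound n m) sequentially"
    using degree_tail_uniform by blast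
  let ?G = "\<lambda>l v. degree_tail w (nn l) v (mm l)"
  let ?H = "\<lambda>l. \<Sum>v=1..nn l. ?G l v"
  have pair: "(\<Sum>k<n. attach_prob w k u * attach_prob w k v) \<le> 2 * C^2 / real v"
    if "1 \<le> v" "v \<le> n" for n u v
  proof -
    have "(\<Sum>k<n. attach_prob w k u * attach_prob w k v) = (\<Sum>k\<in>{v..<n}. attach_prob w k u * attach_prob w k v)"
      by (intro sum.mono_neutral_right) (auto simp: attach_prob_def)
    also have "\<dots> \<le> (\<Sum>k\<in>{v..<n}. C^2 * (1 / real k ^ 2))"
    proof (intro sum_mono)
      fix k assume "k \<in> {v..<n}"
      then have "attach_prob w k u * attach_prob w k v \<le> (C / real k) * (C / real k)"
        using C that by (intro mult_mono) (auto simp: attach_prob_nonneg)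
      then show "attach_prob w k u * attach_prob w k v \<le> C^2 * (1 / real k ^ 2)"
        by (simp add: power2_eq_square)
    qed
    also have "\<dots> = C^2 * (\<Sum>k\<in>{v..<n}. 1 / real k ^ 2)" by (simp add: sum_distrib_left)
    also have "\<dots> \<le> C^2 * (2 / real v)"
      using sum_inverse_squares_le[OF that] that by (intro mult_left_mono) (auto intro: order_trans)
    finally show ?thesis by (simp add: mult.commute)
  qed
  have bound: "\<bar>quenched_expectation w (nn l) (\<lambda>z. \<Prod>v\<in>{1..nn l}. f l (z v)) (\<lambda>_. 0)
           - (\<Prod>v\<in>{1..nn l}. vertex_expectation w v (nn l) (f l) 0)\<bar>
         \<le> 2 * C^2 * ?H l * (\<Sum>v=1..nn l. ?G l v / real v)" for l
  proof -
    let ?h = "\<lambda>x. if mm l \<le> x then 1 else 0 :: real"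
    let ?V = "{1..nn l}"
    have "\<bar>quenched_expectation w (nn l) (\<lambda>z. \<Prod>v\<in>?V. f l (z v)) (\<lambda>_. 0)
           - (\<Prod>v\<in>?V. vertex_expectation w v (nn l) (f l) 0)\<bar>
      \<le> (\<Sum>k<nn l. \<Sum>u\<in>?V. \<Sum>v\<in>?V-{u}. attach_prob w k u * attach_prob w k v * (?G l u * ?G l v))"
      unfolding degree_tail_def
    proof (rule quenched_prod)
      fix x
      show "\<bar>f l (Suc x) - f l x\<bar> \<le> ?h x"
      proof (cases "mm l \<le> x")
        case True
        then show ?thesis using f(1)[of l x] f(1)[of l "Suc x"] by auto
      next
        case False
        then show ?thesis using f(2)[of x l] f(2)[of "Suc x" l] by auto
      qed
    qed (auto simp: f mono_def)
    also have "\<dots> = (\<Sum>u\<in>?V. \<Sum>v\<in>?V-{u}. (\<Sum>k<nn l. attach_prob w k u * attach_prob w k v) * (?G l u * ?G l v))"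
      unfolding sum_distrib_right
      by (subst sum.swap, rule sum.cong[OF refl], rule sum.swap)
    also have "\<dots> \<le> (\<Sum>u\<in>?V. \<Sum>v\<in>?V-{u}. 2 * C^2 / real v * (?G l u * ?G l v))"
      by (intro sum_mono mult_right_mono pair) (auto simp: degree_tail_nonneg)
    also have "\<dots> \<le> (\<Sum>u\<in>?V. \<Sum>v\<in>?V. 2 * C^2 / real v * (?G l u * ?G l v))"
      by (intro sum_mono sum_mono2) (auto simp: degree_tail_nonneg)
    also have "\<dots> = (\<Sum>u\<in>?V. 2 * C^2 * ?G l u * (\<Sum>v\<in>?V. ?G l v / real v))"
      by (simp add: sum_distrib_left mult_ac)
    also have "\<dots> = 2 * C^2 * ?H l * (\<Sum>v=1..nn l. ?G l v / real v)"
      by (simp only: sum_distrib_left sum_distrib_right mult_ac)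
    finally show ?thesis .
  qed
  have "eventually (\<lambda>l. \<forall>v m. degree_tail w (nn l) v m \<le> K * error_bound (nn l) m) sequentially"
    using K(2) nn by (rule eventually_compose_filterlim)
  moreover have "eventually (\<lambda>l. 1 \<le> nn l) sequentially"
    using nn by (simp add: filterlim_at_top)
  ultimately have ev: "eventually (\<lambda>l. norm (quenched_expectation w (nn l) (\<lambda>z. \<Prod>v\<in>{1..nn l}. f l (z v)) (\<lambda>_. 0)
           - (\<Prod>v\<in>{1..nn l}. vertex_expectation w v (nn l) (f l) 0))
       \<le> 2 * C^2 * ?H l * (K * (error_bound (nn l) (mm l) * (1 + ln (real (nn l)))))) sequentially"
  proof eventually_elim
    case (elim l)
    have "(\<Sum>v=1..nn l. ?G l v / real v) \<le> (\<Sum>v=1..nn l. K * error_bound (nn l) (mm l) / real v)"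
      using elim(1) by (intro sum_mono divide_right_mono) auto
    also have "\<dots> = K * error_bound (nn l) (mm l) * harm (nn l)"
      by (simp add: harm_def sum_distrib_left divide_inverse)
    also have "\<dots> \<le> K * error_bound (nn l) (mm l) * (1 + ln (real (nn l)))"
      using euler_mascheroni_sequence_decreasing[of 1 "nn l"] elim K error_bound_pos[of "nn l" "mm l"]
      by (intro mult_left_mono) (auto simp: harm_def)
    finally have "2 * C^2 * ?H l * (\<Sum>v=1..nn l. ?G l v / real v)
        \<le> 2 * C^2 * ?H l * (K * error_bound (nn l) (mm l) * (1 + ln (real (nn l))))"
      using C by (intro mult_left_mono mult_nonneg_nonneg sum_nonneg) (auto simp: degree_tail_nonneg)
    then show ?case using bound[of l] by (simp add: mult.assoc)
  qed
  have "(\<lambda>l. 2 * C^2 * ?H l * (K * (error_bound (nn l) (mm l) * (1 + ln (real (nn l)))))) \<longlonglongrightarrow> 2 * C^2 * (q0 * L) * (K * 0)"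
    by (intro tendsto_intros first_moment[OF nn mm L] error_bound_vanishes[OF nn mm L])
  then have "(\<lambda>l. 2 * C^2 * ?H l * (K * (error_bound (nn l) (mm l) * (1 + ln (real (nn l)))))) \<longlonglongrightarrow> 0"
    by simp
  with ev show ?thesis by (rule Lim_null_comparison)
qed

lemma product_limit:
  fixes f :: "nat \<Rightarrow> nat \<Rightarrow> real"
  assumes f: "\<And>l x. 0 \<le> f l x \<and> f l x \<le> 1" "\<And>l x. x \<le> mm l \<Longrightarrow> f l x = 1"
    and \<Lambda>: "(\<lambda>l. \<Sum>v=1..nn l. 1 - vertex_expectation w v (nn l) (f l) 0) \<longlonglongrightarrow> \<Lambda>"
  shows "(\<lambda>l. \<Prod>v\<in>{1..nn l}. vertex_expectation w v (nn l) (f l) 0) \<longlonglongrightarrow> exp (- \<Lambda>)"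
proof -
  obtain K where K: "0 \<le> K" "eventually (\<lambda>n. \<forall>v m. degree_tail w n v m \<le> K * error_bound n m) sequentially"
    using degree_tail_uniform by blast
  let ?G = "\<lambda>l v. degree_tail w (nn l) v (mm l)"
  let ?H = "\<lambda>l. \<Sum>v=1..nn l. ?G l v"
  define p where "p l v = 1 - vertex_expectation w v (nn l) (f l) 0" for l v
  have p0: "0 \<le> p l v" for l v
    using vertex_mono[of "f l" "\<lambda>_. 1" v "nn l" 0] f(1) by (simp add: p_def vertex_const)
  have p1: "p l v \<le> 1" for l v
    using vertex_nonneg[of "f l" v "nn l" 0] f(1) by (simp add: p_def)
  have pG: "p l v \<le> ?G l v" for l v
  proof -
    have "vertex_expectation w v (nn l) (\<lambda>x. 1 + (-1) * (if mm l \<le> x then 1 else 0)) 0 \<le> vertex_expectation w v (nn l) (f l) 0"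
      using f by (intro vertex_mono) auto
    then show ?thesis
      unfolding vertex_add vertex_scale vertex_const by (simp add: p_def degree_tail_def)
  qed
  have "eventually (\<lambda>l. \<forall>v m. degree_tail w (nn l) v m \<le> K * error_bound (nn l) m) sequentially"
    using K(2) nn by (rule eventually_compose_filterlim)
  then have ev: "eventually (\<lambda>l. norm ((\<Prod>v\<in>{1..nn l}. 1 - p l v) - (\<Prod>v\<in>{1..nn l}. exp (- p l v)))
       \<le> K * error_bound (nn l) (mm l) * ?H l) sequentially"
  proof eventually_elim
    case (elim l)
    have "norm ((\<Prod>v\<in>{1..nn l}. 1 - p l v) - (\<Prod>v\<in>{1..nn l}. exp (- p l v)))
        \<le> (\<Sum>v\<in>{1..nn l}. norm ((1 - p l v) - exp (- p l v)))"
      using p0 p1 by (intro norm_prod_diff) auto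
    also have "\<dots> \<le> (\<Sum>v\<in>{1..nn l}. K * error_bound (nn l) (mm l) * ?G l v)"
    proof (intro sum_mono)
      fix v
      have "norm ((1 - p l v) - exp (- p l v)) \<le> p l v * p l v"
        using exp_minus_approx[OF p0 p1] by (simp add: power2_eq_square)
      also have "\<dots> \<le> (K * error_bound (nn l) (mm l)) * ?G l v"
        using pG[of l v] elim p0[of l v] by (intro mult_mono) (auto intro: order_trans)
      finally show "norm ((1 - p l v) - exp (- p l v)) \<le> K * error_bound (nn l) (mm l) * ?G l v" .
    qed
    finally show ?case by (simp add: sum_distrib_left)
  qed
  have "(\<lambda>l. K * error_bound (nn l) (mm l) * ?H l) \<longlonglongrightarrow> K * 0 * (q0 * L)"
    by (intro tendsto_intros first_moment[OF nn mm L] error_bound_vanishes'[OF nn mm L])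
  then have "(\<lambda>l. K * error_bound (nn l) (mm l) * ?H l) \<longlonglongrightarrow> 0" by simp
  with ev have 1: "(\<lambda>l. (\<Prod>v\<in>{1..nn l}. 1 - p l v) - (\<Prod>v\<in>{1..nn l}. exp (- p l v))) \<longlonglongrightarrow> 0"
    by (rule Lim_null_comparison)
  have 2: "(\<lambda>l. (\<Prod>v\<in>{1..nn l}. exp (- p l v))) \<longlonglongrightarrow> exp (- \<Lambda>)"
  proof -
    have "(\<lambda>l. exp (- (\<Sum>v=1..nn l. p l v))) \<longlonglongrightarrow> exp (- \<Lambda>)"
      using \<Lambda> unfolding p_def by (intro tendsto_exp tendsto_minus)
    moreover have "(\<Prod>v\<in>{1..nn l}. exp (- p l v)) = exp (- (\<Sum>v=1..nn l. p l v))" for l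
      by (simp only: sum_negf[symmetric] exp_sum[OF finite_atLeastAtMost])
    ultimately show ?thesis by simp
  qed
  from tendsto_add[OF 1 2] show ?thesis by (simp add: p_def)
qed

lemma quenched_limit:
  fixes f :: "nat \<Rightarrow> nat \<Rightarrow> real"
  assumes f: "\<And>l x. 0 \<le> f l x \<and> f l x \<le> 1" "\<And>l x. x \<le> mm l \<Longrightarrow> f l x = 1"
    and \<Lambda>: "(\<lambda>l. \<Sum>v=1..nn l. 1 - vertex_expectation w v (nn l) (f l) 0) \<longlonglongrightarrow> \<Lambda>"
  shows "(\<lambda>l. quenched_expectation w (nn l) (\<lambda>z. \<Prod>v\<in>{1..nn l}. f l (z v)) (\<lambda>_. 0)) \<longlonglongrightarrow> exp (- \<Lambda>)"
proof -
  have 1: "(\<lambda>l. quenched_expectation w (nn l) (\<lambda>z. \<Prod>v\<in>{1..nn l}. f l (z v)) (\<lambda>_. 0)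
           - (\<Prod>v\<in>{1..nn l}. vertex_expectation w v (nn l) (f l) 0)) \<longlonglongrightarrow> 0"
    using f by (intro swap_error) auto
  have 2: "(\<lambda>l. \<Prod>v\<in>{1..nn l}. vertex_expectation w v (nn l) (f l) 0) \<longlonglongrightarrow> exp (- \<Lambda>)"
    using f \<Lambda> by (intro product_limit) auto
  from tendsto_add[OF 1 2] show ?thesis by simp
qed

end
end

text \<open>Levels are indexed by \<open>k = 0, \<dots>, d\<close>: for \<open>k < d\<close>, level \<open>k\<close> is the integer \<open>i + k\<close>, and level \<open>d\<close>
  collects all integers from \<open>i + d\<close> on. \<open>level_value s i d j\<close> is \<open>s\<close> at the level of \<open>j\<close>, and \<open>1\<close> if
  \<open>j\<close> is below all levels.\<close>

definition level_value :: "(nat \<Rightarrow> real) \<Rightarrow> int \<Rightarrow> nat \<Rightarrow> int \<Rightarrow> real" where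
  "level_value s i d j = (if j < i then 1 else s (min (nat (j - i)) d))"

text \<open>The increments that write \<open>1 - level_value s i d\<close> as a combination of indicators of the sets
  \<open>{j. i + k \<le> j}\<close>.\<close>

definition level_increment :: "(nat \<Rightarrow> real) \<Rightarrow> nat \<Rightarrow> real" where
  "level_increment s k = (if k = 0 then 1 else s (k - 1)) - s k"

text \<open>The mean of the limiting Poisson number of points in level \<open>k\<close>.\<close>

definition level_mean :: "real \<Rightarrow> real \<Rightarrow> real \<Rightarrow> int \<Rightarrow> nat \<Rightarrow> nat \<Rightarrow> real" where
  "level_mean q \<theta> \<epsilon> i d k =
     (if k < d then q * (\<theta> powr (\<epsilon> - of_int (i + int k)) - \<theta> powr (\<epsilon> - of_int (i + int k) - 1))
      else q * \<theta> powr (\<epsilon> - of_int (i + int k)))"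

lemma sum_level_increment: "(\<Sum>k\<le>m. level_increment s k) = 1 - s m"
  by (induction m) (auto simp: level_increment_def)

lemma level_value_altdef:
  "level_value s i d j = 1 - (\<Sum>k\<le>d. level_increment s k * (if i + int k \<le> j then 1 else 0))"
proof (cases "j < i")
  case False
  have "(\<Sum>k\<le>d. level_increment s k * (if i + int k \<le> j then 1 else 0)) = (\<Sum>k\<le>min (nat (j - i)) d. level_increment s k)"
    by (rule sum.mono_neutral_cong_right) (use False in auto)
  then show ?thesis using False by (simp add: level_value_def sum_level_increment)
qed (simp add: level_value_def)

lemma level_abel_summation:
  "(\<Sum>k\<le>d. level_increment s k * c k) = (\<Sum>k<d. (1 - s k) * (c k - c (Suc k))) + (1 - s d) * c d"
  by (induction d) (auto simp: level_increment_def algebra_simps)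

context typical_weights begin

lemma quenched_levels:
  fixes n :: "nat \<Rightarrow> nat" and \<epsilon> :: real and i :: int
  assumes n: "filterlim n at_top sequentially"
    and eps: "(\<lambda>l. log (1 + \<mu>) (real (n l)) - of_int \<lfloor>log (1 + \<mu>) (real (n l))\<rfloor>) \<longlonglongrightarrow> \<epsilon>"
    and s: "\<And>k. 0 \<le> s k \<and> s k \<le> 1"
  shows "(\<lambda>l. quenched_expectation w (n l)
            (\<lambda>z. \<Prod>v\<in>{1..n l}. level_value s i d (int (z v) - \<lfloor>log (1 + \<mu>) (real (n l))\<rfloor>)) (\<lambda>_. 0))
          \<longlonglongrightarrow> exp (- (\<Sum>k\<le>d. (1 - s k) * level_mean q0 (1 + \<mu>) \<epsilon> i d k))"
proof -
  define \<theta> where "\<theta> = 1 + \<mu>"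
  define m where "m l = \<lfloor>log \<theta> (real (n l))\<rfloor>" for l
  have \<theta>: "1 < \<theta>" using mu_pos by (simp add: \<theta>_def)
  have m_top: "filterlim m at_top sequentially"
  proof -
    have "filterlim (\<lambda>n::nat. \<lfloor>log \<theta> (real n)\<rfloor>) at_top sequentially"
    proof (rule filterlim_compose[OF filterlim_floor_sequentially])
      show "filterlim (\<lambda>n::nat. log \<theta> (real n)) at_top sequentially"
        using \<theta> by real_asymp
    qed
    from filterlim_compose[OF this n] show ?thesis unfolding m_def .
  qed
  have n1: "eventually (\<lambda>l. 1 \<le> n l) sequentially"
    using n by (simp add: filterlim_at_top)
  have mb: "eventually (\<lambda>l. b \<le> m l) sequentially" for b
    using m_top by (simp add: filterlim_at_top)
  have ratio: "(\<lambda>l. real (n l) / \<theta> ^ nat (m l + j)) \<longlonglongrightarrow> \<theta> powr (\<epsilon> - of_int j)" for j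
  proof (rule Lim_transform_eventually)
    show "(\<lambda>l. \<theta> powr (log \<theta> (real (n l)) - of_int (m l) - of_int j)) \<longlonglongrightarrow> \<theta> powr (\<epsilon> - of_int j)"
      using eps \<theta> unfolding m_def \<theta>_def by (intro tendsto_intros) auto
    show "eventually (\<lambda>l. \<theta> powr (log \<theta> (real (n l)) - of_int (m l) - of_int j) = real (n l) / \<theta> ^ nat (m l + j)) sequentially"
      using n1 mb[of "- j"]
    proof eventually_elim
      case (elim l)
      have "\<theta> powr (log \<theta> (real (n l)) - of_int (m l) - of_int j)
          = \<theta> powr (log \<theta> (real (n l)) - real (nat (m l + j)))"
        using elim by (simp add: algebra_simps)
      also have "\<dots> = real (n l) / \<theta> ^ nat (m l + j)"
        unfolding powr_diff using \<theta> elim by (subst powr_realpow) auto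
      finally show ?case .
    qed
  qed
  have nat_top: "filterlim (\<lambda>l. nat (m l + j)) at_top sequentially" for j
    unfolding filterlim_at_top
  proof
    fix Z :: nat
    show "eventually (\<lambda>l. Z \<le> nat (m l + j)) sequentially"
      using mb[of "int Z - j"] by eventually_elim auto
  qed
  have tails: "(\<lambda>l. \<Sum>v=1..n l. degree_tail w (n l) v (nat (m l + j))) \<longlonglongrightarrow> q0 * \<theta> powr (\<epsilon> - of_int j)" for j
    using first_moment[OF n nat_top _ ratio[unfolded \<theta>_def]] \<theta> by (simp add: \<theta>_def)
  \<comment> \<open>\<open>quenched_limit\<close> asks for a function that is \<open>1\<close> up to \<open>mm l\<close> for every \<open>l\<close>; the finitely many \<open>l\<close>
    for which the lowest level does not stand for a positive degree are changed to the constant \<open>1\<close>.\<close>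
  define good where "good l \<longleftrightarrow> 1 \<le> m l + i" for l
  have good: "eventually good sequentially"
    using mb[of "1 - i"] by eventually_elim (auto simp: good_def)
  define f where "f l x = (if good l then level_value s i d (int x - m l) else 1)" for l x
  define mm where "mm l = nat (m l + (i - 1))" for l
  have f01: "0 \<le> f l x \<and> f l x \<le> 1" for l x
    using s by (auto simp: f_def level_value_def)
  have f1: "f l x = 1" if "x \<le> mm l" for l x
    using that by (auto simp: f_def level_value_def good_def mm_def)
  have "(\<lambda>l. \<Sum>v=1..n l. 1 - vertex_expectation w v (n l) (f l) 0)
      \<longlonglongrightarrow> (\<Sum>k\<le>d. level_increment s k * (q0 * \<theta> powr (\<epsilon> - of_int (i + int k))))"
  proof (rule Lim_transform_eventually)
    show "(\<lambda>l. \<Sum>k\<le>d. level_increment s k * (\<Sum>v=1..n l. degree_tail w (n l) v (nat (m l + (i + int k)))))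
       \<longlonglongrightarrow> (\<Sum>k\<le>d. level_increment s k * (q0 * \<theta> powr (\<epsilon> - of_int (i + int k))))"
      by (intro tendsto_sum tendsto_mult_left tails)
    show "eventually (\<lambda>l. (\<Sum>k\<le>d. level_increment s k * (\<Sum>v=1..n l. degree_tail w (n l) v (nat (m l + (i + int k)))))
       = (\<Sum>v=1..n l. 1 - vertex_expectation w v (n l) (f l) 0)) sequentially"
      using good
    proof eventually_elim
      case (elim l)
      have fl: "f l = (\<lambda>x. 1 + (-1) * (\<Sum>k\<le>d. level_increment s k * (if nat (m l + (i + int k)) \<le> x then 1 else 0)))"
        unfolding f_def level_value_altdef using elim
        by (auto simp: fun_eq_iff good_def intro!: sum.cong)
      have "1 - vertex_expectation w v (n l) (f l) 0 = (\<Sum>k\<le>d. level_increment s k * degree_tail w (n l) v (nat (m l + (i + int k))))" for v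
        unfolding fl vertex_add vertex_scale vertex_const vertex_sum degree_tail_def by simp
      then show ?case
        by (simp add: sum_distrib_left) (rule sum.swap)
    qed
  qed
  also have "(\<Sum>k\<le>d. level_increment s k * (q0 * \<theta> powr (\<epsilon> - of_int (i + int k))))
      = (\<Sum>k\<le>d. (1 - s k) * level_mean q0 \<theta> \<epsilon> i d k)"
  proof -
    have "(\<Sum>k\<le>d. (1 - s k) * level_mean q0 \<theta> \<epsilon> i d k)
       = (\<Sum>k<d. (1 - s k) * level_mean q0 \<theta> \<epsilon> i d k) + (1 - s d) * level_mean q0 \<theta> \<epsilon> i d d"
      by (simp add: lessThan_Suc_atMost[symmetric])
    also have "(\<Sum>k<d. (1 - s k) * level_mean q0 \<theta> \<epsilon> i d k)
      = (\<Sum>k<d. (1 - s k) * (q0 * \<theta> powr (\<epsilon> - of_int (i + int k)) - q0 * \<theta> powr (\<epsilon> - of_int (i + int (Suc k)))))"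
      by (intro sum.cong) (auto simp: level_mean_def algebra_simps)
    finally show ?thesis by (simp add: level_abel_summation level_mean_def)
  qed
  finally have \<Lambda>: "(\<lambda>l. \<Sum>v=1..n l. 1 - vertex_expectation w v (n l) (f l) 0) \<longlonglongrightarrow> (\<Sum>k\<le>d. (1 - s k) * level_mean q0 \<theta> \<epsilon> i d k)" .
  have "(\<lambda>l. quenched_expectation w (n l) (\<lambda>z. \<Prod>v\<in>{1..n l}. f l (z v)) (\<lambda>_. 0))
      \<longlonglongrightarrow> exp (- (\<Sum>k\<le>d. (1 - s k) * level_mean q0 \<theta> \<epsilon> i d k))"
  proof (rule quenched_limit[where mm = mm])
    show "filterlim mm at_top sequentially" unfolding mm_def by (rule nat_top)
    show "(\<lambda>l. real (n l) / (1 + \<mu>) ^ mm l) \<longlonglongrightarrow> \<theta> powr (\<epsilon> - of_int (i - 1))"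
      using ratio[of "i - 1"] by (simp add: mm_def \<theta>_def)
  qed (use n \<theta> f01 f1 \<Lambda> in auto)
  moreover have "eventually (\<lambda>l. quenched_expectation w (n l) (\<lambda>z. \<Prod>v\<in>{1..n l}. f l (z v)) (\<lambda>_. 0)
     = quenched_expectation w (n l) (\<lambda>z. \<Prod>v\<in>{1..n l}. level_value s i d (int (z v) - m l)) (\<lambda>_. 0)) sequentially"
    using good by eventually_elim (simp add: f_def)
  ultimately show ?thesis
    unfolding m_def \<theta>_def by (rule Lim_transform_eventually)
qed

end

section \<open>Conditioning on the weights\<close>

text \<open>The parents of the vertices \<open>2, \<dots>, n\<close>, which determine the tree with \<open>n\<close> vertices. Lists of naturals
  are countable, so this is a discrete random variable.\<close>

definition parents :: "(nat \<Rightarrow> 'a \<Rightarrow> nat) \<Rightarrow> nat \<Rightarrow> 'a \<Rightarrow> nat list" where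
  "parents par n \<omega> = map (\<lambda>j. par j \<omega>) [2..<Suc n]"

lemma tree_in_degree_conv_parents: "tree_in_degree par n v \<omega> = count_list (parents par n \<omega>) v"
proof -
  have "in_arcs (recursive_tree (\<lambda>j. par j \<omega>) n) v = {j\<in>set [2..<Suc n]. par j \<omega> = v}"
    by (auto simp: in_arcs_def recursive_tree_def)
  moreover have "card {j\<in>set [2..<Suc n]. par j \<omega> = v} = length (filter (\<lambda>j. par j \<omega> = v) [2..<Suc n])"
    by (subst distinct_card[symmetric]) (auto intro: distinct_filter simp del: upt_Suc)
  moreover have "count_list (map (\<lambda>j. par j \<omega>) xs) v = length (filter (\<lambda>j. par j \<omega> = v) xs)" for xs
    by (induction xs) auto
  ultimately show ?thesis
    by (simp add: tree_in_degree_def in_degree_def parents_def del: upt_Suc)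
qed

lemma parents_Suc: "1 \<le> n \<Longrightarrow> parents par (Suc n) \<omega> = parents par n \<omega> @ [par (Suc n) \<omega>]"
  by (simp add: parents_def)

lemma parents_le_1: "n \<le> 1 \<Longrightarrow> parents par n \<omega> = []"
  by (simp add: parents_def)

context weighted_recursive_tree begin

lemma tree_history_generators:
  "{W i -` B \<inter> space M | i B. i \<in> {1..n} \<and> B \<in> sets borel} \<union>
      {par j -` A \<inter> space M | j A. j \<in> {2..m}} \<subseteq> sets M"
proof -
  have "par j -` A \<inter> space M \<in> sets M" if "j \<in> {2..m}" for j A
    using parent_measurable[of "j - 1"] that by (auto intro: measurable_sets)
  moreover have "W i -` B \<inter> space M \<in> sets M" if "i \<in> {1..n}" "B \<in> sets borel" for i B
    using weight_measurable[of i] that by (auto intro: measurable_sets)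
  ultimately show ?thesis by blast
qed

lemma space_tree_history [simp]: "space (tree_history M W par n m) = space M"
  unfolding tree_history_def
  by (rule space_measure_of, rule order_trans[OF tree_history_generators sets.space_closed])

lemma sets_tree_history:
  "sets (tree_history M W par n m) = sigma_sets (space M)
     ({W i -` B \<inter> space M | i B. i \<in> {1..n} \<and> B \<in> sets borel} \<union>
      {par j -` A \<inter> space M | j A. j \<in> {2..m}})"
  unfolding tree_history_def
  by (rule sets_measure_of, rule order_trans[OF tree_history_generators sets.space_closed])

lemma subalgebra_tree_history: "subalgebra M (tree_history M W par n m)"
  unfolding subalgebra_def sets_tree_history
  using sets.sigma_sets_subset[OF tree_history_generators[of n m]] by simp

lemma tree_history_mono:
  assumes "n \<le> n'" "m \<le> m'"
  shows "sets (tree_history M W par n m) \<subseteq> sets (tree_history M W par n' m')"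
proof -
  have mono1: "I \<subseteq> I' \<Longrightarrow> {F i B |i B. i \<in> I \<and> B \<in> Q} \<subseteq> {F i B |i B. i \<in> I' \<and> B \<in> Q}"
    for F :: "nat \<Rightarrow> real set \<Rightarrow> 'a set" and I I' Q by blast
  have mono2: "J \<subseteq> J' \<Longrightarrow> {F j A |j A. j \<in> J} \<subseteq> {F j A |j A. j \<in> J'}"
    for F :: "nat \<Rightarrow> nat set \<Rightarrow> 'a set" and J J' by blast
  show ?thesis
    unfolding sets_tree_history using assms
    by (intro sigma_sets_mono' Un_mono mono1 mono2) auto
qed

lemma subalgebra_tree_history_mono:
  "n \<le> n' \<Longrightarrow> m \<le> m' \<Longrightarrow> subalgebra (tree_history M W par n' m') (tree_history M W par n m)"
  using tree_history_mono by (auto simp: subalgebra_def)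

lemma weight_measurable_history:
  "i \<in> {1..n} \<Longrightarrow> W i \<in> borel_measurable (tree_history M W par n m)"
  by (rule measurableI, simp) (unfold sets_tree_history space_tree_history, rule sigma_sets.Basic, blast)

lemma parent_measurable_history:
  "j \<in> {2..m} \<Longrightarrow> par j \<in> measurable (tree_history M W par n m) (count_space UNIV)"
  by (rule measurableI, simp) (unfold sets_tree_history space_tree_history, rule sigma_sets.Basic, blast)

lemma parents_measurable_history:
  "n \<le> m \<Longrightarrow> parents par n \<in> measurable (tree_history M W par k m) (count_space UNIV)"
proof (induction n)
  case 0
  have "parents par 0 = (\<lambda>_. [])" by (simp add: parents_def fun_eq_iff)
  then show ?case by simp
next
  case (Suc n)
  show ?case
  proof (cases "1 \<le> n")
    case True
    have "(\<lambda>\<omega>. l @ [par (Suc n) \<omega>]) \<in> measurable (tree_history M W par k m) (count_space UNIV)" for l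
      using measurable_compose[OF parent_measurable_history[of "Suc n" m k], of "\<lambda>x. l @ [x]" "count_space UNIV"] Suc.prems True
      by simp
    then have "(\<lambda>\<omega>. parents par n \<omega> @ [par (Suc n) \<omega>]) \<in> measurable (tree_history M W par k m) (count_space UNIV)"
      by (rule measurable_compose_countable) (use Suc in simp)
    moreover have "(\<lambda>\<omega>. parents par n \<omega> @ [par (Suc n) \<omega>]) = parents par (Suc n)"
      using True by (simp add: parents_Suc fun_eq_iff)
    ultimately show ?thesis by simp
  next
    case False
    then have "parents par (Suc n) = (\<lambda>_. [])" by (simp add: parents_def fun_eq_iff)
    then show ?thesis by simp
  qed
qed

lemma parents_measurable: "parents par n \<in> measurable M (count_space UNIV)"
  using parents_measurable_history[of n n n] subalgebra_tree_history
  by (rule measurable_from_subalg[rotated]) simp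

lemma AE_weight_pos: "AE \<omega> in M. \<forall>i\<ge>1. 0 < W i \<omega>"
proof -
  have "AE \<omega> in M. 1 \<le> i \<longrightarrow> 0 < W i \<omega>" for i
  proof (cases "1 \<le> i")
    case True
    have "AE x in distr M borel (W i). 0 < x" unfolding weight_distr[OF True] by (rule weight_pos)
    then show ?thesis using weight_measurable[OF True] True by (subst (asm) AE_distr_iff) auto
  qed simp
  then show ?thesis by (simp add: AE_all_countable)
qed

text \<open>The random attachment probability of vertex \<open>n + 1\<close> to \<open>i\<close>.\<close>

definition attach_weight :: "nat \<Rightarrow> nat \<Rightarrow> 'a \<Rightarrow> real" where
  "attach_weight n i \<omega> = W i \<omega> / (\<Sum>j=1..n. W j \<omega>)"

lemma attach_weight_measurable_history:
  "n \<le> N \<Longrightarrow> i \<in> {1..n} \<Longrightarrow> attach_weight n i \<in> borel_measurable (tree_history M W par N m)"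
  unfolding attach_weight_def
  by (intro borel_measurable_divide borel_measurable_sum weight_measurable_history) auto

lemma attach_weight_bounds: "AE \<omega> in M. \<forall>n i :: nat. i \<in> {1..n} \<longrightarrow> 0 \<le> attach_weight n i \<omega> \<and> attach_weight n i \<omega> \<le> 1"
  using AE_weight_pos
proof eventually_elim
  case (elim \<omega>)
  interpret positive_weights "\<lambda>i. W i \<omega>" by standard (use elim in auto)
  show ?case
  proof (intro allI impI)
    fix n i :: nat assume i: "i \<in> {1..n}"
    then have "attach_weight n i \<omega> = attach_prob (\<lambda>i. W i \<omega>) n i"
      by (simp add: attach_weight_def attach_prob_def)
    then show "0 \<le> attach_weight n i \<omega> \<and> attach_weight n i \<omega> \<le> 1"
      by (simp add: attach_prob_nonneg attach_prob_le_1)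
  qed
qed

lemma measurable_history_M: "f \<in> measurable (tree_history M W par N m) K \<Longrightarrow> f \<in> measurable M K"
  using measurable_from_subalg[OF subalgebra_tree_history] .

lemma integrable_attach_weight:
  assumes "i \<in> {1..n}"
  shows "integrable M (attach_weight n i)"
proof (rule integrable_const_bound[where B = 1])
  show "AE \<omega> in M. norm (attach_weight n i \<omega>) \<le> 1"
    using attach_weight_bounds by eventually_elim (use assms in auto)
  show "attach_weight n i \<in> borel_measurable M"
    using attach_weight_measurable_history[of n n i n] assms by (auto intro: measurable_history_M)
qed

lemma parent_event:
  assumes "1 \<le> n" "Suc n \<le> m"
  shows "{\<omega>\<in>space M. par (Suc n) \<omega> = i} \<in> sets (tree_history M W par N m)"
proof -
  have "par (Suc n) -` {i} \<inter> space (tree_history M W par N m) \<in> sets (tree_history M W par N m)"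
    using assms by (intro measurable_sets[OF parent_measurable_history]) auto
  moreover have "{\<omega>\<in>space M. par (Suc n) \<omega> = i} = par (Suc n) -` {i} \<inter> space M" by auto
  ultimately show ?thesis by simp
qed

lemma sigma_finite_tree_history: "sigma_finite_subalgebra M (tree_history M W par N m)"
proof -
  interpret finite_measure_subalgebra M "tree_history M W par N m"
    by standard (rule subalgebra_tree_history)
  show ?thesis by (rule sigma_finite_subalgebra_axioms)
qed

text \<open>The weight of vertex \<open>N + 1\<close> is independent of everything determined by the weights up to \<open>N\<close> and
  the parents up to \<open>N + 1\<close>.\<close>

lemma fresh_weight_factor:
  fixes f :: "'a \<Rightarrow> real"
  assumes "1 \<le> N" and f: "f \<in> borel_measurable (tree_history M W par N (Suc N))" "integrable M f"
    and B: "B \<in> sets borel"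
  shows "(\<integral>\<omega>. f \<omega> * indicator (W (Suc N) -` B \<inter> space M) \<omega> \<partial>M)
       = (\<integral>\<omega>. f \<omega> \<partial>M) * (\<integral>\<omega>. indicator (W (Suc N) -` B \<inter> space M) \<omega> \<partial>M)"
proof -
  let ?g = "indicator (W (Suc N) -` B \<inter> space M) :: 'a \<Rightarrow> real"
  have WB: "W (Suc N) -` B \<inter> space M \<in> sets M"
    using weight_measurable[of "Suc N"] B by (auto intro: measurable_sets)
  have "indep_set (sets (vimage_algebra (space M) (W (Suc N)) borel)) (sets (tree_history M W par N (Suc N)))"
    by (rule weight_fresh) fact
  then have "indep_set (sigma_sets (space M) {?g -` A \<inter> space M |A. A \<in> sets borel})
     (sigma_sets (space M) {f -` A \<inter> space M |A. A \<in> sets borel})"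
    unfolding indep_set_def
  proof (rule indep_sets_mono_sets)
    fix b
    have 1: "sigma_sets (space M) {?g -` A \<inter> space M |A. A \<in> sets borel} \<subseteq> sets (vimage_algebra (space M) (W (Suc N)) borel)"
    proof (rule sets.sigma_sets_subset[of _ "vimage_algebra (space M) (W (Suc N)) borel", unfolded space_tree_history space_vimage_algebra], safe)
      fix A :: "real set" assume A: "A \<in> sets borel"
      have g: "?g \<in> borel_measurable (vimage_algebra (space M) (W (Suc N)) borel)"
        using B by (intro borel_measurable_indicator in_vimage_algebra)
      show "?g -` A \<inter> space M \<in> sets (vimage_algebra (space M) (W (Suc N)) borel)"
        using measurable_sets[OF g A] by simp
    qed
    have 2: "sigma_sets (space M) {f -` A \<inter> space M |A. A \<in> sets borel} \<subseteq> sets (tree_history M W par N (Suc N))"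
    proof (rule sets.sigma_sets_subset[of _ "tree_history M W par N (Suc N)", unfolded space_tree_history space_vimage_algebra], safe)
      fix A :: "real set" assume A: "A \<in> sets borel"
      show "f -` A \<inter> space M \<in> sets (tree_history M W par N (Suc N))"
        using measurable_sets[OF f(1) A] by simp
    qed
    show "case_bool (sigma_sets (space M) {?g -` A \<inter> space M |A. A \<in> sets borel}) (sigma_sets (space M) {f -` A \<inter> space M |A. A \<in> sets borel}) b
      \<subseteq> case_bool (sets (vimage_algebra (space M) (W (Suc N)) borel)) (sets (tree_history M W par N (Suc N))) b"
      using 1 2 by (cases b) auto
  qed
  then have "indep_var borel ?g borel f"
    unfolding indep_var_eq using f(1) WB by (auto intro: measurable_history_M)
  then have "(\<integral>\<omega>. ?g \<omega> * f \<omega> \<partial>M) = (\<integral>\<omega>. ?g \<omega> \<partial>M) * (\<integral>\<omega>. f \<omega> \<partial>M)"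
    using f(2) WB by (intro indep_var_lebesgue_integral) (auto intro!: integrable_real_indicator simp: emeasure_eq_measure)
  then show ?thesis by (simp add: mult.commute)
qed

text \<open>Weights of later vertices carry no information about a parent: the attachment rule also holds
  conditionally on the weights of \<open>1, \<dots>, N\<close>, by induction on \<open>N\<close>.\<close>

lemma attachment_future:
  assumes n: "1 \<le> n" "i \<in> {1..n}" and "n \<le> N"
  shows "AE \<omega> in M. real_cond_exp M (tree_history M W par N n)
        (indicator {\<omega>\<in>space M. par (Suc n) \<omega> = i}) \<omega> = attach_weight n i \<omega>"
  using \<open>n \<le> N\<close>
proof (induction N rule: dec_induct)
  case base
  then show ?case using attachment[OF n] by (simp add: attach_weight_def)
next
  case (step N)
  let ?E = "{\<omega>\<in>space M. par (Suc n) \<omega> = i}"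
  let ?f = "indicator ?E :: 'a \<Rightarrow> real"
  let ?g = "attach_weight n i"
  let ?H = "\<lambda>N. tree_history M W par N n"
  interpret H: sigma_finite_subalgebra M "?H N" by (rule sigma_finite_tree_history)
  interpret H': sigma_finite_subalgebra M "?H (Suc N)" by (rule sigma_finite_tree_history)
  have E: "?E \<in> sets M"
    using parent_event[of n "Suc n" i N] n subalgebra_tree_history by (auto simp: subalgebra_def)
  have f: "integrable M ?f" using E by (auto intro!: integrable_real_indicator simp: emeasure_eq_measure)
  have g: "integrable M ?g" using n by (intro integrable_attach_weight)
  have IH: "(\<integral>\<omega>. ?f \<omega> * indicator A \<omega> \<partial>M) = (\<integral>\<omega>. ?g \<omega> * indicator A \<omega> \<partial>M)" if A: "A \<in> sets (?H N)" for A
  proof -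
    have AM: "A \<in> sets M" using A subalgebra_tree_history by (auto simp: subalgebra_def)
    have "(\<integral>\<omega>. ?f \<omega> * indicator A \<omega> \<partial>M) = (\<integral>\<omega>\<in>A. ?f \<omega> \<partial>M)"
      by (simp add: set_lebesgue_integral_def mult.commute)
    also have "\<dots> = (\<integral>\<omega>\<in>A. real_cond_exp M (?H N) ?f \<omega> \<partial>M)"
      by (rule H.real_cond_exp_intA[OF f A])
    also have "\<dots> = (\<integral>\<omega>. ?g \<omega> * indicator A \<omega> \<partial>M)"
      unfolding set_lebesgue_integral_def
    proof (rule integral_cong_AE)
      show "AE \<omega> in M. indicator A \<omega> *\<^sub>R real_cond_exp M (?H N) ?f \<omega> = ?g \<omega> * indicator A \<omega>"
        using step.IH by eventually_elim (simp add: mult.commute)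
    qed (use AM g in \<open>auto intro!: borel_measurable_times borel_measurable_scaleR\<close>)
    finally show ?thesis .
  qed
  \<comment> \<open>An intersection-stable generator of the history enlarged by the weight of \<open>N + 1\<close>.\<close>
  define G where "G = {A \<inter> (W (Suc N) -` B \<inter> space M) | A B. A \<in> sets (?H N) \<and> B \<in> sets borel}"
  have W_meas: "W (Suc N) -` B \<inter> space M \<in> sets M" if "B \<in> sets borel" for B
    using weight_measurable[of "Suc N"] that by (auto intro: measurable_sets)
  have HM: "A \<in> sets (?H N) \<Longrightarrow> A \<in> sets M" for A N
    using subalgebra_tree_history by (auto simp: subalgebra_def)
  have GM: "G \<subseteq> sets M" unfolding G_def using W_meas HM by blast
  have Gpow: "G \<subseteq> Pow (space M)" using GM sets.sets_into_space by blast
  have stable: "Int_stable G"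
  proof (rule Int_stableI)
    fix a b assume "a \<in> G" "b \<in> G"
    then obtain A B A' B' where "A \<in> sets (?H N)" "A' \<in> sets (?H N)" "B \<in> sets borel" "B' \<in> sets borel"
      "a = A \<inter> (W (Suc N) -` B \<inter> space M)" "b = A' \<inter> (W (Suc N) -` B' \<inter> space M)"
      unfolding G_def by blast
    moreover from this have "a \<inter> b = (A \<inter> A') \<inter> (W (Suc N) -` (B \<inter> B') \<inter> space M)" by auto
    ultimately show "a \<inter> b \<in> G" unfolding G_def by blast
  qed
  have spaceN: "space M \<in> sets (?H N)" using sets.top[of "?H N"] by simp
  have GI: "A \<inter> (W (Suc N) -` B \<inter> space M) \<in> sigma_sets (space M) G"
    if "A \<in> sets (?H N)" "B \<in> sets borel" for A B
    using that unfolding G_def by (intro sigma_sets.Basic CollectI exI conjI) (rule refl)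
  have gen: "sets (?H (Suc N)) \<subseteq> sigma_sets (space M) G"
    unfolding sets_tree_history
  proof (rule sigma_sets_mono, rule Un_least; safe)
    fix k :: nat and B :: "real set" assume k: "k \<in> {1..Suc N}" "B \<in> sets borel"
    show "W k -` B \<inter> space M \<in> sigma_sets (space M) G"
    proof (cases "k = Suc N")
      case True
      have "W k -` B \<inter> space M = space M \<inter> (W (Suc N) -` B \<inter> space M)" using True by auto
      then show ?thesis using GI[OF spaceN k(2)] by simp
    next
      case False
      have eq: "W k -` B \<inter> space M = (W k -` B \<inter> space M) \<inter> (W (Suc N) -` UNIV \<inter> space M)" by auto
      have "W k -` B \<inter> space M \<in> sets (?H N)"
        using measurable_sets[OF weight_measurable_history[of k N n] k(2)] k False by simp
      from GI[OF this, of UNIV] show ?thesis by (subst eq) simp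
    qed
  next
    fix j A assume j: "j \<in> {2..n}"
    have eq: "par j -` A \<inter> space M = (par j -` A \<inter> space M) \<inter> (W (Suc N) -` UNIV \<inter> space M)" by auto
    have "par j -` A \<inter> space M \<in> sets (?H N)"
      using measurable_sets[OF parent_measurable_history[of j n N], of A] j by simp
    from GI[OF this, of UNIV] show "par j -` A \<inter> space M \<in> sigma_sets (space M) G"
      by (subst eq) simp
  qed
  have N1: "1 \<le> N" using step n by simp
  have base: "(\<integral>\<omega>. ?f \<omega> * indicator C \<omega> \<partial>M) = (\<integral>\<omega>. ?g \<omega> * indicator C \<omega> \<partial>M)" if C: "C \<in> G" for C
  proof -
    obtain A B where A: "A \<in> sets (?H N)" "B \<in> sets borel" "C = A \<inter> (W (Suc N) -` B \<inter> space M)"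
      using C unfolding G_def by blast
    let ?WB = "W (Suc N) -` B \<inter> space M"
    have A': "A \<in> sets (tree_history M W par N (Suc N))"
      using A tree_history_mono[of N N n "Suc N"] step by auto
    have ind: "indicator C \<omega> = indicator A \<omega> * (indicator ?WB \<omega> :: real)" for \<omega>
      by (simp add: A indicator_inter_arith)
    have fA: "(\<lambda>\<omega>. h \<omega> * indicator A \<omega>) \<in> borel_measurable (tree_history M W par N (Suc N))"
       "integrable M (\<lambda>\<omega>. h \<omega> * indicator A \<omega>)"
      if "h \<in> borel_measurable (tree_history M W par N (Suc N))" "integrable M h" for h :: "'a \<Rightarrow> real"
      using that A' HM[OF A(1)] by (auto intro!: integrable_real_mult_indicator)
    have f': "?f \<in> borel_measurable (tree_history M W par N (Suc N))"
      using parent_event[of n "Suc N" i N] n step by (intro borel_measurable_indicator) auto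
    have g': "?g \<in> borel_measurable (tree_history M W par N (Suc N))"
      using step n by (intro attach_weight_measurable_history) auto
    show ?thesis
      using fresh_weight_factor[OF N1 fA[OF f' f] A(2)] fresh_weight_factor[OF N1 fA[OF g' g] A(2)] IH[OF A(1)]
      by (simp add: ind mult.assoc)
  qed
  have all: "(\<integral>\<omega>. ?f \<omega> * indicator C \<omega> \<partial>M) = (\<integral>\<omega>. ?g \<omega> * indicator C \<omega> \<partial>M)" if "C \<in> sigma_sets (space M) G" for C
    using stable Gpow that
  proof (induction rule: sigma_sets_induct_disjoint)
    case (basic C) then show ?case by (rule base)
  next
    case empty show ?case by simp
  next
    case (compl C)
    have CM: "C \<in> sets M" using compl(1) GM sets.sigma_sets_subset by blast
    have eq: "(\<integral>\<omega>. h \<omega> * indicator (space M - C) \<omega> \<partial>M) = (\<integral>\<omega>. h \<omega> * indicator (space M) \<omega> \<partial>M) - (\<integral>\<omega>. h \<omega> * indicator C \<omega> \<partial>M)"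
      if h: "integrable M h" for h :: "'a \<Rightarrow> real"
    proof -
      have "(\<integral>\<omega>. h \<omega> * indicator (space M - C) \<omega> \<partial>M) = (\<integral>\<omega>. h \<omega> * indicator (space M) \<omega> - h \<omega> * indicator C \<omega> \<partial>M)"
        by (intro Bochner_Integration.integral_cong) (auto simp: indicator_def)
      then show ?thesis
        using h CM by (simp add: integrable_real_mult_indicator Bochner_Integration.integral_diff)
    qed
    show ?case using IH[OF spaceN] compl(2) by (simp add: eq[OF f] eq[OF g])
  next
    case (union A)
    have AM: "A k \<in> sets M" for k using union(2) GM sets.sigma_sets_subset by blast
    have "(\<integral>\<omega>. h \<omega> * indicator (\<Union>(range A)) \<omega> \<partial>M) = (\<Sum>k. \<integral>\<omega>. h \<omega> * indicator (A k) \<omega> \<partial>M)"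
      if h: "integrable M h" for h :: "'a \<Rightarrow> real"
    proof -
      have int: "set_integrable M (\<Union>k. A k) h"
        using h AM unfolding set_integrable_def by (intro integrable_mult_indicator) auto
      have "(\<integral>\<omega>\<in>(\<Union>k. A k). h \<omega> \<partial>M) = (\<Sum>k. \<integral>\<omega>\<in>A k. h \<omega> \<partial>M)"
        using union(1) AM int by (intro lebesgue_integral_countable_add) (auto simp: disjoint_family_on_def)
      then show ?thesis by (simp add: set_lebesgue_integral_def mult.commute)
    qed
    from this[OF f] this[OF g] show ?case using union(3) by simp
  qed
  show ?case
  proof (rule H'.real_cond_exp_charact)
    fix A assume "A \<in> sets (?H (Suc N))"
    then show "(\<integral>\<omega>\<in>A. ?f \<omega> \<partial>M) = (\<integral>\<omega>\<in>A. ?g \<omega> \<partial>M)"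
      using all[of A] gen by (auto simp: set_lebesgue_integral_def mult.commute)
  next
    show "?g \<in> borel_measurable (?H (Suc N))"
      using step n by (intro attach_weight_measurable_history) auto
  qed (fact f g)+
qed

end

context weighted_recursive_tree begin

lemma attach_step_measurable:
  assumes "\<And>z. F z \<in> borel_measurable K" "\<And>v. v \<in> {1..k} \<Longrightarrow> W v \<in> borel_measurable K"
  shows "(\<lambda>\<omega>. attach_step (\<lambda>v. W v \<omega>) k (\<lambda>z. F z \<omega>) z) \<in> borel_measurable K"
proof -
  have q: "(\<lambda>\<omega>. attach_prob (\<lambda>v. W v \<omega>) k v) \<in> borel_measurable K" for v
    unfolding attach_prob_def using assms(2)
    by (cases "v \<in> {1..k}") (auto intro!: borel_measurable_divide borel_measurable_sum)
  show ?thesis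
    unfolding attach_step_def
    by (intro borel_measurable_add borel_measurable_sum borel_measurable_times borel_measurable_diff q assms(1))
qed

lemma quenched_measurable:
  assumes "\<And>z. F z \<in> borel_measurable K" "\<And>v. v \<in> {1..n} \<Longrightarrow> W v \<in> borel_measurable K"
  shows "(\<lambda>\<omega>. quenched_expectation (\<lambda>v. W v \<omega>) n (\<lambda>z. F z \<omega>) z) \<in> borel_measurable K"
  using assms
proof (induction n arbitrary: F)
  case (Suc n)
  show ?case
    unfolding quenched_expectation.simps
    by (rule Suc.IH) (use Suc.prems in \<open>auto intro!: attach_step_measurable\<close>)
qed simp

lemma attach_step_bound:
  assumes "positive_weights w" "\<And>z. \<bar>F z\<bar> \<le> B"
  shows "\<bar>attach_step w n F z\<bar> \<le> B"
proof -
  interpret positive_weights w by fact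
  have "attach_step w n F z \<le> B"
    using attach_step_mono[of F "\<lambda>_. B" n z] assms(2) by (auto simp: abs_le_iff attach_step_const)
  moreover have "- B \<le> attach_step w n F z"
  proof -
    have "- B \<le> F z" for z using assms(2)[of z] by linarith
    from attach_step_mono[of "\<lambda>_. - B" F n z, OF this] show ?thesis by (simp add: attach_step_const)
  qed
  ultimately show ?thesis by (simp add: abs_le_iff)
qed

lemma AE_positive_weights: "AE \<omega> in M. positive_weights (\<lambda>v. W v \<omega>)"
  using AE_weight_pos by eventually_elim (auto simp: positive_weights_def)

lemma count_list_snoc: "count_list (xs @ [a]) = (count_list xs)(a := Suc (count_list xs a))"
  by (auto simp: fun_eq_iff)

text \<open>Given the weights of \<open>1, \<dots>, N\<close>, the last step of the tree can be integrated out. The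
  function \<open>F\<close> may depend on the weights, as it does after the first such step.\<close>

lemma attach_step_expectation:
  assumes "1 \<le> n" "n \<le> N"
    and F: "\<And>z. F z \<in> borel_measurable (tree_history M W par N 1)"
    and B: "AE \<omega> in M. \<forall>z. \<bar>F z \<omega>\<bar> \<le> B"
  shows "(\<integral>\<omega>. F (count_list (parents par (Suc n) \<omega>)) \<omega> \<partial>M)
       = (\<integral>\<omega>. attach_step (\<lambda>v. W v \<omega>) n (\<lambda>z. F z \<omega>) (count_list (parents par n \<omega>)) \<partial>M)"
proof -
  let ?H = "tree_history M W par N n"
  interpret H: sigma_finite_subalgebra M ?H by (rule sigma_finite_tree_history)
  have FH: "F z \<in> borel_measurable ?H" for z
    using F[of z] subalgebra_tree_history_mono[of N N 1 n] assms(1) by (auto intro: measurable_from_subalg)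
  define G where "G i \<omega> = F (count_list (parents par n \<omega> @ [i])) \<omega>" for i \<omega>
  have G: "G i \<in> borel_measurable ?H" for i
    unfolding G_def
    by (rule measurable_compose_countable[OF _ parents_measurable_history]) (use FH in auto)
  have GB: "AE \<omega> in M. \<forall>i. \<bar>G i \<omega>\<bar> \<le> B"
    using B by eventually_elim (auto simp: G_def)
  define I where "I i = (indicator {\<omega>\<in>space M. par (Suc n) \<omega> = i} :: 'a \<Rightarrow> real)" for i
  have E: "{\<omega>\<in>space M. par (Suc n) \<omega> = i} \<in> sets M" for i
    using parent_event[of n "Suc n" i N] assms subalgebra_tree_history by (auto simp: subalgebra_def)
  have I: "I i \<in> borel_measurable M" for i using E by (auto simp: I_def)
  have intGI: "integrable M (\<lambda>\<omega>. G i \<omega> * I i \<omega>)" for i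
  proof (rule integrable_const_bound[where B = B])
    show "AE \<omega> in M. norm (G i \<omega> * I i \<omega>) \<le> B"
      using GB
    proof eventually_elim
      case (elim \<omega>)
      then have "\<bar>G i \<omega>\<bar> * \<bar>I i \<omega>\<bar> \<le> B * 1" by (intro mult_mono) (auto simp: I_def indicator_def intro: order_trans[OF abs_ge_zero])
      then show ?case by (simp add: abs_mult)
    qed
  qed (use measurable_history_M[OF G] I in auto)
  have intGW: "integrable M (\<lambda>\<omega>. G i \<omega> * attach_weight n i \<omega>)" if "i \<in> {1..n}" for i
  proof (rule integrable_const_bound[where B = B])
    show "AE \<omega> in M. norm (G i \<omega> * attach_weight n i \<omega>) \<le> B"
      using GB attach_weight_bounds
    proof eventually_elim
      case (elim \<omega>)
      then have "\<bar>G i \<omega>\<bar> * \<bar>attach_weight n i \<omega>\<bar> \<le> B * 1"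
        using that by (intro mult_mono) (auto intro: order_trans[OF abs_ge_zero])
      then show ?case by (simp add: abs_mult)
    qed
    show "(\<lambda>\<omega>. G i \<omega> * attach_weight n i \<omega>) \<in> borel_measurable M"
      using measurable_history_M[OF G] attach_weight_measurable_history[of n n i n] that
      by (auto intro!: borel_measurable_times intro: measurable_history_M)
  qed
  have step: "(\<integral>\<omega>. G i \<omega> * I i \<omega> \<partial>M) = (\<integral>\<omega>. G i \<omega> * attach_weight n i \<omega> \<partial>M)" if i: "i \<in> {1..n}" for i
  proof -
    have "(\<integral>\<omega>. G i \<omega> * I i \<omega> \<partial>M) = (\<integral>\<omega>. G i \<omega> * real_cond_exp M ?H (I i) \<omega> \<partial>M)"
      using H.real_cond_exp_intg(2)[OF intGI G I] by simp
    also have "\<dots> = (\<integral>\<omega>. G i \<omega> * attach_weight n i \<omega> \<partial>M)"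
    proof (rule integral_cong_AE)
      show "AE \<omega> in M. G i \<omega> * real_cond_exp M ?H (I i) \<omega> = G i \<omega> * attach_weight n i \<omega>"
        using attachment_future[OF assms(1) i assms(2)] unfolding I_def by eventually_elim simp
    qed (use measurable_history_M[OF G] borel_measurable_integrable[OF intGW[OF i]] in auto)
    finally show ?thesis .
  qed
  have "(\<integral>\<omega>. F (count_list (parents par (Suc n) \<omega>)) \<omega> \<partial>M) = (\<integral>\<omega>. (\<Sum>i=1..n. G i \<omega> * I i \<omega>) \<partial>M)"
  proof (rule Bochner_Integration.integral_cong[OF refl])
    fix \<omega> assume \<omega>: "\<omega> \<in> space M"
    have p: "par (Suc n) \<omega> \<in> {1..n}" using parent_range[OF assms(1) \<omega>] .
    have "(\<Sum>i=1..n. G i \<omega> * I i \<omega>) = (\<Sum>i\<in>{par (Suc n) \<omega>}. G i \<omega> * I i \<omega>)"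
      using p by (intro sum.mono_neutral_right) (auto simp: I_def indicator_def)
    also have "\<dots> = F (count_list (parents par (Suc n) \<omega>)) \<omega>"
      using \<omega> assms by (simp add: I_def G_def parents_Suc)
    finally show "F (count_list (parents par (Suc n) \<omega>)) \<omega> = (\<Sum>i=1..n. G i \<omega> * I i \<omega>)" by simp
  qed
  also have "\<dots> = (\<Sum>i=1..n. \<integral>\<omega>. G i \<omega> * I i \<omega> \<partial>M)"
    by (intro Bochner_Integration.integral_sum intGI)
  also have "\<dots> = (\<Sum>i=1..n. \<integral>\<omega>. G i \<omega> * attach_weight n i \<omega> \<partial>M)"
    by (intro sum.cong step refl)
  also have "\<dots> = (\<integral>\<omega>. (\<Sum>i=1..n. G i \<omega> * attach_weight n i \<omega>) \<partial>M)"
    by (intro Bochner_Integration.integral_sum[symmetric] intGW)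
  also have "\<dots> = (\<integral>\<omega>. attach_step (\<lambda>v. W v \<omega>) n (\<lambda>z. F z \<omega>) (count_list (parents par n \<omega>)) \<partial>M)"
  proof (rule integral_cong_AE)
    show "(\<lambda>\<omega>. \<Sum>i=1..n. G i \<omega> * attach_weight n i \<omega>) \<in> borel_measurable M"
      using intGW by (intro borel_measurable_sum) auto
    have "(\<lambda>\<omega>. attach_step (\<lambda>v. W v \<omega>) n (\<lambda>z. F z \<omega>) (count_list xs)) \<in> borel_measurable M" for xs
      using measurable_history_M[OF FH] weight_measurable by (intro attach_step_measurable) auto
    then show "(\<lambda>\<omega>. attach_step (\<lambda>v. W v \<omega>) n (\<lambda>z. F z \<omega>) (count_list (parents par n \<omega>))) \<in> borel_measurable M"
      by (rule measurable_compose_countable[OF _ parents_measurable])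
    show "AE \<omega> in M. (\<Sum>i=1..n. G i \<omega> * attach_weight n i \<omega>)
        = attach_step (\<lambda>v. W v \<omega>) n (\<lambda>z. F z \<omega>) (count_list (parents par n \<omega>))"
      using AE_positive_weights
    proof eventually_elim
      case (elim \<omega>)
      interpret positive_weights "\<lambda>v. W v \<omega>" by fact
      have "attach_step (\<lambda>v. W v \<omega>) n (\<lambda>z. F z \<omega>) (count_list (parents par n \<omega>))
          = (\<Sum>i=1..n. attach_prob (\<lambda>v. W v \<omega>) n i * G i \<omega>)"
        unfolding attach_step_altdef sum_attach_prob[OF assms(1)] by (simp add: G_def count_list_snoc)
      also have "\<dots> = (\<Sum>i=1..n. G i \<omega> * attach_weight n i \<omega>)"
        by (intro sum.cong) (auto simp: attach_prob_def attach_weight_def)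
      finally show ?case by simp
    qed
  qed
  finally show ?thesis .
qed

lemma annealing:
  assumes "n \<le> N"
    and F: "\<And>z. F z \<in> borel_measurable (tree_history M W par N 1)"
    and B: "AE \<omega> in M. \<forall>z. \<bar>F z \<omega>\<bar> \<le> B"
  shows "(\<integral>\<omega>. F (count_list (parents par n \<omega>)) \<omega> \<partial>M)
       = (\<integral>\<omega>. quenched_expectation (\<lambda>v. W v \<omega>) n (\<lambda>z. F z \<omega>) (\<lambda>_. 0) \<partial>M)"
  using assms
proof (induction n arbitrary: F)
  case 0
  then show ?case by (simp add: parents_le_1 fun_eq_iff[symmetric])
next
  case (Suc n)
  show ?case
  proof (cases "1 \<le> n")
    case True
    have "(\<integral>\<omega>. F (count_list (parents par (Suc n) \<omega>)) \<omega> \<partial>M)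
       = (\<integral>\<omega>. attach_step (\<lambda>v. W v \<omega>) n (\<lambda>z. F z \<omega>) (count_list (parents par n \<omega>)) \<partial>M)"
      using Suc.prems True by (intro attach_step_expectation[where N = N]) auto
    also have "\<dots> = (\<integral>\<omega>. quenched_expectation (\<lambda>v. W v \<omega>) n
        (\<lambda>z. attach_step (\<lambda>v. W v \<omega>) n (\<lambda>z. F z \<omega>) z) (\<lambda>_. 0) \<partial>M)"
    proof (rule Suc.IH)
      show "(\<lambda>\<omega>. attach_step (\<lambda>v. W v \<omega>) n (\<lambda>z. F z \<omega>) z) \<in> borel_measurable (tree_history M W par N 1)" for z
        using Suc.prems by (intro attach_step_measurable weight_measurable_history) auto
      show "AE \<omega> in M. \<forall>z. \<bar>attach_step (\<lambda>v. W v \<omega>) n (\<lambda>z. F z \<omega>) z\<bar> \<le> B"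
        using AE_positive_weights Suc.prems(3) by eventually_elim (auto intro: attach_step_bound)
    qed (use Suc.prems in simp)
    finally show ?thesis by simp
  next
    case False
    then have "n = 0" by simp
    then show ?thesis by (simp add: parents_le_1 attach_step_def fun_eq_iff[symmetric])
  qed
qed

text \<open>The law of the in-degrees is the mixture of the quenched laws.\<close>

lemma annealed_expectation:
  fixes F :: "(nat \<Rightarrow> nat) \<Rightarrow> real"
  assumes "\<And>z. \<bar>F z\<bar> \<le> B"
  shows "(\<integral>\<omega>. F (\<lambda>v. tree_in_degree par n v \<omega>) \<partial>M)
       = (\<integral>\<omega>. quenched_expectation (\<lambda>v. W v \<omega>) n F (\<lambda>_. 0) \<partial>M)"
  using annealing[of n n "\<lambda>z _. F z" B] assms by (simp add: tree_in_degree_conv_parents)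

end

section \<open>Almost sure properties of the weights\<close>

lemma (in prob_space) hoeffding_iid_unit:
  fixes X :: "nat \<Rightarrow> 'a \<Rightarrow> real"
  assumes "indep_vars (\<lambda>_. borel) X {1..k}" "\<And>v. v \<in> {1..k} \<Longrightarrow> distr M borel (X v) = distr M borel Y"
    and "Y \<in> borel_measurable M" "\<And>\<omega>. Y \<omega> \<in> {0..1}" and "0 \<le> \<epsilon>" "1 \<le> k"
  shows "prob {\<omega>\<in>space M. \<epsilon> \<le> \<bar>(\<Sum>v\<in>{1..k}. X v \<omega>) - real k * expectation Y\<bar>} \<le> 2 * exp (- 2 * \<epsilon>\<^sup>2 / real k)"
proof -
  have "AE \<omega> in M. Y \<omega> \<in> {0..1}" using assms(4) by simp
  then interpret Hoeffding_ineq_iid M "{1..k}" X Y 0 1 "expectation Y"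
    using assms(1-3) by unfold_locales auto
  show ?thesis using Hoeffding_ineq_abs_ge[of \<epsilon>] assms(5,6) by simp
qed

context weighted_recursive_tree begin

text \<open>A strong law with rate \<open>k powr (2/3)\<close>, by Hoeffding's inequality and the Borel-Cantelli lemma.\<close>

lemma empirical_mean:
  fixes h :: "real \<Rightarrow> real"
  assumes h: "h \<in> borel_measurable borel" "\<And>x. 0 \<le> h x \<and> h x \<le> 1"
  shows "AE \<omega> in M. eventually (\<lambda>k. \<bar>(\<Sum>v=1..k. h (W v \<omega>)) - (\<integral>x. h x \<partial>D) * real k\<bar> \<le> real k powr (2/3)) sequentially"
proof -
  let ?A = "\<lambda>k. {\<omega>\<in>space M. real k powr (2/3) \<le> \<bar>(\<Sum>v=1..k. h (W v \<omega>)) - real k * (\<integral>x. h x \<partial>D)\<bar>}"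
  have hW: "(\<lambda>\<omega>. h (W v \<omega>)) \<in> borel_measurable M" if "1 \<le> v" for v
    using measurable_compose[OF weight_measurable[OF that] h(1)] .
  have mean: "expectation (\<lambda>\<omega>. h (W 1 \<omega>)) = (\<integral>x. h x \<partial>D)"
    using integral_distr[of "W 1" M borel h] weight_measurable[of 1] h(1) weight_distr[of 1] by simp
  have A_meas: "?A k \<in> sets M" for k
    using hW by (intro borel_measurable_le borel_measurable_abs borel_measurable_diff borel_measurable_sum) auto
  have bound: "measure M (?A k) \<le> 2 * exp (- 2 * real k powr (1/3))" if k: "1 \<le> k" for k
  proof -
    have iid: "indep_vars (\<lambda>_. borel) (\<lambda>v \<omega>. h (W v \<omega>)) {1..k}"
      using h(1) by (intro indep_vars_compose2[OF indep_vars_subset[OF weight_indep]]) auto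
    have same: "distr M borel (\<lambda>\<omega>. h (W v \<omega>)) = distr M borel (\<lambda>\<omega>. h (W 1 \<omega>))" if "v \<in> {1..k}" for v
    proof -
      have "distr M borel (h \<circ> W u) = distr D borel h" if "1 \<le> u" for u
        using distr_distr[OF h(1) weight_measurable[OF that]] weight_distr[OF that] by simp
      then show ?thesis using that by (simp add: comp_def)
    qed
    have "measure M (?A k) \<le> 2 * exp (- 2 * (real k powr (2/3))\<^sup>2 / real k)"
      using hoeffding_iid_unit[OF iid same hW[of 1], of "real k powr (2/3)"] h(2) k by (simp add: mean[unfolded One_nat_def])
    also have "- 2 * (real k powr (2/3))\<^sup>2 / real k = - 2 * real k powr (1/3)"
    proof -
      have "(real k powr (2/3))\<^sup>2 = real k powr (4/3)"
        by (simp add: power2_eq_square flip: powr_add)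
      also have "\<dots> / real k = real k powr (4/3 - 1)"
        unfolding powr_diff using k by simp
      finally have "(real k powr (2/3))\<^sup>2 / real k = real k powr (1/3)" by simp
      then show ?thesis by simp
    qed
    finally show ?thesis .
  qed
  have "summable (\<lambda>k. measure M (?A k))"
  proof (rule summable_comparison_test_ev)
    show "summable (\<lambda>k. real k powr (-2))" by (simp add: summable_real_powr_iff)
    have "eventually (\<lambda>k. 2 * exp (- 2 * real k powr (1/3)) \<le> real k powr (-2)) sequentially"
      by real_asymp
    then show "eventually (\<lambda>k. norm (measure M (?A k)) \<le> real k powr (-2)) sequentially"
      using eventually_ge_at_top[of 1]
    proof eventually_elim
      case (elim k)
      then show ?case using order_trans[OF bound elim(1)] by simp
    qed
  qed
  moreover have "emeasure M (?A k) < \<infinity>" for k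
    using emeasure_finite by (simp only: infinity_ennreal_def less_top[symmetric] not_False_eq_True)
  ultimately have "AE \<omega> in M. eventually (\<lambda>k. \<omega> \<in> space M - ?A k) sequentially"
    by (rule borel_cantelli_AE1[OF A_meas, rotated])
  then show ?thesis
  proof eventually_elim
    case (elim \<omega>)
    then show ?case
    proof eventually_elim
      case (elim k)
      then show ?case by (auto simp: mult.commute)
    qed
  qed
qed

text \<open>Almost every realisation of the weights is typical.\<close>

lemma AE_typical_weights:
  assumes range: "AE x in D. x \<in> {0<..1}"
    and q0: "measure D {1} = q" "0 < q" and mu: "(\<integral>x. x \<partial>D) = \<mu>" "0 < \<mu>"
  shows "AE \<omega> in M. typical_weights (\<lambda>v. W v \<omega>) \<mu> q"
proof -
  interpret D: real_distribution D by (rule weight_law)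
  have space_D: "space D = UNIV" by simp
  let ?emp = "\<lambda>h \<omega>. eventually (\<lambda>k. \<bar>(\<Sum>v=1..k. h (W v \<omega>)) - (\<integral>x. h x \<partial>D) * real k\<bar> \<le> real k powr (2/3)) sequentially"
  \<comment> \<open>The weights lie in \<open>{0<..1}\<close> only almost surely, whereas \<open>empirical_mean\<close> asks for a function
    with values in the unit interval.\<close>
  define clip where "clip x = max 0 (min 1 x)" for x :: real
  define b where "b r = 1 - 1 / (real r + 2)" for r :: nat
  have 1: "AE \<omega> in M. ?emp clip \<omega>" by (rule empirical_mean) (auto simp: clip_def)
  have 2: "AE \<omega> in M. ?emp (indicator {1}) \<omega>" by (rule empirical_mean) (auto simp: indicator_def)
  have 3: "AE \<omega> in M. \<forall>r. ?emp (indicator {b r<..}) \<omega>"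
    unfolding AE_all_countable by (intro allI empirical_mean) (auto simp: indicator_def)
  have 4: "AE \<omega> in M. \<forall>v\<ge>1. W v \<omega> \<in> {0<..1}"
  proof -
    have "AE \<omega> in M. 1 \<le> i \<longrightarrow> W i \<omega> \<in> {0<..1}" for i
    proof (cases "1 \<le> i")
      case True
      have "AE x in distr M borel (W i). x \<in> {0<..1}" unfolding weight_distr[OF True] by (rule range)
      then show ?thesis using weight_measurable[OF True] True by (subst (asm) AE_distr_iff) auto
    qed simp
    then show ?thesis by (simp add: AE_all_countable)
  qed
  have clip_mean: "(\<integral>x. clip x \<partial>D) = \<mu>"
  proof -
    have "(\<integral>x. clip x \<partial>D) = (\<integral>x. x \<partial>D)"
    proof (rule integral_cong_AE)
      show "AE x in D. clip x = x" using range by eventually_elim (auto simp: clip_def)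
    qed (auto simp: clip_def)
    then show ?thesis using mu by simp
  qed
  have b_lim: "(\<lambda>r. measure D {b r<..}) \<longlonglongrightarrow> q"
  proof -
    have b_mono: "b r \<le> b r'" if "r \<le> r'" for r r'
      using that by (auto simp: b_def intro!: divide_left_mono)
    have "(\<lambda>r. measure D {b r<..}) \<longlonglongrightarrow> measure D (\<Inter>r. {b r<..})"
      using b_mono by (intro D.finite_Lim_measure_decseq) (auto simp: decseq_def intro: le_less_trans)
    also have "measure D (\<Inter>r. {b r<..}) = measure D {1}"
    proof (rule D.finite_measure_eq_AE)
      have iff: "x \<in> (\<Inter>r. {b r<..}) \<longleftrightarrow> x = 1" if "x \<in> {0<..1}" for x
      proof
        assume x: "x \<in> (\<Inter>r. {b r<..})"
        have "b \<longlonglongrightarrow> 1" unfolding b_def by real_asymp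
        moreover have "b r \<le> x" for r using x by (auto intro: less_imp_le)
        ultimately have "1 \<le> x" by (intro LIMSEQ_le_const2) auto
        then show "x = 1" using that by simp
      next
        assume "x = 1"
        then show "x \<in> (\<Inter>r. {b r<..})" by (auto simp: b_def)
      qed
      show "AE x in D. (x \<in> (\<Inter>r. {b r<..})) = (x \<in> {1})"
        using range by (rule eventually_mono) (simp only: iff singleton_iff)
    qed auto
    finally show ?thesis using q0 by simp
  qed
  show ?thesis using 1 2 3 4
  proof eventually_elim
    case (elim \<omega>)
    have card_ind: "(\<Sum>v=1..k. indicator A (W v \<omega>)) = real (card {v\<in>{1..k}. W v \<omega> \<in> A})" for A k
    proof -
      have "(\<Sum>v=1..k. indicator A (W v \<omega>)) = (\<Sum>v\<in>{v\<in>{1..k}. W v \<omega> \<in> A}. 1 :: real)"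
        by (rule sum.mono_neutral_cong_right) (auto simp: indicator_def)
      then show ?thesis by simp
    qed
    have clip_sum: "(\<Sum>v=1..k. clip (W v \<omega>)) = (\<Sum>v=1..k. W v \<omega>)" for k
      using elim(4) by (intro sum.cong) (auto simp: clip_def)
    show ?case
    proof
      show "0 < W v \<omega>" "W v \<omega> \<le> 1" if "1 \<le> v" for v using elim(4) that by auto
      show "0 < \<mu>" "0 < q" by fact+
      show "eventually (\<lambda>k. \<bar>(\<Sum>j=1..k. W j \<omega>) - \<mu> * real k\<bar> \<le> real k powr (2/3)) sequentially"
        using elim(1) unfolding clip_sum clip_mean .
      have "eventually (\<lambda>k. \<bar>real (card {v\<in>{1..k}. W v \<omega> = 1}) - q * real k\<bar> \<le> real k powr (2/3)) sequentially"
        using elim(2) unfolding card_ind by (simp add: q0)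
      then have ev: "eventually (\<lambda>k. norm (real (card {v\<in>{1..k}. W v \<omega> = 1}) / real k - q) \<le> real k powr (-1/3)) sequentially"
        using eventually_ge_at_top[of 1]
      proof eventually_elim
        case (elim k)
        let ?c = "real (card {v\<in>{1..k}. W v \<omega> = 1})"
        have "?c / real k - q = (?c - q * real k) / real k" using elim by (simp add: field_simps)
        then have "norm (?c / real k - q) = \<bar>?c - q * real k\<bar> / real k" by simp
        also have "\<dots> \<le> real k powr (2/3) / real k" using elim by (intro divide_right_mono) auto
        also have "\<dots> = real k powr (2/3 - 1)" unfolding powr_diff using elim by simp
        finally show ?case by simp
      qed
      have "(\<lambda>k. real k powr (-1/3)) \<longlonglongrightarrow> 0" by real_asymp
      with ev have "(\<lambda>k. real (card {v\<in>{1..k}. W v \<omega> = 1}) / real k - q) \<longlonglongrightarrow> 0"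
        by (rule Lim_null_comparison)
      then show "(\<lambda>k. real (card {v\<in>{1..k}. W v \<omega> = 1}) / real k) \<longlonglongrightarrow> q"
        by (rule LIM_zero_cancel)
      fix \<delta> :: real assume \<delta>: "0 < \<delta>"
      have "eventually (\<lambda>r. measure D {b r<..} < q + \<delta> / 2) sequentially"
        using \<delta> by (intro order_tendstoD(2)[OF b_lim]) auto
      then obtain r where r: "measure D {b r<..} < q + \<delta> / 2"
        by (auto simp: eventually_at_top_linorder)
      have "eventually (\<lambda>k. \<bar>real (card {v\<in>{1..k}. b r < W v \<omega>}) - measure D {b r<..} * real k\<bar> \<le> real k powr (2/3)) sequentially"
        using elim(3)[rule_format, of r] unfolding card_ind by simp
      moreover have "eventually (\<lambda>k. real k powr (2/3) \<le> \<delta> / 2 * real k) sequentially"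
        using \<delta> by real_asymp
      ultimately have "eventually (\<lambda>k. real (card {v\<in>{1..k}. b r < W v \<omega>}) \<le> (q + \<delta>) * real k) sequentially"
      proof eventually_elim
        case (elim k)
        have "measure D {b r<..} * real k \<le> (q + \<delta> / 2) * real k" using r by (intro mult_right_mono) auto
        then show ?case using elim by (simp add: algebra_simps)
      qed
      moreover have "0 < b r" "b r < 1" by (auto simp: b_def field_simps)
      ultimately show "\<exists>b. 0 < b \<and> b < 1 \<and>
        eventually (\<lambda>k. real (card {v\<in>{1..k}. b < W v \<omega>}) \<le> (q + \<delta>) * real k) sequentially"
        by blast
    qed
  qed
qed

end

section \<open>From generating functions to point probabilities\<close>

text \<open>The coefficient of \<open>s ^ m\<close> is recovered from a generating function once the lower
  coefficients are known, with an error at most \<open>s\<close>.\<close>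

lemma (in prob_space) pgf_coefficient_error:
  fixes X :: "'a \<Rightarrow> nat" and R :: "'a \<Rightarrow> real"
  assumes X: "X \<in> measurable M (count_space UNIV)" and R: "R \<in> borel_measurable M"
    and R01: "\<And>\<omega>. 0 \<le> R \<omega> \<and> R \<omega> \<le> 1" and s: "0 < s" "s \<le> (1::real)"
  shows "\<bar>((\<integral>\<omega>. s ^ X \<omega> * R \<omega> \<partial>M) - (\<Sum>j<m. s ^ j * (\<integral>\<omega>. (if X \<omega> = j then 1 else 0) * R \<omega> \<partial>M))) / s ^ m
           - (\<integral>\<omega>. (if X \<omega> = m then 1 else 0) * R \<omega> \<partial>M)\<bar> \<le> s"
proof -
  let ?I = "\<lambda>j \<omega>. (if X \<omega> = j then 1 else 0 :: real)"
  have meas: "(\<lambda>\<omega>. f (X \<omega>) * R \<omega>) \<in> borel_measurable M" for f :: "nat \<Rightarrow> real"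
    using measurable_compose[OF X, of f borel] R by (intro borel_measurable_times) auto
  have int: "integrable M (\<lambda>\<omega>. f (X \<omega>) * R \<omega>)" if "\<And>x. 0 \<le> f x \<and> f x \<le> 1" for f :: "nat \<Rightarrow> real"
  proof (rule integrable_const_bound[where B = 1])
    show "AE \<omega> in M. norm (f (X \<omega>) * R \<omega>) \<le> 1"
      using that R01 by (intro AE_I2) (auto simp: abs_mult intro!: mult_le_one)
  qed (rule meas)
  have s01: "0 \<le> s ^ k \<and> s ^ k \<le> 1" for k using s by (auto intro: power_le_one)
  have pw: "s ^ x - (\<Sum>j\<le>m. s ^ j * (if x = j then 1 else 0)) = (if m < x then s ^ x else 0)" for x
  proof (cases "m < x")
    case False
    then have "(\<Sum>j\<le>m. s ^ j * (if x = j then 1 else 0)) = (\<Sum>j\<in>{x}. s ^ j)"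
      by (intro sum.mono_neutral_cong_right) auto
    then show ?thesis using False by simp
  qed (auto intro!: sum.neutral)
  let ?E = "\<integral>\<omega>. (if m < X \<omega> then s ^ X \<omega> else 0) * R \<omega> \<partial>M"
  have "(\<integral>\<omega>. s ^ X \<omega> * R \<omega> \<partial>M) - (\<Sum>j\<le>m. s ^ j * (\<integral>\<omega>. ?I j \<omega> * R \<omega> \<partial>M))
      = (\<integral>\<omega>. s ^ X \<omega> * R \<omega> - (\<Sum>j\<le>m. s ^ j * (?I j \<omega> * R \<omega>)) \<partial>M)"
    using int[of "\<lambda>x. s ^ x"] int[of "\<lambda>x. if x = j then 1 else 0" for j] s01
    by (subst Bochner_Integration.integral_diff) (auto simp: Bochner_Integration.integral_sum)
  also have "\<dots> = ?E"
  proof (rule Bochner_Integration.integral_cong[OF refl])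
    fix \<omega>
    have "s ^ X \<omega> * R \<omega> - (\<Sum>j\<le>m. s ^ j * (?I j \<omega> * R \<omega>)) = (s ^ X \<omega> - (\<Sum>j\<le>m. s ^ j * ?I j \<omega>)) * R \<omega>"
      by (simp add: left_diff_distrib sum_distrib_right mult.assoc)
    then show "s ^ X \<omega> * R \<omega> - (\<Sum>j\<le>m. s ^ j * (?I j \<omega> * R \<omega>)) = (if m < X \<omega> then s ^ X \<omega> else 0) * R \<omega>"
      unfolding pw .
  qed
  finally have eq: "(\<integral>\<omega>. s ^ X \<omega> * R \<omega> \<partial>M) - (\<Sum>j<m. s ^ j * (\<integral>\<omega>. ?I j \<omega> * R \<omega> \<partial>M))
      = s ^ m * (\<integral>\<omega>. ?I m \<omega> * R \<omega> \<partial>M) + ?E"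
    by (simp add: lessThan_Suc_atMost[symmetric])
  have E0: "0 \<le> ?E"
    using R01 s by (intro Bochner_Integration.integral_nonneg) auto
  have E1: "?E \<le> s ^ Suc m"
  proof -
    have "?E \<le> (\<integral>\<omega>. s ^ Suc m \<partial>M)"
    proof (rule integral_mono)
      show "integrable M (\<lambda>\<omega>. (if m < X \<omega> then s ^ X \<omega> else 0) * R \<omega>)"
        using s01 by (intro int[of "\<lambda>x. if m < x then s ^ x else 0"]) auto
      fix \<omega>
      show "(if m < X \<omega> then s ^ X \<omega> else 0) * R \<omega> \<le> s ^ Suc m"
      proof (cases "m < X \<omega>")
        case True
        then have "s ^ X \<omega> * R \<omega> \<le> s ^ Suc m * 1"
          using R01 s by (intro mult_mono power_decreasing) auto
        then show ?thesis using True by simp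
      qed (use s in simp)
    qed simp
    then show ?thesis by (simp add: prob_space)
  qed
  have "((\<integral>\<omega>. s ^ X \<omega> * R \<omega> \<partial>M) - (\<Sum>j<m. s ^ j * (\<integral>\<omega>. ?I j \<omega> * R \<omega> \<partial>M))) / s ^ m
      - (\<integral>\<omega>. ?I m \<omega> * R \<omega> \<partial>M) = ?E / s ^ m"
    unfolding eq using s by (simp add: field_simps)
  also have "\<bar>\<dots>\<bar> \<le> s" using E0 E1 s by (simp add: divide_le_eq)
  finally show ?thesis .
qed

lemma pgf_coefficient_tendsto:
  fixes X :: "nat \<Rightarrow> 'a \<Rightarrow> nat" and R :: "nat \<Rightarrow> 'a \<Rightarrow> real" and Y :: "'b \<Rightarrow> nat" and Q :: "'b \<Rightarrow> real"
  assumes "prob_space M" "prob_space N"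
    and X: "\<And>l. X l \<in> measurable M (count_space UNIV)" "\<And>l. R l \<in> borel_measurable M"
      "\<And>l \<omega>. 0 \<le> R l \<omega> \<and> R l \<omega> \<le> 1"
    and Y: "Y \<in> measurable N (count_space UNIV)" "Q \<in> borel_measurable N" "\<And>\<omega>. 0 \<le> Q \<omega> \<and> Q \<omega> \<le> 1"
    and pgf: "\<And>s. 0 < s \<Longrightarrow> s \<le> 1 \<Longrightarrow> (\<lambda>l. \<integral>\<omega>. s ^ X l \<omega> * R l \<omega> \<partial>M) \<longlonglongrightarrow> (\<integral>\<omega>. s ^ Y \<omega> * Q \<omega> \<partial>N)"
  shows "(\<lambda>l. \<integral>\<omega>. (if X l \<omega> = m then 1 else 0) * R l \<omega> \<partial>M) \<longlonglongrightarrow> (\<integral>\<omega>. (if Y \<omega> = m then 1 else 0) * Q \<omega> \<partial>N)"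
proof (induction m rule: less_induct)
  case (less m)
  interpret M: prob_space M by fact
  interpret N: prob_space N by fact
  let ?u = "\<lambda>l m. \<integral>\<omega>. (if X l \<omega> = m then 1 else 0) * R l \<omega> \<partial>M"
  let ?u' = "\<lambda>m. \<integral>\<omega>. (if Y \<omega> = m then 1 else 0) * Q \<omega> \<partial>N"
  show ?case
  proof (rule tendstoI)
    fix e :: real assume e: "0 < e"
    define s where "s = min 1 (e / 4)"
    have s: "0 < s" "s \<le> 1" "s \<le> e / 4" using e by (auto simp: s_def)
    let ?c = "\<lambda>l. ((\<integral>\<omega>. s ^ X l \<omega> * R l \<omega> \<partial>M) - (\<Sum>j<m. s ^ j * ?u l j)) / s ^ m"
    let ?c' = "((\<integral>\<omega>. s ^ Y \<omega> * Q \<omega> \<partial>N) - (\<Sum>j<m. s ^ j * ?u' j)) / s ^ m"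
    have "?c \<longlonglongrightarrow> ?c'"
      using s less by (intro tendsto_intros pgf) auto
    then have "eventually (\<lambda>l. dist (?c l) ?c' < e / 4) sequentially"
      using e by (intro tendstoD) auto
    then show "eventually (\<lambda>l. dist (?u l m) (?u' m) < e) sequentially"
    proof eventually_elim
      case (elim l)
      have "\<bar>?c l - ?u l m\<bar> \<le> s" by (rule M.pgf_coefficient_error) (use X s in auto)
      moreover have "\<bar>?c' - ?u' m\<bar> \<le> s" by (rule N.pgf_coefficient_error) (use Y s in auto)
      ultimately show ?case using elim s e unfolding dist_real_def by linarith
    qed
  qed
qed

lemma coordinate_product_measurable:
  fixes V :: "'i \<Rightarrow> 'e \<Rightarrow> nat" and s :: "'i \<Rightarrow> real"
  assumes V: "\<And>k. k \<in> K \<Longrightarrow> V k \<in> measurable L (count_space UNIV)" and "A \<subseteq> K" "B \<subseteq> K"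
  shows "(\<lambda>\<omega>. (\<Prod>k\<in>A. if V k \<omega> = m k then 1 else 0) * (\<Prod>k\<in>B. s k ^ V k \<omega>)) \<in> borel_measurable L"
proof -
  have f: "(\<lambda>\<omega>. f (V k \<omega>)) \<in> borel_measurable L" if "k \<in> K" for k and f :: "nat \<Rightarrow> real"
    by (rule measurable_compose[OF V[OF that]]) simp
  show ?thesis
    using assms(2,3) f[where f = "\<lambda>x. if x = m k then 1 else 0" for k] f[where f = "\<lambda>x. s k ^ x" for k]
    by (intro borel_measurable_times borel_measurable_prod) auto
qed

lemma integral_prod_indicators:
  fixes V :: "'i \<Rightarrow> 'e \<Rightarrow> nat"
  assumes "finite K"
  shows "(\<integral>\<omega>. (\<Prod>k\<in>K. if V k \<omega> = m k then 1 else 0 :: real) \<partial>L) = measure L {\<omega>\<in>space L. \<forall>k\<in>K. V k \<omega> = m k}"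
proof -
  have "(\<Prod>k\<in>K. if V k \<omega> = m k then 1 else 0 :: real) = (if \<forall>k\<in>K. V k \<omega> = m k then 1 else 0)" for \<omega>
    using assms by (auto simp: prod_zero_iff)
  then have "(\<integral>\<omega>. (\<Prod>k\<in>K. if V k \<omega> = m k then 1 else 0 :: real) \<partial>L)
     = (\<integral>\<omega>. indicator {\<omega>\<in>space L. \<forall>k\<in>K. V k \<omega> = m k} \<omega> \<partial>L)"
    by (intro Bochner_Integration.integral_cong) (auto simp: indicator_def)
  moreover have "{\<omega>\<in>space L. \<forall>k\<in>K. V k \<omega> = m k} \<inter> space L = {\<omega>\<in>space L. \<forall>k\<in>K. V k \<omega> = m k}" by auto
  ultimately show ?thesis by simp
qed

text \<open>The joint version extracts one coordinate at a time: for \<open>J \<subseteq> K\<close>, the factors in \<open>J\<close> are already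
  indicators and those in \<open>K - J\<close> still powers.\<close>

lemma joint_pgf_tendsto_imp_joint_pmf:
  fixes X :: "nat \<Rightarrow> 'i \<Rightarrow> 'a \<Rightarrow> nat" and Y :: "'i \<Rightarrow> 'b \<Rightarrow> nat"
  assumes M: "prob_space M" and N: "prob_space N" and K: "finite K"
    and X: "\<And>l k. k \<in> K \<Longrightarrow> X l k \<in> measurable M (count_space UNIV)"
    and Y: "\<And>k. k \<in> K \<Longrightarrow> Y k \<in> measurable N (count_space UNIV)"
    and pgf: "\<And>s :: 'i \<Rightarrow> real. (\<And>k. 0 < s k \<and> s k \<le> 1) \<Longrightarrow>
      (\<lambda>l. \<integral>\<omega>. (\<Prod>k\<in>K. s k ^ X l k \<omega>) \<partial>M) \<longlonglongrightarrow> (\<integral>\<omega>. (\<Prod>k\<in>K. s k ^ Y k \<omega>) \<partial>N)"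
  shows "(\<lambda>l. measure M {\<omega>\<in>space M. \<forall>k\<in>K. X l k \<omega> = m k}) \<longlonglongrightarrow> measure N {\<omega>\<in>space N. \<forall>k\<in>K. Y k \<omega> = m k}"
proof -
  have "(\<lambda>l. \<integral>\<omega>. (\<Prod>k\<in>J. if X l k \<omega> = m k then 1 else 0) * (\<Prod>k\<in>K-J. s k ^ X l k \<omega>) \<partial>M)
      \<longlonglongrightarrow> (\<integral>\<omega>. (\<Prod>k\<in>J. if Y k \<omega> = m k then 1 else 0) * (\<Prod>k\<in>K-J. s k ^ Y k \<omega>) \<partial>N)"
    if J: "finite J" "J \<subseteq> K" and s: "\<And>k. 0 < s k \<and> s k \<le> 1" for J and s :: "'i \<Rightarrow> real"
    using J s
  proof (induction J arbitrary: s rule: finite_induct)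
    case empty
    then show ?case using pgf[of s] by simp
  next
    case (insert j J)
    have jK: "j \<in> K" "j \<notin> J" and KJ: "K - J = insert j (K - insert j J)" using insert by auto
    have R_range: "0 \<le> (\<Prod>k\<in>J. if c k = m k then 1 else 0) * (\<Prod>k\<in>K - insert j J. s k ^ c k)
      \<and> (\<Prod>k\<in>J. if c k = m k then 1 else 0) * (\<Prod>k\<in>K - insert j J. s k ^ c k) \<le> 1" for c :: "'i \<Rightarrow> nat"
      using insert.prems(2)
      by (intro conjI mult_nonneg_nonneg mult_le_one prod_nonneg prod_le_1)
        (auto intro: power_le_one less_imp_le)
    have shift: "(\<Prod>k\<in>J. if c k = m k then 1 else 0) * (\<Prod>k\<in>K-J. (s(j := t)) k ^ c k)
        = t ^ c j * ((\<Prod>k\<in>J. if c k = m k then 1 else 0) * (\<Prod>k\<in>K - insert j J. s k ^ c k))" for t :: real and c :: "'i \<Rightarrow> nat"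
    proof -
      have "(\<Prod>k\<in>K-J. (s(j := t)) k ^ c k) = t ^ c j * (\<Prod>k\<in>K - insert j J. (s(j := t)) k ^ c k)"
        unfolding KJ using K by (subst prod.insert) auto
      also have "(\<Prod>k\<in>K - insert j J. (s(j := t)) k ^ c k) = (\<Prod>k\<in>K - insert j J. s k ^ c k)"
        by (intro prod.cong) auto
      finally show ?thesis by simp
    qed
    have "(\<lambda>l. \<integral>\<omega>. (if X l j \<omega> = m j then 1 else 0)
           * ((\<Prod>k\<in>J. if X l k \<omega> = m k then 1 else 0) * (\<Prod>k\<in>K - insert j J. s k ^ X l k \<omega>)) \<partial>M)
      \<longlonglongrightarrow> (\<integral>\<omega>. (if Y j \<omega> = m j then 1 else 0)
           * ((\<Prod>k\<in>J. if Y k \<omega> = m k then 1 else 0) * (\<Prod>k\<in>K - insert j J. s k ^ Y k \<omega>)) \<partial>N)"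
    proof (rule pgf_coefficient_tendsto[OF M N])
      fix t :: real assume t: "0 < t" "t \<le> 1"
      show "(\<lambda>l. \<integral>\<omega>. t ^ X l j \<omega> * ((\<Prod>k\<in>J. if X l k \<omega> = m k then 1 else 0) * (\<Prod>k\<in>K - insert j J. s k ^ X l k \<omega>)) \<partial>M)
        \<longlonglongrightarrow> (\<integral>\<omega>. t ^ Y j \<omega> * ((\<Prod>k\<in>J. if Y k \<omega> = m k then 1 else 0) * (\<Prod>k\<in>K - insert j J. s k ^ Y k \<omega>)) \<partial>N)"
      proof -
        have "J \<subseteq> K" "\<And>k. 0 < (s(j := t)) k \<and> (s(j := t)) k \<le> 1" using insert.prems t by auto
        from insert.IH[where s = "s(j := t)", OF this] show ?thesis unfolding shift .
      qed
    qed (use X Y jK R_range insert.prems(1) in \<open>auto intro!: coordinate_product_measurable[where K = K]\<close>)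
    then show ?case using insert(1,2) by (simp add: mult.assoc)
  qed
  from this[OF K order_refl, of "\<lambda>_. 1"]
  have lim: "(\<lambda>l. \<integral>\<omega>. (\<Prod>k\<in>K. if X l k \<omega> = m k then 1 else 0) \<partial>M)
      \<longlonglongrightarrow> (\<integral>\<omega>. (\<Prod>k\<in>K. if Y k \<omega> = m k then 1 else 0 :: real) \<partial>N)" by simp
  show ?thesis using lim by (simp only: integral_prod_indicators[OF K])
qed

section \<open>Generating functions of the limit and of the tree\<close>

text \<open>The points \<open>x\<close> for which \<open>\<lfloor>x + \<epsilon>\<rfloor>\<close> lies in level \<open>k\<close>, for \<open>k \<le> d\<close>.\<close>

definition level_set :: "real \<Rightarrow> int \<Rightarrow> nat \<Rightarrow> nat \<Rightarrow> real set" where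
  "level_set \<epsilon> i d k =
     (if k < d then {of_int (i + int k) - \<epsilon>..<of_int (i + int k) + 1 - \<epsilon>} else {of_int (i + int k) - \<epsilon>..})"

text \<open>The number of points in \<open>A\<close>, which is \<open>0\<close> by convention if it is infinite.\<close>

definition point_count :: "('b \<Rightarrow> real set) \<Rightarrow> real set \<Rightarrow> 'b \<Rightarrow> nat" where
  "point_count P A \<omega> = nat \<lfloor>enn2real (emeasure (count_space UNIV) (P \<omega> \<inter> A))\<rfloor>"

lemma emeasure_limit_intensity_atLeast:
  assumes "0 < q" "1 < \<theta>"
  shows "emeasure (limit_intensity q \<theta>) {a..} = ennreal (q * \<theta> powr (- a))"
proof -
  let ?F = "\<lambda>x. - (q * \<theta> powr (- x))"
  have "emeasure (limit_intensity q \<theta>) {a..} = (\<integral>\<^sup>+x. ennreal (q * \<theta> powr (- x) * ln \<theta>) * indicator {a..} x \<partial>lborel)"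
    unfolding limit_intensity_def by (subst emeasure_density) auto
  also have "\<dots> = ennreal (0 - ?F a)"
  proof (rule nn_integral_FTC_atLeast)
    show "DERIV ?F x :> q * \<theta> powr (- x) * ln \<theta>" for x
      using assms by (auto intro!: derivative_eq_intros)
    show "(?F \<longlongrightarrow> 0) at_top" using assms by real_asymp
  qed (use assms in auto)
  finally show ?thesis by simp
qed

lemma measure_limit_intensity_level_set:
  assumes "0 < q" "1 < \<theta>" "k \<le> d"
  shows "emeasure (limit_intensity q \<theta>) (level_set \<epsilon> i d k) < \<infinity>"
    "measure (limit_intensity q \<theta>) (level_set \<epsilon> i d k) = level_mean q \<theta> \<epsilon> i d k"
proof -
  let ?\<Lambda> = "limit_intensity q \<theta>"
  let ?a = "of_int (i + int k) - \<epsilon>"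
  have fin: "emeasure ?\<Lambda> {x..} < \<infinity>" for x
    using emeasure_limit_intensity_atLeast[OF assms(1,2), of x] by simp
  have m: "measure ?\<Lambda> {x..} = q * \<theta> powr (- x)" for x
    using emeasure_limit_intensity_atLeast[OF assms(1,2), of x] assms by (simp add: measure_def)
  have s [simp]: "sets ?\<Lambda> = sets borel" by (simp add: limit_intensity_def)
  have "level_set \<epsilon> i d k \<subseteq> {?a..}" by (auto simp: level_set_def)
  then have "emeasure ?\<Lambda> (level_set \<epsilon> i d k) \<le> emeasure ?\<Lambda> {?a..}" by (intro emeasure_mono) auto
  then show "emeasure ?\<Lambda> (level_set \<epsilon> i d k) < \<infinity>" using fin[of ?a] by (rule le_less_trans)
  show "measure ?\<Lambda> (level_set \<epsilon> i d k) = level_mean q \<theta> \<epsilon> i d k"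
  proof (cases "k < d")
    case True
    then have "level_set \<epsilon> i d k = {?a..} - {?a + 1..}" by (auto simp: level_set_def)
    then have "measure ?\<Lambda> (level_set \<epsilon> i d k) = measure ?\<Lambda> {?a..} - measure ?\<Lambda> {?a + 1..}"
      using fin[of ?a] by (simp add: measure_Diff less_top[symmetric])
    then show ?thesis using True by (simp add: m level_mean_def algebra_simps)
  next
    case False
    then show ?thesis using assms by (simp add: level_set_def m level_mean_def algebra_simps)
  qed
qed

lemma power_floor_measurable: "(\<lambda>y. s ^ nat \<lfloor>enn2real y\<rfloor> :: real) \<in> borel_measurable borel"
proof -
  have "(\<lambda>y. \<lfloor>enn2real y\<rfloor>) \<in> measurable borel (count_space UNIV)"
    by (intro measurable_compose[OF _ measurable_real_floor]) simp
  from measurable_compose[OF this, of "\<lambda>z. s ^ nat z" borel] show ?thesis by simp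
qed

lemma poisson_pgf:
  fixes Y :: "'b \<Rightarrow> ennreal"
  assumes N: "prob_space N" and Y: "Y \<in> borel_measurable N"
    and pmf: "\<And>m::nat. measure N {\<omega>\<in>space N. Y \<omega> = of_nat m} = lam ^ m / fact m * exp (- lam)"
    and s: "0 \<le> s" "s \<le> (1::real)" and lam: "0 \<le> lam"
  shows "AE \<omega> in N. Y \<omega> < \<infinity>"
    "(\<integral>\<omega>. s ^ nat \<lfloor>enn2real (Y \<omega>)\<rfloor> \<partial>N) = exp (- ((1 - s) * lam))"
proof -
  interpret N: prob_space N by fact
  let ?E = "\<lambda>m::nat. {\<omega>\<in>space N. Y \<omega> = of_nat m}"
  have E: "?E m \<in> sets N" for m
    using measurable_sets[OF Y, of "{of_nat m}"] by (simp add: vimage_def Int_def conj_commute)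
  have ser: "(\<lambda>m. c * (x ^ m / fact m)) sums (c * exp x)" for c x :: real
    using sums_mult[OF exp_converges[of x], of c] by (simp add: divide_inverse mult_ac)
  have disj: "disjoint_family ?E" by (auto simp: disjoint_family_on_def)
  have "(\<lambda>m. measure N (?E m)) sums measure N (\<Union>m. ?E m)"
    by (intro N.finite_measure_UNION disj) (use E in blast)
  moreover have "(\<lambda>m. measure N (?E m)) sums (exp (- lam) * exp lam)"
    using ser[of "exp (- lam)" lam] by (simp add: pmf mult.commute)
  ultimately have one: "measure N (\<Union>m. ?E m) = 1"
    using sums_unique2 by (fastforce simp flip: exp_add)
  have EU: "(\<Union>m. ?E m) \<in> sets N" using E by blast
  have AE: "AE \<omega> in N. \<omega> \<in> (\<Union>m. ?E m)"
    using N.AE_prob_1[OF one] .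
  then show "AE \<omega> in N. Y \<omega> < \<infinity>"
    by eventually_elim (auto simp: of_nat_less_top)
  define f where "f m \<omega> = s ^ m * (indicator (?E m) \<omega> :: real)" for m \<omega>
  have f_int: "integrable N (f m)" for m
    unfolding f_def using E by (intro integrable_mult_right integrable_real_indicator) (auto simp: N.emeasure_eq_measure)
  have f_val: "(\<integral>\<omega>. f m \<omega> \<partial>N) = exp (- lam) * ((s * lam) ^ m / fact m)" for m
  proof -
    have "?E m \<inter> space N = ?E m" by auto
    then show ?thesis by (simp add: f_def pmf power_mult_distrib mult_ac)
  qed
  have f_single: "(\<lambda>m. f m \<omega>) sums s ^ m0" if "\<omega> \<in> ?E m0" for \<omega> m0
  proof -
    have "(\<lambda>m. f m \<omega>) = (\<lambda>m. if m = m0 then s ^ m else 0)"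
      using that by (auto simp: f_def fun_eq_iff indicator_def)
    then show ?thesis using sums_single[of m0 "\<lambda>m. s ^ m"] by simp
  qed
  have f_nonneg: "0 \<le> f m \<omega>" for m \<omega> using s by (simp add: f_def)
  have "(\<integral>\<omega>. (\<Sum>m. f m \<omega>) \<partial>N) = (\<Sum>m. \<integral>\<omega>. f m \<omega> \<partial>N)"
  proof (rule integral_suminf[OF f_int])
    show "AE \<omega> in N. summable (\<lambda>m. norm (f m \<omega>))"
      using AE
    proof eventually_elim
      case (elim \<omega>)
      then obtain m0 where "\<omega> \<in> ?E m0" by blast
      from sums_summable[OF f_single[OF this]] show ?case using f_nonneg by simp
    qed
    show "summable (\<lambda>m. \<integral>\<omega>. norm (f m \<omega>) \<partial>N)"
      using f_nonneg sums_summable[OF ser[of "exp (- lam)" "s * lam"]] by (simp add: f_val)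
  qed
  also have "\<dots> = exp (- lam) * exp (s * lam)"
    unfolding f_val by (rule sums_unique[OF ser, symmetric])
  also have "\<dots> = exp (- ((1 - s) * lam))"
    by (simp add: algebra_simps flip: exp_add)
  also have "(\<integral>\<omega>. (\<Sum>m. f m \<omega>) \<partial>N) = (\<integral>\<omega>. s ^ nat \<lfloor>enn2real (Y \<omega>)\<rfloor> \<partial>N)"
  proof (rule integral_cong_AE)
    show "(\<lambda>\<omega>. \<Sum>m. f m \<omega>) \<in> borel_measurable N"
      using f_int by (intro borel_measurable_suminf) auto
    show "(\<lambda>\<omega>. s ^ nat \<lfloor>enn2real (Y \<omega>)\<rfloor>) \<in> borel_measurable N"
      by (rule measurable_compose[OF Y power_floor_measurable])
    show "AE \<omega> in N. (\<Sum>m. f m \<omega>) = s ^ nat \<lfloor>enn2real (Y \<omega>)\<rfloor>"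
      using AE
    proof eventually_elim
      case (elim \<omega>)
      then obtain m0 where m0: "\<omega> \<in> ?E m0" by blast
      from sums_unique[OF f_single[OF this]] m0 show ?case by simp
    qed
  qed
  finally show "(\<integral>\<omega>. s ^ nat \<lfloor>enn2real (Y \<omega>)\<rfloor> \<partial>N) = exp (- ((1 - s) * lam))" .
qed

lemma level_set_borel: "level_set \<epsilon> i d k \<in> sets borel"
  by (simp add: level_set_def)

lemma level_set_disjoint: "disjoint_family_on (level_set \<epsilon> i d) {..<Suc d}"
  unfolding disjoint_family_on_def
proof (intro ballI impI)
  fix k k' assume k: "k \<in> {..<Suc d}" "k' \<in> {..<Suc d}" "k \<noteq> k'"
  have *: "level_set \<epsilon> i d k \<inter> level_set \<epsilon> i d k' = {}" if "k < k'" "k' \<le> d" for k k'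
  proof -
    have "of_int (i + int k) + 1 \<le> (of_int (i + int k') :: real)" using that by simp
    then show ?thesis using that by (auto simp: level_set_def)
  qed
  show "level_set \<epsilon> i d k \<inter> level_set \<epsilon> i d k' = {}"
    using k *[of k k'] *[of k' k] by (cases "k < k'") auto
qed

context
  fixes N :: "'b measure" and q \<theta> :: real and P :: "'b \<Rightarrow> real set"
  assumes ppp: "poisson_point_process N (limit_intensity q \<theta>) P"
begin

lemma ppp_measurable: "A \<in> sets borel \<Longrightarrow> (\<lambda>\<omega>. emeasure (count_space UNIV) (P \<omega> \<inter> A)) \<in> borel_measurable N"
  using ppp by (simp add: poisson_point_process_def limit_intensity_def)

lemma ppp_prob_space: "prob_space N"
  using ppp by (simp add: poisson_point_process_def)

lemma point_count_measurable: "A \<in> sets borel \<Longrightarrow> point_count P A \<in> measurable N (count_space UNIV)"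
proof -
  assume A: "A \<in> sets borel"
  have "(\<lambda>\<omega>. \<lfloor>enn2real (emeasure (count_space UNIV) (P \<omega> \<inter> A))\<rfloor>) \<in> measurable N (count_space UNIV)"
    using measurable_compose[OF borel_measurable_enn2real[OF ppp_measurable[OF A]] measurable_real_floor] .
  from measurable_compose[OF this, of nat "count_space UNIV"] show ?thesis
    unfolding point_count_def by simp
qed

lemma ppp_level_set_law:
  assumes q: "0 < q" and \<theta>: "1 < \<theta>" and "k \<le> d"
  shows "measure N {\<omega>\<in>space N. emeasure (count_space UNIV) (P \<omega> \<inter> level_set \<epsilon> i d k) = of_nat m}
      = level_mean q \<theta> \<epsilon> i d k ^ m / fact m * exp (- level_mean q \<theta> \<epsilon> i d k)"
    and "0 \<le> level_mean q \<theta> \<epsilon> i d k"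
proof -
  have "level_set \<epsilon> i d k \<in> sets (limit_intensity q \<theta>)" by (simp add: limit_intensity_def level_set_borel)
  then show "measure N {\<omega>\<in>space N. emeasure (count_space UNIV) (P \<omega> \<inter> level_set \<epsilon> i d k) = of_nat m}
      = level_mean q \<theta> \<epsilon> i d k ^ m / fact m * exp (- level_mean q \<theta> \<epsilon> i d k)"
    using ppp measure_limit_intensity_level_set[OF assms, of \<epsilon> i]
    by (simp add: poisson_point_process_def)
  show "0 \<le> level_mean q \<theta> \<epsilon> i d k"
    using measure_limit_intensity_level_set(2)[OF assms, of \<epsilon> i, symmetric] by simp
qed

lemma point_count_finite:
  assumes "0 < q" "1 < \<theta>"
  shows "AE \<omega> in N. emeasure (count_space UNIV) (P \<omega> \<inter> {of_int i - \<epsilon>..}) < \<infinity>"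
proof -
  have "level_set \<epsilon> i 0 0 = {of_int i - \<epsilon>..}" by (simp add: level_set_def)
  then show ?thesis
    using poisson_pgf(1)[OF ppp_prob_space ppp_measurable[OF level_set_borel]
        ppp_level_set_law(1)[OF assms order_refl], of 1 \<epsilon> i 0] ppp_level_set_law(2)[OF assms order_refl, of \<epsilon> i]
    by simp
qed

lemma limit_pgf:
  fixes s :: "nat \<Rightarrow> real"
  assumes q: "0 < q" and \<theta>: "1 < \<theta>" and s: "\<And>k. 0 \<le> s k \<and> s k \<le> 1"
  shows "(\<integral>\<omega>. (\<Prod>k\<le>d. s k ^ point_count P (level_set \<epsilon> i d k) \<omega>) \<partial>N)
     = exp (- (\<Sum>k\<le>d. (1 - s k) * level_mean q \<theta> \<epsilon> i d k))"
proof -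
  interpret N: prob_space N by (rule ppp_prob_space)
  let ?Y = "\<lambda>i d k \<omega>. emeasure (count_space UNIV) (P \<omega> \<inter> level_set \<epsilon> i d k)"
  have Ym: "?Y i d k \<in> borel_measurable N" for i d k by (rule ppp_measurable[OF level_set_borel])
  define g where "g k y = s k ^ nat \<lfloor>enn2real y\<rfloor>" for k y
  have gm: "g k \<in> borel_measurable borel" for k unfolding g_def by (rule power_floor_measurable)
  have g01: "0 \<le> g k y \<and> g k y \<le> 1" for k y using s[of k] by (simp add: g_def power_le_one)
  have pe: "(\<integral>\<omega>. g k (?Y i d k \<omega>) \<partial>N) = exp (- ((1 - s k) * level_mean q \<theta> \<epsilon> i d k))" if "k \<le> d" for k
    unfolding g_def using poisson_pgf(2)[OF ppp_prob_space Ym ppp_level_set_law(1)[OF q \<theta> that]] s[of k]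
      ppp_level_set_law(2)[OF q \<theta> that] by simp
  have "\<forall>(A :: nat \<Rightarrow> real set) m. disjoint_family_on A {..<m} \<and> (\<forall>k<m. A k \<in> sets (limit_intensity q \<theta>)) \<longrightarrow>
        N.indep_vars (\<lambda>_. borel) (\<lambda>k \<omega>. emeasure (count_space UNIV) (P \<omega> \<inter> A k)) {..<m}"
    using ppp unfolding poisson_point_process_def by blast
  then have "N.indep_vars (\<lambda>_. borel) (?Y i d) {..<Suc d}"
    using level_set_disjoint[of \<epsilon> i d] level_set_borel by (simp add: limit_intensity_def)
  then have ind: "N.indep_vars (\<lambda>_. borel) (\<lambda>k \<omega>. g k (?Y i d k \<omega>)) {..<Suc d}"
    by (rule N.indep_vars_compose2) (rule gm)
  have int: "integrable N (\<lambda>\<omega>. g k (?Y i d k \<omega>))" for k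
    using g01 by (intro N.integrable_const_bound[where B = 1] AE_I2 measurable_compose[OF Ym gm]) simp
  have "(\<integral>\<omega>. (\<Prod>k\<in>{..<Suc d}. g k (?Y i d k \<omega>)) \<partial>N) = (\<Prod>k\<in>{..<Suc d}. \<integral>\<omega>. g k (?Y i d k \<omega>) \<partial>N)"
    by (rule N.indep_vars_lebesgue_integral) (use ind int in auto)
  also have "\<dots> = (\<Prod>k\<in>{..<Suc d}. exp (- ((1 - s k) * level_mean q \<theta> \<epsilon> i d k)))"
    by (intro prod.cong) (auto simp: pe)
  also have "\<dots> = exp (- (\<Sum>k\<le>d. (1 - s k) * level_mean q \<theta> \<epsilon> i d k))"
    by (simp only: lessThan_Suc_atMost sum_negf[symmetric] exp_sum[OF finite_atMost])
  finally show "(\<integral>\<omega>. (\<Prod>k\<le>d. s k ^ point_count P (level_set \<epsilon> i d k) \<omega>) \<partial>N)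
     = exp (- (\<Sum>k\<le>d. (1 - s k) * level_mean q \<theta> \<epsilon> i d k))"
    by (simp add: point_count_def g_def lessThan_Suc_atMost)
qed

end

text \<open>The number of vertices in level \<open>k\<close>, for \<open>k \<le> d\<close>.\<close>

definition level_count :: "real \<Rightarrow> (nat \<Rightarrow> 'a \<Rightarrow> nat) \<Rightarrow> nat \<Rightarrow> int \<Rightarrow> nat \<Rightarrow> nat \<Rightarrow> 'a \<Rightarrow> nat" where
  "level_count \<theta> par n i d k \<omega> =
     (if k < d then degree_count \<theta> par n (i + int k) \<omega> else degree_count_ge \<theta> par n (i + int d) \<omega>)"

lemma prod_level_count:
  fixes s :: "nat \<Rightarrow> real"
  shows "(\<Prod>k\<le>d. s k ^ level_count \<theta> par n i d k \<omega>)
     = (\<Prod>v\<in>{1..n}. level_value s i d (int (tree_in_degree par n v \<omega>) - \<lfloor>log \<theta> (real n)\<rfloor>))"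
proof -
  define g where "g v = int (tree_in_degree par n v \<omega>) - \<lfloor>log \<theta> (real n)\<rfloor>" for v
  let ?V = "{v\<in>{1..n}. i \<le> g v}"
  let ?lev = "\<lambda>v. min (nat (g v - i)) d"
  have c: "level_count \<theta> par n i d k \<omega> = card {v\<in>?V. ?lev v = k}" if "k \<le> d" for k
  proof (cases "k < d")
    case True
    then have "{v\<in>?V. ?lev v = k} = {j\<in>{1..n}. int (tree_in_degree par n j \<omega>) = \<lfloor>log \<theta> (real n)\<rfloor> + (i + int k)}"
      by (auto simp: g_def)
    then show ?thesis using True by (simp add: level_count_def degree_count_def)
  next
    case False
    then have "k = d" using that by simp
    then have "{v\<in>?V. ?lev v = k} = {j\<in>{1..n}. int (tree_in_degree par n j \<omega>) \<ge> \<lfloor>log \<theta> (real n)\<rfloor> + (i + int d)}"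
      by (auto simp: g_def)
    then show ?thesis using False by (simp add: level_count_def degree_count_ge_def)
  qed
  have "(\<Prod>v\<in>{1..n}. level_value s i d (g v)) = (\<Prod>v\<in>?V. s (?lev v))"
    by (rule prod.mono_neutral_cong_right) (auto simp: level_value_def)
  also have "\<dots> = (\<Prod>k\<in>{..d}. \<Prod>v\<in>{v\<in>?V. ?lev v = k}. s (?lev v))"
    by (rule prod.group[symmetric]) auto
  also have "\<dots> = (\<Prod>k\<le>d. s k ^ level_count \<theta> par n i d k \<omega>)"
    by (intro prod.cong) (auto simp: c)
  finally show ?thesis by (simp add: g_def)
qed

text \<open>The quenched limit does not depend on the weights and the generating functions are bounded by \<open>1\<close>, so
  dominated convergence removes the conditioning on the weights.\<close>

lemma (in weighted_recursive_tree) annealed_pgf: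
  fixes n :: "nat \<Rightarrow> nat"
  assumes range: "AE x in D. x \<in> {0<..1}"
    and q: "measure D {1} = q" "0 < q" and theta: "\<theta> = 1 + (\<integral>x. x \<partial>D)" "1 < \<theta>"
    and n: "filterlim n at_top sequentially"
    and eps: "(\<lambda>l. log \<theta> (real (n l)) - of_int \<lfloor>log \<theta> (real (n l))\<rfloor>) \<longlonglongrightarrow> \<epsilon>"
    and s: "\<And>k. 0 \<le> s k \<and> s k \<le> (1 :: real)"
  shows "(\<lambda>l. \<integral>\<omega>. (\<Prod>k\<le>d. s k ^ level_count \<theta> par (n l) i d k \<omega>) \<partial>M)
     \<longlonglongrightarrow> exp (- (\<Sum>k\<le>d. (1 - s k) * level_mean q \<theta> \<epsilon> i d k))"
proof -
  let ?F = "\<lambda>l z. \<Prod>v\<in>{1..n l}. level_value s i d (int (z v) - \<lfloor>log \<theta> (real (n l))\<rfloor>)"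
  let ?Q = "\<lambda>l \<omega>. quenched_expectation (\<lambda>v. W v \<omega>) (n l) (?F l) (\<lambda>_. 0)"
  let ?lim = "exp (- (\<Sum>k\<le>d. (1 - s k) * level_mean q \<theta> \<epsilon> i d k))"
  have F01: "0 \<le> ?F l z \<and> ?F l z \<le> 1" for l z
    using s by (intro conjI prod_nonneg prod_le_1) (auto simp: level_value_def)
  have "(\<lambda>l. \<integral>\<omega>. ?Q l \<omega> \<partial>M) \<longlonglongrightarrow> (\<integral>\<omega>. ?lim \<partial>M)"
  proof (rule integral_dominated_convergence[where w = "\<lambda>_. 1"])
    show "?Q l \<in> borel_measurable M" for l
      by (rule quenched_measurable) (auto intro: weight_measurable)
    have "AE \<omega> in M. typical_weights (\<lambda>v. W v \<omega>) (\<theta> - 1) q"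
      using range q theta by (intro AE_typical_weights) auto
    then show "AE \<omega> in M. (\<lambda>l. ?Q l \<omega>) \<longlonglongrightarrow> ?lim"
    proof eventually_elim
      case (elim \<omega>)
      then interpret typical_weights "\<lambda>v. W v \<omega>" "\<theta> - 1" q .
      show ?case using quenched_levels[OF n, of \<epsilon> s i d] eps s by simp
    qed
    show "AE \<omega> in M. norm (?Q l \<omega>) \<le> 1" for l
      using AE_positive_weights
    proof eventually_elim
      case (elim \<omega>)
      then interpret positive_weights "\<lambda>v. W v \<omega>" .
      have "?Q l \<omega> \<le> 1"
        using quenched_mono[of "?F l" "\<lambda>_. 1" "n l" "\<lambda>_. 0"] F01[of _ l] by (simp add: quenched_const)
      moreover have "0 \<le> ?Q l \<omega>"
        using quenched_mono[of "\<lambda>_. 0" "?F l" "n l" "\<lambda>_. 0"] F01[of _ l] by (simp add: quenched_const)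
      ultimately show ?case by simp
    qed
  qed auto
  moreover have "(\<integral>\<omega>. ?Q l \<omega> \<partial>M) = (\<integral>\<omega>. (\<Prod>k\<le>d. s k ^ level_count \<theta> par (n l) i d k \<omega>) \<partial>M)" for l
    unfolding prod_level_count
  proof -
    have "\<bar>?F l z\<bar> \<le> 1" for z using F01[of z l] by (simp only: abs_of_nonneg)
    from annealed_expectation[of "?F l" 1 "n l", OF this]
    show "(\<integral>\<omega>. ?Q l \<omega> \<partial>M)
      = (\<integral>\<omega>. (\<Prod>v\<in>{1..n l}. level_value s i d (int (tree_in_degree par (n l) v \<omega>) - \<lfloor>log \<theta> (real (n l))\<rfloor>)) \<partial>M)" by simp
  qed
  ultimately show ?thesis by (simp add: prob_space)
qed

section \<open>Convergence in distribution through discrete codes\<close>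

text \<open>In both parts of the theorem the random elements take values in a set \<open>S\<close> whose elements are
  described by a refining sequence of countable codes, and every neighbourhood of a point of \<open>S\<close>
  contains all points of \<open>S\<close> that share some code with it. Events and integrals can then be
  treated as for discrete random variables.\<close>

context
  fixes T :: "'s topology" and S :: "'s set" and code :: "nat \<Rightarrow> 's \<Rightarrow> 'k :: countable"
  assumes S: "S \<subseteq> topspace T"
    and refine: "\<And>a b s s'. a \<le> b \<Longrightarrow> s \<in> S \<Longrightarrow> s' \<in> S \<Longrightarrow> code b s = code b s' \<Longrightarrow> code a s = code a s'"
    and nbhd: "\<And>s U. s \<in> S \<Longrightarrow> openin T U \<Longrightarrow> s \<in> U \<Longrightarrow> \<exists>a. \<forall>s'\<in>S. code a s' = code a s \<longrightarrow> s' \<in> U"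
begin

lemma cylinder_open_event:
  assumes Z: "\<And>\<omega>. \<omega> \<in> space L \<Longrightarrow> Z \<omega> \<in> S" "\<And>a v. {\<omega>\<in>space L. code a (Z \<omega>) = v} \<in> sets L"
    and U: "openin T U"
  shows "{\<omega>\<in>space L. Z \<omega> \<in> U} \<in> sets L"
proof -
  let ?C = "{(a, v). \<forall>s\<in>S. code a s = v \<longrightarrow> s \<in> U}"
  have "{\<omega>\<in>space L. Z \<omega> \<in> U} = (\<Union>(a, v)\<in>?C. {\<omega>\<in>space L. code a (Z \<omega>) = v})"
  proof (intro equalityI subsetI)
    fix \<omega> assume "\<omega> \<in> {\<omega>\<in>space L. Z \<omega> \<in> U}"
    then have \<omega>: "\<omega> \<in> space L" "Z \<omega> \<in> U" by auto
    obtain a where "\<forall>s\<in>S. code a s = code a (Z \<omega>) \<longrightarrow> s \<in> U"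
      using nbhd[OF Z(1)[OF \<omega>(1)] U \<omega>(2)] by blast
    then have "(a, code a (Z \<omega>)) \<in> ?C" by simp
    then show "\<omega> \<in> (\<Union>(a, v)\<in>?C. {\<omega>\<in>space L. code a (Z \<omega>) = v})" using \<omega>(1) by blast
  qed (use Z(1) in auto)
  also have "\<dots> \<in> sets L"
    using Z(2) by (intro sets.countable_UN') auto
  finally show ?thesis .
qed

lemma cylinder_measurable:
  assumes Z: "\<And>\<omega>. \<omega> \<in> space L \<Longrightarrow> Z \<omega> \<in> S" "\<And>a v. {\<omega>\<in>space L. code a (Z \<omega>) = v} \<in> sets L"
  shows "Z \<in> measurable L (borel_of_topology T)"
  unfolding borel_of_topology_def
proof (rule measurable_measure_of)
  show "{U. openin T U} \<subseteq> Pow (topspace T)" using openin_subset by auto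
  show "Z \<in> space L \<rightarrow> topspace T" using Z(1) S by auto
  fix U assume "U \<in> {U. openin T U}"
  moreover have "Z -` U \<inter> space L = {\<omega>\<in>space L. Z \<omega> \<in> U}" by auto
  ultimately show "Z -` U \<inter> space L \<in> sets L" using cylinder_open_event[OF Z] by simp
qed

lemma cylinder_continuous_measurable:
  fixes f :: "'s \<Rightarrow> real"
  assumes Z: "\<And>\<omega>. \<omega> \<in> space L \<Longrightarrow> Z \<omega> \<in> S" "\<And>a v. {\<omega>\<in>space L. code a (Z \<omega>) = v} \<in> sets L"
    and f: "continuous_map T euclideanreal f"
  shows "(\<lambda>\<omega>. f (Z \<omega>)) \<in> borel_measurable L"
proof (rule borel_measurableI)
  fix U :: "real set" assume "open U"
  then have "openin T {x \<in> topspace T. f x \<in> U}"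
    using f by (auto simp: continuous_map_def)
  from cylinder_open_event[OF Z this]
  have "{\<omega>\<in>space L. Z \<omega> \<in> {x \<in> topspace T. f x \<in> U}} \<in> sets L" .
  also have "{\<omega>\<in>space L. Z \<omega> \<in> {x \<in> topspace T. f x \<in> U}} = (\<lambda>\<omega>. f (Z \<omega>)) -` U \<inter> space L"
    using Z(1) S by auto
  finally show "(\<lambda>\<omega>. f (Z \<omega>)) -` U \<inter> space L \<in> sets L" .
qed

lemma cylinder_approximation:
  fixes f :: "'s \<Rightarrow> real" and F :: "'k \<Rightarrow> real"
  assumes "prob_space L"
    and Z: "\<And>\<omega>. \<omega> \<in> space L \<Longrightarrow> Z \<omega> \<in> S" "\<And>a v. {\<omega>\<in>space L. code a (Z \<omega>) = v} \<in> sets L"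
    and f: "continuous_map T euclideanreal f" and B: "\<And>s. s \<in> S \<Longrightarrow> \<bar>f s\<bar> \<le> B"
    and V: "finite V" "\<And>s. s \<in> S \<Longrightarrow> code a s \<in> V \<Longrightarrow> \<bar>f s - F (code a s)\<bar> \<le> e" and "0 \<le> e"
  shows "\<bar>(\<integral>\<omega>. f (Z \<omega>) \<partial>L) - (\<Sum>v\<in>V. F v * measure L {\<omega>\<in>space L. code a (Z \<omega>) = v})\<bar>
     \<le> e + B * (1 - (\<Sum>v\<in>V. measure L {\<omega>\<in>space L. code a (Z \<omega>) = v}))"
proof -
  interpret L: prob_space L by fact
  let ?E = "\<lambda>v. {\<omega>\<in>space L. code a (Z \<omega>) = v}"
  have E [simp]: "?E v \<inter> space L = ?E v" for v by auto
  have I: "integrable L (indicator (?E v) :: _ \<Rightarrow> real)" for v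
    using Z(2) by (intro integrable_real_indicator) (auto simp: L.emeasure_eq_measure)
  have fint: "integrable L (\<lambda>\<omega>. f (Z \<omega>))"
    using B Z(1) by (intro L.integrable_const_bound[where B = B] cylinder_continuous_measurable Z f AE_I2) auto
  have m: "(\<integral>\<omega>. indicator (?E v) \<omega> \<partial>L) = measure L (?E v)" for v
    using Z(2)[of a v] by simp
  have sF: "(\<integral>\<omega>. (\<Sum>v\<in>V. F v * indicator (?E v) \<omega>) \<partial>L) = (\<Sum>v\<in>V. F v * measure L (?E v))"
    using I by (subst Bochner_Integration.integral_sum) (auto simp: m)
  have s1: "(\<integral>\<omega>. e + B * (1 - (\<Sum>v\<in>V. indicator (?E v) \<omega>)) \<partial>L) = e + B * (1 - (\<Sum>v\<in>V. measure L (?E v)))"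
  proof -
    have "(\<integral>\<omega>. (\<Sum>v\<in>V. indicator (?E v) \<omega>) \<partial>L) = (\<Sum>v\<in>V. measure L (?E v))"
      using I by (subst Bochner_Integration.integral_sum) (auto simp: m)
    then show ?thesis using I by (simp add: L.prob_space)
  qed
  have "\<bar>(\<integral>\<omega>. f (Z \<omega>) \<partial>L) - (\<Sum>v\<in>V. F v * measure L (?E v))\<bar>
      = \<bar>\<integral>\<omega>. f (Z \<omega>) - (\<Sum>v\<in>V. F v * indicator (?E v) \<omega>) \<partial>L\<bar>"
    unfolding sF[symmetric] using I fint by (subst Bochner_Integration.integral_diff) auto
  also have "\<dots> \<le> (\<integral>\<omega>. \<bar>f (Z \<omega>) - (\<Sum>v\<in>V. F v * indicator (?E v) \<omega>)\<bar> \<partial>L)"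
    by (rule integral_abs_bound)
  also have "\<dots> \<le> (\<integral>\<omega>. e + B * (1 - (\<Sum>v\<in>V. indicator (?E v) \<omega>)) \<partial>L)"
  proof (rule integral_mono)
    fix \<omega> assume \<omega>: "\<omega> \<in> space L"
    let ?c = "code a (Z \<omega>)"
    have 1: "(\<Sum>v\<in>V. G v * indicator (?E v) \<omega>) = (if ?c \<in> V then G ?c else 0)" for G :: "'k \<Rightarrow> real"
    proof -
      have "(\<Sum>v\<in>V. G v * indicator (?E v) \<omega>) = (\<Sum>v\<in>V. if ?c = v then G v else 0)"
        using \<omega> by (intro sum.cong) (auto simp: indicator_def)
      then show ?thesis using V(1) by simp
    qed
    from 1[of F] 1[of "\<lambda>_. 1"] show "\<bar>f (Z \<omega>) - (\<Sum>v\<in>V. F v * indicator (?E v) \<omega>)\<bar> \<le> e + B * (1 - (\<Sum>v\<in>V. indicator (?E v) \<omega>))"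
      using V(2)[OF Z(1)[OF \<omega>]] B[OF Z(1)[OF \<omega>]] \<open>0 \<le> e\<close> by (cases "?c \<in> V") auto
  qed (use I fint in \<open>auto intro!: Bochner_Integration.integrable_sum\<close>)
  finally show ?thesis unfolding s1 .
qed

text \<open>For random elements that are determined by countably many codes, convergence of the
  probabilities of all code values implies convergence in distribution.\<close>

lemma converges_in_distribution_by_codes:
  fixes X :: "nat \<Rightarrow> 'a \<Rightarrow> 's" and Y :: "'b \<Rightarrow> 's"
  assumes M: "prob_space M" and N: "prob_space N"
    and X: "\<And>l \<omega>. \<omega> \<in> space M \<Longrightarrow> X l \<omega> \<in> S" "\<And>l a v. {\<omega>\<in>space M. code a (X l \<omega>) = v} \<in> sets M"
    and Y: "\<And>\<omega>. \<omega> \<in> space N \<Longrightarrow> Y \<omega> \<in> S" "\<And>a v. {\<omega>\<in>space N. code a (Y \<omega>) = v} \<in> sets N"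
    and lim: "\<And>a v. (\<lambda>l. measure M {\<omega>\<in>space M. code a (X l \<omega>) = v}) \<longlonglongrightarrow> measure N {\<omega>\<in>space N. code a (Y \<omega>) = v}"
  shows "converges_in_distribution T M X N Y"
  unfolding converges_in_distribution_def
proof (intro conjI allI impI)
  show "X l \<in> measurable M (borel_of_topology T)" for l using X by (rule cylinder_measurable)
  show "Y \<in> measurable N (borel_of_topology T)" using Y by (rule cylinder_measurable)
  fix f assume f: "continuous_map T euclideanreal f \<and> bounded (f ` topspace T)"
  then obtain B where B: "\<And>s. s \<in> topspace T \<Longrightarrow> \<bar>f s\<bar> \<le> B" "0 < B"
    unfolding bounded_pos by auto
  have BS: "\<bar>f s\<bar> \<le> B" if "s \<in> S" for s using B that S by auto
  interpret N: prob_space N by (rule N)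
  interpret M: prob_space M by (rule M)
  show "(\<lambda>l. \<integral>\<omega>. f (X l \<omega>) \<partial>M) \<longlonglongrightarrow> (\<integral>\<omega>. f (Y \<omega>) \<partial>N)"
  proof (rule tendstoI)
    fix \<epsilon> :: real assume \<epsilon>: "0 < \<epsilon>"
    define e where "e = \<epsilon> / (4 + 2 * B)"
    have e: "0 < e" "e * (3 + 2 * B) < \<epsilon>" using \<epsilon> B(2) by (auto simp: e_def field_simps)
    \<comment> \<open>A code value is good if \<open>f\<close> varies by at most \<open>e\<close> on its cylinder; up to probability \<open>e\<close>, one \<open>a\<close>
      and finitely many good values of \<open>code a\<close> suffice.\<close>
    define good where "good a v \<longleftrightarrow> (\<forall>s\<in>S. \<forall>s'\<in>S. code a s = v \<longrightarrow> code a s' = v \<longrightarrow> \<bar>f s - f s'\<bar> \<le> e)" for a v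
    have event: "{\<omega>\<in>space N. Q (code a (Y \<omega>))} \<in> sets N" for Q a
    proof -
      have "{\<omega>\<in>space N. Q (code a (Y \<omega>))} = (\<Union>v\<in>{v. Q v}. {\<omega>\<in>space N. code a (Y \<omega>) = v})" by auto
      also have "\<dots> \<in> sets N" using Y(2) by (intro sets.countable_UN') auto
      finally show ?thesis .
    qed
    let ?A = "\<lambda>a. {\<omega>\<in>space N. good a (code a (Y \<omega>))}"
    have "(\<lambda>a. measure N (?A a)) \<longlonglongrightarrow> measure N (\<Union>a. ?A a)"
    proof (rule N.finite_Lim_measure_incseq)
      show "range ?A \<subseteq> sets N" using event[of "good _"] by blast
      show "incseq ?A"
      proof (rule incseq_SucI, safe)
        fix a \<omega> assume \<omega>: "\<omega> \<in> space N" "good a (code a (Y \<omega>))"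
        show "good (Suc a) (code (Suc a) (Y \<omega>))"
          unfolding good_def
        proof (intro ballI impI)
          fix s s' assume s: "s \<in> S" "s' \<in> S" "code (Suc a) s = code (Suc a) (Y \<omega>)" "code (Suc a) s' = code (Suc a) (Y \<omega>)"
          have "code a s = code a (Y \<omega>)" "code a s' = code a (Y \<omega>)"
            using refine[of a "Suc a" s "Y \<omega>"] refine[of a "Suc a" s' "Y \<omega>"] s Y(1)[OF \<omega>(1)] by auto
          then show "\<bar>f s - f s'\<bar> \<le> e" using \<omega>(2) s unfolding good_def by blast
        qed
      qed
    qed
    moreover have "(\<Union>a. ?A a) = space N"
    proof (intro equalityI subsetI)
      fix \<omega> assume \<omega>: "\<omega> \<in> space N"
      let ?U = "{x \<in> topspace T. f x \<in> {f (Y \<omega>) - e/2 <..< f (Y \<omega>) + e/2}}"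
      have "openin T {x \<in> topspace T. f x \<in> U}" if "open U" for U
        using f that by (auto simp: continuous_map_def)
      from this[OF open_greaterThanLessThan] have "openin T ?U" .
      moreover have "Y \<omega> \<in> ?U" using Y(1)[OF \<omega>] S e by auto
      ultimately obtain a where a: "\<forall>s'\<in>S. code a s' = code a (Y \<omega>) \<longrightarrow> s' \<in> ?U"
        using nbhd[OF Y(1)[OF \<omega>]] by blast
      have "good a (code a (Y \<omega>))"
        unfolding good_def
      proof (intro ballI impI)
        fix s s' assume "s \<in> S" "s' \<in> S" "code a s = code a (Y \<omega>)" "code a s' = code a (Y \<omega>)"
        then have "s \<in> ?U" "s' \<in> ?U" using a by blast+
        then show "\<bar>f s - f s'\<bar> \<le> e" by (auto simp: abs_le_iff)
      qed
      then show "\<omega> \<in> (\<Union>a. ?A a)" using \<omega> by blast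
    qed auto
    ultimately have "(\<lambda>a. measure N (?A a)) \<longlonglongrightarrow> 1" by (simp add: N.prob_space)
    then have "eventually (\<lambda>a. 1 - e < measure N (?A a)) sequentially"
      using e by (intro order_tendstoD) auto
    then obtain a where a: "1 - e < measure N (?A a)"
      by (auto simp: eventually_at_top_linorder)
    let ?B = "\<lambda>J. {\<omega>\<in>space N. good a (code a (Y \<omega>)) \<and> to_nat (code a (Y \<omega>)) < J}"
    have "(\<lambda>J. measure N (?B J)) \<longlonglongrightarrow> measure N (\<Union>J. ?B J)"
    proof (rule N.finite_Lim_measure_incseq)
      show "range ?B \<subseteq> sets N" using event[of "\<lambda>v. good a v \<and> to_nat v < _" a] by blast
      show "incseq ?B" by (rule incseq_SucI) auto
    qed
    moreover have "(\<Union>J. ?B J) = ?A a" by auto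
    ultimately have "eventually (\<lambda>J. 1 - e < measure N (?B J)) sequentially"
      using a by (intro order_tendstoD) auto
    then obtain J where J: "1 - e < measure N (?B J)"
      by (auto simp: eventually_at_top_linorder)
    define V where "V = {v. good a v \<and> to_nat v < J}"
    have V: "finite V"
    proof (rule finite_imageD[OF finite_subset])
      show "to_nat ` V \<subseteq> {..<J}" by (auto simp: V_def)
    qed (auto intro: inj_on_subset[OF inj_to_nat])
    define F where "F v = f (SOME s. s \<in> S \<and> code a s = v)" for v
    have F: "\<bar>f s - F (code a s)\<bar> \<le> e" if "s \<in> S" "code a s \<in> V" for s
    proof -
      have "\<exists>s'. s' \<in> S \<and> code a s' = code a s" using that by blast
      from someI_ex[OF this] show ?thesis
        using that unfolding F_def V_def good_def by blast
    qed
    let ?p = "\<lambda>l v. measure M {\<omega>\<in>space M. code a (X l \<omega>) = v}"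
    let ?q = "\<lambda>v. measure N {\<omega>\<in>space N. code a (Y \<omega>) = v}"
    have q: "1 - e < (\<Sum>v\<in>V. ?q v)"
    proof -
      have "?B J = (\<Union>v\<in>V. {\<omega>\<in>space N. code a (Y \<omega>) = v})" by (auto simp: V_def)
      moreover have "measure N (\<Union>v\<in>V. {\<omega>\<in>space N. code a (Y \<omega>) = v}) = (\<Sum>v\<in>V. ?q v)"
      proof (rule N.finite_measure_finite_Union[OF V])
        show "(\<lambda>v. {\<omega>\<in>space N. code a (Y \<omega>) = v}) ` V \<subseteq> sets N" using Y(2) by blast
        show "disjoint_family_on (\<lambda>v. {\<omega>\<in>space N. code a (Y \<omega>) = v}) V"
          unfolding disjoint_family_on_def by blast
      qed
      ultimately have "measure N (?B J) = (\<Sum>v\<in>V. ?q v)" by simp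
      then show ?thesis using J by simp
    qed
    have "eventually (\<lambda>l. 1 - e < (\<Sum>v\<in>V. ?p l v)) sequentially"
      by (rule order_tendstoD(1)[OF _ q]) (intro tendsto_sum lim)
    moreover have "eventually (\<lambda>l. dist (\<Sum>v\<in>V. F v * ?p l v) (\<Sum>v\<in>V. F v * ?q v) < e) sequentially"
      using e by (intro tendstoD tendsto_sum tendsto_mult_left lim) auto
    ultimately show "eventually (\<lambda>l. dist (\<integral>\<omega>. f (X l \<omega>) \<partial>M) (\<integral>\<omega>. f (Y \<omega>) \<partial>N) < \<epsilon>) sequentially"
    proof eventually_elim
      case (elim l)
      have 1: "\<bar>(\<integral>\<omega>. f (X l \<omega>) \<partial>M) - (\<Sum>v\<in>V. F v * ?p l v)\<bar> \<le> e + B * (1 - (\<Sum>v\<in>V. ?p l v))"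
        using f by (intro cylinder_approximation M X BS V F less_imp_le[OF e(1)]) auto
      have 2: "\<bar>(\<integral>\<omega>. f (Y \<omega>) \<partial>N) - (\<Sum>v\<in>V. F v * ?q v)\<bar> \<le> e + B * (1 - (\<Sum>v\<in>V. ?q v))"
        using f by (intro cylinder_approximation N Y BS V F less_imp_le[OF e(1)]) auto
      have "B * (1 - (\<Sum>v\<in>V. ?p l v)) \<le> B * e" "B * (1 - (\<Sum>v\<in>V. ?q v)) \<le> B * e"
        using elim(1) q B(2) by (intro mult_left_mono; linarith)+
      with 1 2 elim(2) have "dist (\<integral>\<omega>. f (X l \<omega>) \<partial>M) (\<integral>\<omega>. f (Y \<omega>) \<partial>N) < 3 * e + 2 * (B * e)"
        unfolding dist_real_def by linarith
      also have "\<dots> < \<epsilon>" using e(2) by (simp add: algebra_simps)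
      finally show ?case .
    qed
  qed
qed

end

section \<open>Configurations on the extended integers\<close>

lemma powi_2_gt: "\<exists>a::nat. (e::real) < 2 powi (int a)"
proof -
  obtain a where "e < 2 ^ a" using real_arch_pow[of 2 e] by auto
  then show ?thesis by (intro exI[of _ a]) simp
qed

instance zstar :: countable
proof
  have "inj (\<lambda>x. case x of Fin i \<Rightarrow> Suc (to_nat i) | Infty \<Rightarrow> 0)"
    by (auto simp: inj_def split: zstar.splits)
  then show "\<exists>f :: zstar \<Rightarrow> nat. inj f" by blast
qed

lemma zstar_borel [simp]: "A \<in> sets (borel :: zstar measure)"
proof (rule sets.countable)
  show "{a} \<in> sets borel" for a :: zstar by simp
  show "countable A" by simp
qed

lemma zstar_bounded_iff: "bounded B \<longleftrightarrow> (\<exists>a::nat. B \<subseteq> insert Infty (Fin ` {- int a..}))"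
proof
  assume "bounded B"
  then obtain e where e: "\<And>x. x \<in> B \<Longrightarrow> dist Infty x \<le> e"
    using bounded_any_center[of B Infty] by blast
  obtain a :: nat where a: "e < 2 powi (int a)" using powi_2_gt by blast
  have "- int a \<le> k" if "Fin k \<in> B" for k
  proof (rule ccontr)
    assume "\<not> - int a \<le> k"
    then have "2 powi (int a) \<le> (2 powi (- k) :: real)" by (intro power_int_increasing) auto
    then show False using e[OF that] a by simp
  qed
  then have "B \<subseteq> insert Infty (Fin ` {- int a..})"
  proof (intro subsetI)
    fix x assume "x \<in> B"
    then show "x \<in> insert Infty (Fin ` {- int a..})"
      using \<open>\<And>k. Fin k \<in> B \<Longrightarrow> - int a \<le> k\<close> by (cases x) auto
  qed
  then show "\<exists>a::nat. B \<subseteq> insert Infty (Fin ` {- int a..})" ..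
next
  assume "\<exists>a::nat. B \<subseteq> insert Infty (Fin ` {- int a..})"
  then obtain a :: nat where a: "B \<subseteq> insert Infty (Fin ` {- int a..})" ..
  have "dist Infty x \<le> 2 powi (int a)" if "x \<in> insert Infty (Fin ` {- int a..})" for x
  proof (cases x)
    case (Fin k)
    then have "- k \<le> int a" using that by auto
    then have "2 powi (- k) \<le> (2 powi (int a) :: real)" by (intro power_int_increasing) auto
    then show ?thesis using Fin by simp
  qed simp
  then show "bounded B" using a unfolding bounded_def by blast
qed

lemma boundedly_finite_zstar_iff:
  fixes \<mu> :: "zstar measure"
  shows "\<mu> \<in> boundedly_finite_measures \<longleftrightarrow>
    sets \<mu> = sets borel \<and> (\<forall>a::nat. emeasure \<mu> (insert Infty (Fin ` {- int a..})) < \<infinity>)"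
proof
  assume \<mu>: "\<mu> \<in> boundedly_finite_measures"
  have "bounded (insert Infty (Fin ` {- int a..}))" for a :: nat
    unfolding zstar_bounded_iff by blast
  with \<mu> show "sets \<mu> = sets borel \<and> (\<forall>a::nat. emeasure \<mu> (insert Infty (Fin ` {- int a..})) < \<infinity>)"
    by (simp add: boundedly_finite_measures_def)
next
  assume r: "sets \<mu> = sets borel \<and> (\<forall>a::nat. emeasure \<mu> (insert Infty (Fin ` {- int a..})) < \<infinity>)"
  have "emeasure \<mu> B < \<infinity>" if B: "bounded B" for B
  proof -
    obtain a :: nat where a: "B \<subseteq> insert Infty (Fin ` {- int a..})"
      using B unfolding zstar_bounded_iff by blast
    have "emeasure \<mu> B \<le> emeasure \<mu> (insert Infty (Fin ` {- int a..}))"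
      using a conjunct1[OF r] by (intro emeasure_mono) simp_all
    from this r[THEN conjunct2, rule_format, of a] show ?thesis by (rule le_less_trans)
  qed
  then show "\<mu> \<in> boundedly_finite_measures"
    using conjunct1[OF r] unfolding boundedly_finite_measures_def by blast
qed

lemma emeasure_point_sum:
  "emeasure (point_sum I g) (B :: zstar set) = emeasure (count_space UNIV) {x\<in>I. g x \<in> B}"
proof -
  have "emeasure (point_sum I g) B = emeasure (count_space I) {x\<in>I. g x \<in> B}"
    unfolding point_sum_def by (subst emeasure_distr) (auto simp: vimage_def Int_def conj_commute)
  also have "\<dots> = emeasure (count_space UNIV) {x\<in>I. g x \<in> B}"
    by (cases "finite {x\<in>I. g x \<in> B}") (auto simp: emeasure_count_space)
  finally show ?thesis .
qed

lemma sets_point_sum [simp]: "sets (point_sum I g) = sets borel"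
  by (simp add: point_sum_def)

text \<open>Configurations are the integer-valued boundedly finite measures without mass at infinity. The
  last clause, that there is no mass beyond some integer, follows from the others by continuity from
  above; it is stated since it is the form that is used.\<close>

definition configurations :: "zstar measure set" where
  "configurations = {\<mu> \<in> boundedly_finite_measures. emeasure \<mu> {Infty} = 0
     \<and> (\<forall>A. emeasure \<mu> A < \<infinity> \<longrightarrow> (\<exists>c::nat. emeasure \<mu> A = of_nat c))
     \<and> (\<exists>a. emeasure \<mu> (Fin ` {a..}) = 0)}"

text \<open>The subset of \<open>\<int>\<^sup>*\<close> that corresponds to level \<open>k\<close>, and the list of masses of the levels.\<close>

definition zlevel :: "int \<Rightarrow> nat \<Rightarrow> nat \<Rightarrow> zstar set" where
  "zlevel i d k = (if k < d then {Fin (i + int k)} else Fin ` {i + int k..})"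

definition level_code :: "int \<Rightarrow> nat \<Rightarrow> zstar measure \<Rightarrow> nat list" where
  "level_code i d \<mu> = map (\<lambda>k. nat \<lfloor>measure \<mu> (zlevel i d k)\<rfloor>) [0..<Suc d]"

lemma point_sum_configuration:
  assumes "point_sum I (\<lambda>x. Fin (h x)) \<in> boundedly_finite_measures" (is "?\<mu> \<in> _")
  shows "point_sum I (\<lambda>x. Fin (h x)) \<in> configurations"
proof -
  have e: "emeasure ?\<mu> A = emeasure (count_space UNIV) {x\<in>I. Fin (h x) \<in> A}" for A
    by (rule emeasure_point_sum)
  have "\<exists>c::nat. emeasure ?\<mu> A = of_nat c" if "emeasure ?\<mu> A < \<infinity>" for A
    using that unfolding e by (cases "finite {x\<in>I. Fin (h x) \<in> A}") (auto simp: emeasure_count_space)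
  moreover have "\<exists>a. emeasure ?\<mu> (Fin ` {a..}) = 0"
  proof -
    let ?J = "{x\<in>I. Fin (h x) \<in> insert Infty (Fin ` {- int 0..})}"
    have "emeasure (count_space UNIV) ?J < \<infinity>"
      using assms unfolding boundedly_finite_zstar_iff e by blast
    then have fin: "finite ?J" by (cases "finite ?J") (auto simp: emeasure_count_space)
    define a where "a = Max (insert 0 (h ` ?J)) + 1"
    have "h x < a" if "x \<in> ?J" for x
    proof -
      have "h x \<le> Max (insert 0 (h ` ?J))" using that fin by (intro Max_ge) auto
      then show ?thesis by (simp add: a_def)
    qed
    moreover have "0 < a"
      using Max_ge[of "insert 0 (h ` ?J)" 0] fin by (simp add: a_def)
    ultimately have "{x\<in>I. Fin (h x) \<in> Fin ` {a..}} = {}" by fastforce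
    then have "emeasure ?\<mu> (Fin ` {a..}) = 0" unfolding e by (simp only: emeasure_empty)
    then show ?thesis ..
  qed
  moreover have "emeasure ?\<mu> {Infty} = 0" unfolding e by simp
  ultimately show ?thesis using assms unfolding configurations_def by blast
qed

lemma null_configuration: "null_measure borel \<in> configurations"
  unfolding configurations_def boundedly_finite_zstar_iff by (auto intro: exI[of _ 0])

lemma configuration_finite:
  assumes "\<mu> \<in> configurations"
  shows "emeasure \<mu> (Fin ` {i..}) < \<infinity>" "emeasure \<mu> {Fin i} < \<infinity>"
proof -
  have b: "emeasure \<mu> B < \<infinity>" if "bounded B" for B
    using assms that by (auto simp: configurations_def boundedly_finite_measures_def)
  have "bounded (Fin ` {i..})"
    unfolding zstar_bounded_iff by (rule exI[of _ "nat (- i)"]) auto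
  then show "emeasure \<mu> (Fin ` {i..}) < \<infinity>" by (rule b)
  show "emeasure \<mu> {Fin i} < \<infinity>" by (rule b) simp
qed

lemma configuration_zlevel:
  assumes "\<mu> \<in> configurations"
  shows "emeasure \<mu> (zlevel i d k) < \<infinity>" "\<exists>c::nat. measure \<mu> (zlevel i d k) = real c"
proof -
  show fin: "emeasure \<mu> (zlevel i d k) < \<infinity>"
    using configuration_finite[OF assms] by (simp add: zlevel_def)
  then obtain c :: nat where "emeasure \<mu> (zlevel i d k) = of_nat c"
    using assms by (auto simp: configurations_def)
  then show "\<exists>c::nat. measure \<mu> (zlevel i d k) = real c" by (auto simp: measure_def)
qed

lemma level_code_eq_iff:
  assumes "\<mu> \<in> configurations" "\<nu> \<in> configurations"
  shows "level_code i d \<mu> = level_code i d \<nu> \<longleftrightarrow> (\<forall>k\<le>d. measure \<mu> (zlevel i d k) = measure \<nu> (zlevel i d k))"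
proof -
  have "nat \<lfloor>measure \<mu> (zlevel i d k)\<rfloor> = nat \<lfloor>measure \<nu> (zlevel i d k)\<rfloor> \<longleftrightarrow> measure \<mu> (zlevel i d k) = measure \<nu> (zlevel i d k)" for k
    using configuration_zlevel(2)[OF assms(1), of i d k] configuration_zlevel(2)[OF assms(2), of i d k] by auto
  then show ?thesis
    unfolding level_code_def map_eq_conv set_upt by (auto simp: less_Suc_eq_le)
qed

text \<open>The levels \<open>- a, \<dots>, a - 1\<close> and \<open>{a..}\<close> give a sequence of codes that refines with \<open>a\<close>.\<close>

lemma level_code_symmetric_iff:
  assumes "\<mu> \<in> configurations" "\<nu> \<in> configurations"
  shows "level_code (- int a) (2 * a) \<mu> = level_code (- int a) (2 * a) \<nu> \<longleftrightarrow>
    (\<forall>k\<in>{- int a..<int a}. measure \<mu> {Fin k} = measure \<nu> {Fin k}) \<and> measure \<mu> (Fin ` {int a..}) = measure \<nu> (Fin ` {int a..})"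
    (is "?L \<longleftrightarrow> ?R")
proof
  assume "?L"
  then have *: "measure \<mu> (zlevel (- int a) (2 * a) k) = measure \<nu> (zlevel (- int a) (2 * a) k)" if "k \<le> 2 * a" for k
    using that level_code_eq_iff[OF assms] by blast
  have "measure \<mu> {Fin k} = measure \<nu> {Fin k}" if "k \<in> {- int a..<int a}" for k
  proof -
    have "nat (k + int a) < 2 * a" using that by auto
    then show ?thesis using *[of "nat (k + int a)"] that by (simp add: zlevel_def)
  qed
  moreover have "measure \<mu> (Fin ` {int a..}) = measure \<nu> (Fin ` {int a..})"
    using *[of "2 * a"] by (simp add: zlevel_def)
  ultimately show ?R by blast
next
  assume R: ?R
  have "measure \<mu> (zlevel (- int a) (2 * a) k) = measure \<nu> (zlevel (- int a) (2 * a) k)" if "k \<le> 2 * a" for k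
  proof (cases "k < 2 * a")
    case True
    then have "- int a + int k \<in> {- int a..<int a}" by auto
    then show ?thesis using R True by (simp add: zlevel_def)
  next
    case False
    then have "k = 2 * a" using that by simp
    then show ?thesis using R by (simp add: zlevel_def)
  qed
  then show ?L using level_code_eq_iff[OF assms] by blast
qed

lemma configuration_tail_step:
  assumes "\<mu> \<in> configurations"
  shows "measure \<mu> (Fin ` {i..}) = measure \<mu> {Fin i} + measure \<mu> (Fin ` {i + 1..})"
proof -
  have s: "sets \<mu> = sets borel" using assms by (simp add: configurations_def boundedly_finite_measures_def)
  have "{i..} = insert i {i + 1..}" by auto
  then have "Fin ` {i..} = {Fin i} \<union> Fin ` {i + 1..}" by auto
  also have "measure \<mu> \<dots> = measure \<mu> {Fin i} + measure \<mu> (Fin ` {i + 1..})"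
    using configuration_finite[OF assms, of i] configuration_finite[OF assms, of "i + 1"] s
    by (intro measure_Union) auto
  finally show ?thesis .
qed

lemma level_code_refine:
  assumes "a \<le> b" "\<mu> \<in> configurations" "\<nu> \<in> configurations"
    and "level_code (- int b) (2 * b) \<mu> = level_code (- int b) (2 * b) \<nu>"
  shows "level_code (- int a) (2 * a) \<mu> = level_code (- int a) (2 * a) \<nu>"
proof -
  note codes = assms(4)[unfolded level_code_symmetric_iff[OF assms(2,3)]]
  have pts: "measure \<mu> {Fin k} = measure \<nu> {Fin k}" if "k \<in> {- int b..<int b}" for k
    using codes that by blast
  have top: "measure \<mu> (Fin ` {int b..}) = measure \<nu> (Fin ` {int b..})"
    using codes by blast
  have "measure \<mu> (Fin ` {int b - int j..}) = measure \<nu> (Fin ` {int b - int j..})" if "j \<le> 2 * b" for j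
    using that
  proof (induction j)
    case 0
    then show ?case using top by simp
  next
    case (Suc j)
    have eq: "int b - int (Suc j) + 1 = int b - int j" by simp
    show ?case
      using Suc pts[of "int b - int (Suc j)"]
      unfolding configuration_tail_step[OF assms(2), of "int b - int (Suc j)"]
        configuration_tail_step[OF assms(3), of "int b - int (Suc j)"] eq by simp
  qed
  from this[of "b - a"] pts show ?thesis
    unfolding level_code_symmetric_iff[OF assms(2,3)] using assms(1) by auto
qed

lemma configuration_integral:
  fixes f :: "zstar \<Rightarrow> real"
  assumes \<mu>: "\<mu> \<in> configurations" and f: "\<And>k. k < - int a \<Longrightarrow> f (Fin k) = 0"
    and top: "measure \<mu> (Fin ` {int a..}) = 0"
  shows "(\<integral>x. f x \<partial>\<mu>) = (\<Sum>k\<in>{- int a..<int a}. f (Fin k) * measure \<mu> {Fin k})"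
proof -
  have s: "sets \<mu> = sets borel" using \<mu> by (simp add: configurations_def boundedly_finite_measures_def)
  have sp: "space \<mu> = UNIV" using sets_eq_imp_space_eq[OF s] by simp
  have fin: "emeasure \<mu> {Fin k} < \<infinity>" for k by (rule configuration_finite[OF \<mu>])
  have "emeasure \<mu> (Fin ` {int a..}) = 0"
    using top configuration_finite(1)[OF \<mu>, of "int a"] by (auto simp: measure_def enn2real_eq_0_iff)
  then have n1: "Fin ` {int a..} \<in> null_sets \<mu>" using s by (simp add: null_sets_def)
  have n2: "{Infty} \<in> null_sets \<mu>" using \<mu> s by (simp add: null_sets_def configurations_def)
  have "AE x in \<mu>. f x = (\<Sum>k\<in>{- int a..<int a}. f (Fin k) * indicator {Fin k} x)"
    using AE_not_in[OF n1] AE_not_in[OF n2]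
  proof eventually_elim
    case (elim x)
    then obtain j where j: "x = Fin j" "j < int a" by (cases x) (auto simp: image_iff)
    have "(\<Sum>k\<in>{- int a..<int a}. f (Fin k) * indicator {Fin k} x) = (\<Sum>k\<in>{- int a..<int a}. if k = j then f (Fin j) else 0)"
      using j by (intro sum.cong) (auto simp: indicator_def)
    also have "\<dots> = f x" using j f[of j] by (auto simp: not_le)
    finally show ?case by simp
  qed
  then have "(\<integral>x. f x \<partial>\<mu>) = (\<integral>x. (\<Sum>k\<in>{- int a..<int a}. f (Fin k) * indicator {Fin k} x) \<partial>\<mu>)"
    using s by (intro integral_cong_AE) (auto simp: measurable_def sp)
  also have "\<dots> = (\<Sum>k\<in>{- int a..<int a}. \<integral>x. f (Fin k) * indicator {Fin k} x \<partial>\<mu>)"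
    using s fin by (intro Bochner_Integration.integral_sum integrable_mult_right integrable_real_indicator) auto
  also have "\<dots> = (\<Sum>k\<in>{- int a..<int a}. f (Fin k) * measure \<mu> {Fin k})"
    by (simp add: sp)
  finally show ?thesis .
qed

lemma topspace_vague: "topspace vague_topology = (boundedly_finite_measures :: 'x::metric_space measure set)"
proof
  show "topspace vague_topology \<subseteq> (boundedly_finite_measures :: 'x measure set)"
    unfolding vague_topology_def by (auto simp: topology_generated_by_topspace)
  have "(boundedly_finite_measures :: 'x measure set) \<in>
     {{\<mu> \<in> boundedly_finite_measures. (\<integral>x. f x \<partial>\<mu>) \<in> U} | (f :: 'x \<Rightarrow> real) U.
        continuous_on UNIV f \<and> bounded (range f) \<and> (\<exists>B. bounded B \<and> (\<forall>x. x \<notin> B \<longrightarrow> f x = 0)) \<and>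
        open U}"
    by (intro CollectI exI[of _ "\<lambda>_. 0"] exI[of _ UNIV]) (auto intro: exI[of _ "{}"])
  then show "(boundedly_finite_measures :: 'x measure set) \<subseteq> topspace vague_topology"
    unfolding vague_topology_def topology_generated_by_topspace by (rule Union_upper)
qed

lemma configurations_subset: "configurations \<subseteq> topspace vague_topology"
  by (auto simp: topspace_vague configurations_def)

text \<open>A neighbourhood of \<open>\<mu>\<close> in the vague topology involves finitely many test functions, which vanish below
  some \<open>- a\<close>. If \<open>\<mu>\<close> has no mass in \<open>{a..}\<close>, a configuration with the same code has the same integrals.\<close>

lemma vague_neighbourhood:
  assumes "openin vague_topology U" "\<mu> \<in> configurations" "\<mu> \<in> U"
  shows "\<exists>a. \<forall>\<nu>\<in>configurations. level_code (- int a) (2 * a) \<nu> = level_code (- int a) (2 * a) \<mu> \<longrightarrow> \<nu> \<in> U"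
  using assms(1,3) unfolding vague_topology_def openin_topology_generated_by_iff
proof (induction U rule: generate_topology_on.induct)
  case (Int U V)
  then obtain a b where ab:
    "\<And>\<nu>. \<nu> \<in> configurations \<Longrightarrow> level_code (- int a) (2 * a) \<nu> = level_code (- int a) (2 * a) \<mu> \<Longrightarrow> \<nu> \<in> U"
    "\<And>\<nu>. \<nu> \<in> configurations \<Longrightarrow> level_code (- int b) (2 * b) \<nu> = level_code (- int b) (2 * b) \<mu> \<Longrightarrow> \<nu> \<in> V"
    by blast
  show ?case
  proof (intro exI[of _ "max a b"] ballI impI IntI)
    fix \<nu> assume \<nu>: "\<nu> \<in> configurations" "level_code (- int (max a b)) (2 * max a b) \<nu> = level_code (- int (max a b)) (2 * max a b) \<mu>"
    show "\<nu> \<in> U" by (rule ab(1)[OF \<nu>(1) level_code_refine[OF _ \<nu>(1) assms(2) \<nu>(2)]]) simp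
    show "\<nu> \<in> V" by (rule ab(2)[OF \<nu>(1) level_code_refine[OF _ \<nu>(1) assms(2) \<nu>(2)]]) simp
  qed
next
  case (UN K)
  then show ?case by blast
next
  case (Basis U)
  then obtain f :: "zstar \<Rightarrow> real" and O' B where U: "U = {\<mu> \<in> boundedly_finite_measures. (\<integral>x. f x \<partial>\<mu>) \<in> O'}"
    "bounded B" "\<And>x. x \<notin> B \<Longrightarrow> f x = 0" by blast
  obtain a1 :: nat where a1: "B \<subseteq> insert Infty (Fin ` {- int a1..})"
    using U(2) unfolding zstar_bounded_iff by blast
  obtain a2 where a2: "emeasure \<mu> (Fin ` {a2..}) = 0"
    using assms(2) by (auto simp: configurations_def)
  define a where "a = max a1 (nat a2)"
  have f0: "f (Fin k) = 0" if "k < - int a" for k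
    using that a1 by (intro U(3)) (auto simp: a_def)
  have "emeasure \<mu> (Fin ` {int a..}) \<le> emeasure \<mu> (Fin ` {a2..})"
    using assms(2) by (intro emeasure_mono) (auto simp: a_def configurations_def boundedly_finite_measures_def)
  then have top: "measure \<mu> (Fin ` {int a..}) = 0" using a2 by (simp add: measure_def)
  show ?case
  proof (intro exI[of _ a] ballI impI)
    fix \<nu> assume \<nu>: "\<nu> \<in> configurations" "level_code (- int a) (2 * a) \<nu> = level_code (- int a) (2 * a) \<mu>"
    from \<nu>(2)[unfolded level_code_symmetric_iff[OF \<nu>(1) assms(2)]] top
    have "measure \<nu> (Fin ` {int a..}) = 0" "\<And>k. k \<in> {- int a..<int a} \<Longrightarrow> measure \<nu> {Fin k} = measure \<mu> {Fin k}" by auto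
    then have "(\<integral>x. f x \<partial>\<nu>) = (\<integral>x. f x \<partial>\<mu>)"
      using configuration_integral[of \<nu> a f, OF \<nu>(1) f0] configuration_integral[of \<mu> a f, OF assms(2) f0 top] by simp
    then show "\<nu> \<in> U" using \<nu>(1) Basis.prems unfolding U(1) by (auto simp: configurations_def)
  qed
qed simp

section \<open>Convergence of the degree process\<close>

lemma level_code_event:
  "{\<omega>\<in>\<Omega>. map (\<lambda>k. c k \<omega>) [0..<Suc d] = v}
     = (if length v = Suc d then {\<omega>\<in>\<Omega>. \<forall>k\<in>{..d}. c k \<omega> = v ! k} else {})"
proof (cases "length v = Suc d")
  case True
  have "map (\<lambda>k. c k \<omega>) [0..<Suc d] = v \<longleftrightarrow> (\<forall>k\<in>{..d}. c k \<omega> = v ! k)" for \<omega>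
    unfolding list_eq_iff_nth_eq using True by (auto simp: less_Suc_eq_le simp del: upt_Suc)
  then show ?thesis using True by simp
qed (auto simp del: upt_Suc)

lemma degree_process_configuration: "degree_process \<theta> par n \<omega> \<in> configurations"
proof -
  have "emeasure (point_sum {1..n} g) B < \<infinity>" for g :: "nat \<Rightarrow> zstar" and B
    unfolding emeasure_point_sum by (subst emeasure_count_space_finite) (auto simp: of_nat_less_top)
  then have "degree_process \<theta> par n \<omega> \<in> boundedly_finite_measures"
    by (simp add: degree_process_def boundedly_finite_measures_def)
  then show ?thesis
    unfolding degree_process_def by (rule point_sum_configuration)
qed

lemma measure_degree_process:
  assumes "k \<le> d"
  shows "measure (degree_process \<theta> par n \<omega>) (zlevel i d k) = real (level_count \<theta> par n i d k \<omega>)"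
proof -
  let ?L = "\<lfloor>log \<theta> (real n)\<rfloor>"
  have "{v\<in>{1..n}. Fin (int (tree_in_degree par n v \<omega>) - ?L) \<in> zlevel i d k}
      = (if k < d then {j\<in>{1..n}. int (tree_in_degree par n j \<omega>) = ?L + (i + int k)}
         else {j\<in>{1..n}. int (tree_in_degree par n j \<omega>) \<ge> ?L + (i + int d)})"
    using assms by (auto simp: zlevel_def image_iff)
  then have "emeasure (degree_process \<theta> par n \<omega>) (zlevel i d k) = of_nat (level_count \<theta> par n i d k \<omega>)"
    unfolding degree_process_def emeasure_point_sum
    by (simp add: level_count_def degree_count_def degree_count_ge_def emeasure_count_space_finite)
  then show ?thesis by (simp add: measure_def)
qed

lemma (in weighted_recursive_tree) level_count_measurable:
  "level_count \<theta> par n i d k \<in> measurable M (count_space UNIV)"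
proof -
  let ?h = "\<lambda>l. if k < d then card {j\<in>{1..n}. int (count_list l j) = \<lfloor>log \<theta> (real n)\<rfloor> + (i + int k)}
      else card {j\<in>{1..n}. int (count_list l j) \<ge> \<lfloor>log \<theta> (real n)\<rfloor> + (i + int d)}"
  have "(\<lambda>\<omega>. ?h (parents par n \<omega>)) \<in> measurable M (count_space UNIV)"
    by (rule measurable_compose[OF parents_measurable]) simp
  moreover have "(\<lambda>\<omega>. ?h (parents par n \<omega>)) = level_count \<theta> par n i d k"
    by (simp add: level_count_def degree_count_def degree_count_ge_def tree_in_degree_conv_parents fun_eq_iff)
  ultimately show ?thesis by simp
qed

text \<open>The event that the limiting process is boundedly finite, so that it is not replaced by the zero
  measure.\<close>

definition limit_defined :: "real \<Rightarrow> ('b \<Rightarrow> real set) \<Rightarrow> 'b \<Rightarrow> bool" where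
  "limit_defined \<epsilon> P \<omega> \<longleftrightarrow> (\<forall>a::nat. emeasure (count_space UNIV) (P \<omega> \<inter> {of_int (- int a) - \<epsilon>..}) < \<infinity>)"

lemma limit_defined_iff:
  "limit_defined \<epsilon> P \<omega> \<longleftrightarrow> point_sum (P \<omega>) (\<lambda>x. Fin \<lfloor>x + \<epsilon>\<rfloor>) \<in> boundedly_finite_measures"
proof -
  have "{x\<in>P \<omega>. Fin \<lfloor>x + \<epsilon>\<rfloor> \<in> insert Infty (Fin ` {- int a..})} = P \<omega> \<inter> {of_int (- int a) - \<epsilon>..}" for a :: nat
    by (auto simp: image_iff le_floor_iff)
  then show ?thesis
    unfolding boundedly_finite_zstar_iff emeasure_point_sum limit_defined_def by simp
qed

lemma limit_process_configuration: "limit_process \<epsilon> P \<omega> \<in> configurations"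
  unfolding limit_process_def Let_def
  by (auto intro: point_sum_configuration null_configuration)

lemma measure_limit_process:
  assumes "k \<le> d"
  shows "measure (limit_process \<epsilon> P \<omega>) (zlevel i d k)
     = (if limit_defined \<epsilon> P \<omega> then enn2real (emeasure (count_space UNIV) (P \<omega> \<inter> level_set \<epsilon> i d k)) else 0)"
proof -
  have "{x\<in>P \<omega>. Fin \<lfloor>x + \<epsilon>\<rfloor> \<in> zlevel i d k} = P \<omega> \<inter> level_set \<epsilon> i d k"
  proof (cases "k < d")
    case True
    then show ?thesis by (auto simp: zlevel_def level_set_def floor_eq_iff)
  next
    case False
    have "Fin m \<in> Fin ` {c..} \<longleftrightarrow> c \<le> m" for m c by auto
    then show ?thesis using False by (auto simp: zlevel_def level_set_def le_floor_iff)
  qed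
  then show ?thesis
    unfolding limit_process_def Let_def limit_defined_iff measure_def
    by (simp add: emeasure_point_sum)
qed

lemma limit_defined_event:
  assumes ppp: "poisson_point_process N (limit_intensity q \<theta>) P"
  shows "{\<omega>\<in>space N. limit_defined \<epsilon> P \<omega>} \<in> sets N"
proof -
  have "{\<omega>\<in>space N. emeasure (count_space UNIV) (P \<omega> \<inter> {of_int (- int a) - \<epsilon>..}) < \<infinity>} \<in> sets N" for a :: nat
    by (intro borel_measurable_less ppp_measurable[OF ppp]) auto
  then have "(\<Inter>a. {\<omega>\<in>space N. emeasure (count_space UNIV) (P \<omega> \<inter> {of_int (- int a) - \<epsilon>..}) < \<infinity>}) \<in> sets N"
    by blast
  also have "(\<Inter>a. {\<omega>\<in>space N. emeasure (count_space UNIV) (P \<omega> \<inter> {of_int (- int a) - \<epsilon>..}) < \<infinity>})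
      = {\<omega>\<in>space N. limit_defined \<epsilon> P \<omega>}"
    by (auto simp: limit_defined_def)
  finally show ?thesis .
qed

text \<open>The number of points of the limiting process in level \<open>k\<close>.\<close>

definition limit_count :: "real \<Rightarrow> ('b \<Rightarrow> real set) \<Rightarrow> int \<Rightarrow> nat \<Rightarrow> nat \<Rightarrow> 'b \<Rightarrow> nat" where
  "limit_count \<epsilon> P i d k \<omega> = nat \<lfloor>measure (limit_process \<epsilon> P \<omega>) (zlevel i d k)\<rfloor>"

lemma limit_count_altdef:
  "k \<le> d \<Longrightarrow> limit_count \<epsilon> P i d k \<omega> = (if limit_defined \<epsilon> P \<omega> then point_count P (level_set \<epsilon> i d k) \<omega> else 0)"
  by (simp add: limit_count_def measure_limit_process point_count_def)

lemma limit_count_measurable: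
  assumes "poisson_point_process N (limit_intensity q \<theta>) P" "k \<le> d"
  shows "limit_count \<epsilon> P i d k \<in> measurable N (count_space UNIV)"
proof -
  have "(\<lambda>\<omega>. if limit_defined \<epsilon> P \<omega> then point_count P (level_set \<epsilon> i d k) \<omega> else 0) \<in> measurable N (count_space UNIV)"
    by (intro measurable_If point_count_measurable[OF assms(1)] level_set_borel limit_defined_event[OF assms(1)]) simp
  moreover have "limit_count \<epsilon> P i d k = (\<lambda>\<omega>. if limit_defined \<epsilon> P \<omega> then point_count P (level_set \<epsilon> i d k) \<omega> else 0)"
    using assms(2) by (simp add: limit_count_altdef fun_eq_iff)
  ultimately show ?thesis by simp
qed

lemma level_code_degree_process:
  "level_code i d (degree_process \<theta> par n \<omega>) = map (\<lambda>k. level_count \<theta> par n i d k \<omega>) [0..<Suc d]"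
  unfolding level_code_def by (intro map_cong refl) (auto simp: measure_degree_process)

lemma level_code_limit_process:
  "level_code i d (limit_process \<epsilon> P \<omega>) = map (\<lambda>k. limit_count \<epsilon> P i d k \<omega>) [0..<Suc d]"
  by (simp add: level_code_def limit_count_def)

lemma mean_weight_pos:
  assumes "real_distribution D" "AE x in D. x \<in> {0<..1}" "measure D {1} = q" "0 < q"
  shows "0 < (\<integral>x. x \<partial>D)"
proof -
  interpret real_distribution D by fact
  have "(\<integral>x. indicator {1} x \<partial>D) \<le> (\<integral>x. x \<partial>D)"
  proof (rule integral_mono_AE)
    show "integrable D (indicator {1} :: real \<Rightarrow> real)"
      by (intro integrable_real_indicator) (auto simp: emeasure_eq_measure)
    show "integrable D (\<lambda>x. x)"
    proof (rule integrable_const_bound[where B = 1])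
      show "AE x in D. norm x \<le> 1" using assms(2) by eventually_elim auto
    qed simp
    show "AE x in D. indicator {1} x \<le> x" using assms(2) by eventually_elim (auto simp: indicator_def)
  qed
  then show ?thesis using assms by simp
qed

theorem theorem2p5:
  fixes M :: "'a measure" and N :: "'b measure"
    and D :: "real measure"
    and W :: "nat \<Rightarrow> 'a \<Rightarrow> real" and par :: "nat \<Rightarrow> 'a \<Rightarrow> nat"
    and P :: "'b \<Rightarrow> real set"
    and q\<^sub>0 \<theta> \<epsilon> :: real
    and n :: "nat \<Rightarrow> nat"
  assumes tree: "weighted_recursive_tree M D W par"
    and range_W: "AE x in D. x \<in> {0<..1}"
    and sup_W: "Sup {x. cdf D x < 1} = 1"
    and small_W: "\<exists>C>0. \<exists>\<rho>>0. \<exists>x\<^sub>1\<in>{0<..<1}. \<forall>x\<in>{0..x\<^sub>1}. cdf D x \<le> C * x powr \<rho>"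
    and atom_W: "measure D {1} = q\<^sub>0" "0 < q\<^sub>0" "q\<^sub>0 \<le> 1"
    and theta: "\<theta> = 1 + (\<integral>x. x \<partial>D)"
    and ppp: "poisson_point_process N (limit_intensity q\<^sub>0 \<theta>) P"
    and eps: "\<epsilon> \<in> {0..1}"
    and n_pos: "\<And>l. 0 < n l"
    and n_infty: "filterlim n at_top sequentially"
    and n_eps: "(\<lambda>l. log \<theta> (real (n l)) - of_int \<lfloor>log \<theta> (real (n l))\<rfloor>) \<longlonglongrightarrow> \<epsilon>"
  shows "converges_in_distribution vague_topology
           M (\<lambda>l. degree_process \<theta> par (n l)) N (limit_process \<epsilon> P) \<and>
         (\<forall>i i' :: int. i < i' \<longrightarrow>
           converges_in_distribution (product_topology (\<lambda>_. euclideanreal) {i..i'})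
             M (\<lambda>l \<omega>. \<lambda>k\<in>{i..i'}.
                  if k < i' then real (degree_count \<theta> par (n l) k \<omega>)
                  else real (degree_count_ge \<theta> par (n l) i' \<omega>))
             N (\<lambda>\<omega>. \<lambda>k\<in>{i..i'}.
                  if k < i' then measure (limit_process \<epsilon> P \<omega>) {Fin k}
                  else measure (limit_process \<epsilon> P \<omega>) (Fin ` {i'..})))"
proof -
  interpret weighted_recursive_tree M D W par by (rule tree)
  interpret N: prob_space N using ppp by (simp add: poisson_point_process_def)
  have \<theta>: "1 < \<theta>" using mean_weight_pos[OF weight_law range_W atom_W(1,2)] theta by simp
  note limit_facts = ppp atom_W(2) \<theta>
  have defined: "AE \<omega> in N. limit_defined \<epsilon> P \<omega>"
    unfolding limit_defined_def AE_all_countable by (intro allI point_count_finite[OF limit_facts])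
  have pmf: "(\<lambda>l. measure M {\<omega>\<in>space M. \<forall>k\<in>{..d}. level_count \<theta> par (n l) i d k \<omega> = m k})
      \<longlonglongrightarrow> measure N {\<omega>\<in>space N. \<forall>k\<in>{..d}. limit_count \<epsilon> P i d k \<omega> = m k}" for i d m
  proof (rule joint_pgf_tendsto_imp_joint_pmf)
    show "prob_space M" by (rule prob_space_axioms)
    show "prob_space N" by (rule N.prob_space_axioms)
    show "limit_count \<epsilon> P i d k \<in> measurable N (count_space UNIV)" if "k \<in> {..d}" for k
      using that by (intro limit_count_measurable[OF ppp]) simp
    fix s :: "nat \<Rightarrow> real" assume "\<And>k. 0 < s k \<and> s k \<le> 1"
    then have s: "\<And>k. 0 \<le> s k \<and> s k \<le> 1" by (simp add: less_imp_le)
    have "(\<integral>\<omega>. (\<Prod>k\<le>d. s k ^ limit_count \<epsilon> P i d k \<omega>) \<partial>N)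
        = (\<integral>\<omega>. (\<Prod>k\<le>d. s k ^ point_count P (level_set \<epsilon> i d k) \<omega>) \<partial>N)"
    proof (rule integral_cong_AE)
      show "(\<lambda>\<omega>. \<Prod>k\<le>d. s k ^ limit_count \<epsilon> P i d k \<omega>) \<in> borel_measurable N"
        by (intro borel_measurable_prod measurable_compose[OF limit_count_measurable[OF ppp]]) auto
      show "(\<lambda>\<omega>. \<Prod>k\<le>d. s k ^ point_count P (level_set \<epsilon> i d k) \<omega>) \<in> borel_measurable N"
        by (intro borel_measurable_prod measurable_compose[OF point_count_measurable[OF ppp level_set_borel]]) auto
      show "AE \<omega> in N. (\<Prod>k\<le>d. s k ^ limit_count \<epsilon> P i d k \<omega>) = (\<Prod>k\<le>d. s k ^ point_count P (level_set \<epsilon> i d k) \<omega>)"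
        using defined by eventually_elim (auto simp: limit_count_altdef intro!: prod.cong)
    qed
    also have "\<dots> = exp (- (\<Sum>k\<le>d. (1 - s k) * level_mean q\<^sub>0 \<theta> \<epsilon> i d k))"
      by (rule limit_pgf[OF limit_facts s])
    finally show "(\<lambda>l. \<integral>\<omega>. (\<Prod>k\<in>{..d}. s k ^ level_count \<theta> par (n l) i d k \<omega>) \<partial>M)
        \<longlonglongrightarrow> (\<integral>\<omega>. (\<Prod>k\<in>{..d}. s k ^ limit_count \<epsilon> P i d k \<omega>) \<partial>N)"
      using annealed_pgf[OF range_W atom_W(1,2) theta \<theta> n_infty n_eps s] by simp
  qed (auto intro: level_count_measurable)
  have events_X: "{\<omega>\<in>space M. level_code i d (degree_process \<theta> par (n l) \<omega>) = v} \<in> sets M" for i d l v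
  proof -
    have "{\<omega>\<in>space M. \<forall>k\<in>{..d}. level_count \<theta> par (n l) i d k \<omega> = v ! k}
        = (\<Inter>k\<in>{..d}. level_count \<theta> par (n l) i d k -` {v ! k} \<inter> space M)" by auto
    also have "\<dots> \<in> sets M"
      by (intro sets.finite_INT measurable_sets[OF level_count_measurable]) auto
    finally show ?thesis unfolding level_code_degree_process level_code_event by simp
  qed
  have events_Y: "{\<omega>\<in>space N. level_code i d (limit_process \<epsilon> P \<omega>) = v} \<in> sets N" for i d v
  proof -
    have "{\<omega>\<in>space N. \<forall>k\<in>{..d}. limit_count \<epsilon> P i d k \<omega> = v ! k}
        = (\<Inter>k\<in>{..d}. limit_count \<epsilon> P i d k -` {v ! k} \<inter> space N)" by auto
    also have "\<dots> \<in> sets N"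
      by (intro sets.finite_INT measurable_sets[OF limit_count_measurable[OF ppp]]) auto
    finally show ?thesis unfolding level_code_limit_process level_code_event by simp
  qed
  have lim: "(\<lambda>l. measure M {\<omega>\<in>space M. level_code i d (degree_process \<theta> par (n l) \<omega>) = v})
      \<longlonglongrightarrow> measure N {\<omega>\<in>space N. level_code i d (limit_process \<epsilon> P \<omega>) = v}" for i d v
    unfolding level_code_degree_process level_code_limit_process level_code_event
    using pmf[of d i "\<lambda>k. v ! k"] by (cases "length v = Suc d") simp_all
  show ?thesis
  proof (intro conjI allI impI)
    show "converges_in_distribution vague_topology M (\<lambda>l. degree_process \<theta> par (n l)) N (limit_process \<epsilon> P)"
    proof (rule converges_in_distribution_by_codes[where S = configurations
          and code = "\<lambda>a. level_code (- int a) (2 * a)"])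
      show "configurations \<subseteq> topspace vague_topology" by (rule configurations_subset)
      show "level_code (- int a) (2 * a) s = level_code (- int a) (2 * a) s'"
        if "a \<le> b" "s \<in> configurations" "s' \<in> configurations"
          "level_code (- int b) (2 * b) s = level_code (- int b) (2 * b) s'" for a b s s'
        using that by (rule level_code_refine)
      show "\<exists>a. \<forall>s'\<in>configurations. level_code (- int a) (2 * a) s' = level_code (- int a) (2 * a) s \<longrightarrow> s' \<in> U"
        if "s \<in> configurations" "openin vague_topology U" "s \<in> U" for s U
        using vague_neighbourhood[OF that(2,1,3)] .
    qed (rule prob_space_axioms N.prob_space_axioms degree_process_configuration
        limit_process_configuration events_X events_Y lim)+
  next
    fix i i' :: int assume ii: "i < i'"
    define d where "d = nat (i' - i)"
    have i': "i' = i + int d" using ii by (simp add: d_def)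
    let ?T = "product_topology (\<lambda>_. euclideanreal) {i..i'}"
    define S where "S = {x \<in> {i..i'} \<rightarrow>\<^sub>E (UNIV :: real set). \<forall>k\<in>{i..i'}. x k \<in> \<nat>}"
    define code where "code x = map (\<lambda>k. nat \<lfloor>x (i + int k)\<rfloor>) [0..<Suc d]" for x :: "int \<Rightarrow> real"
    let ?X = "\<lambda>l \<omega>. \<lambda>k\<in>{i..i'}. if k < i' then real (degree_count \<theta> par (n l) k \<omega>)
                  else real (degree_count_ge \<theta> par (n l) i' \<omega>)"
    let ?Y = "\<lambda>\<omega>. \<lambda>k\<in>{i..i'}. if k < i' then measure (limit_process \<epsilon> P \<omega>) {Fin k}
                  else measure (limit_process \<epsilon> P \<omega>) (Fin ` {i'..})"
    have X_eq: "?X l \<omega> (i + int k) = measure (degree_process \<theta> par (n l) \<omega>) (zlevel i d k)" if "k \<le> d" for l \<omega> k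
      using that by (simp add: measure_degree_process level_count_def i')
    have Y_eq: "?Y \<omega> (i + int k) = measure (limit_process \<epsilon> P \<omega>) (zlevel i d k)" if "k \<le> d" for \<omega> k
      using that by (auto simp: zlevel_def i')
    have codeX: "code (?X l \<omega>) = level_code i d (degree_process \<theta> par (n l) \<omega>)" for l \<omega>
      unfolding code_def level_code_def
    proof (rule map_cong[OF refl])
      fix k assume "k \<in> set [0..<Suc d]"
      then have "k \<le> d" by auto
      from X_eq[OF this, of l \<omega>] show "nat \<lfloor>?X l \<omega> (i + int k)\<rfloor> = nat \<lfloor>measure (degree_process \<theta> par (n l) \<omega>) (zlevel i d k)\<rfloor>"
        by (rule arg_cong[where f = "\<lambda>x. nat \<lfloor>x\<rfloor>"])
    qed
    have codeY: "code (?Y \<omega>) = level_code i d (limit_process \<epsilon> P \<omega>)" for \<omega>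
      unfolding code_def level_code_def
    proof (rule map_cong[OF refl])
      fix k assume "k \<in> set [0..<Suc d]"
      then have "k \<le> d" by auto
      from Y_eq[OF this, of \<omega>] show "nat \<lfloor>?Y \<omega> (i + int k)\<rfloor> = nat \<lfloor>measure (limit_process \<epsilon> P \<omega>) (zlevel i d k)\<rfloor>"
        by (rule arg_cong[where f = "\<lambda>x. nat \<lfloor>x\<rfloor>"])
    qed
    have ball: "(\<forall>k\<in>{i..i'}. Q k) \<longleftrightarrow> (\<forall>k\<le>d. Q (i + int k))" for Q
    proof
      assume Q: "\<forall>k\<le>d. Q (i + int k)"
      show "\<forall>k\<in>{i..i'}. Q k"
      proof
        fix k assume "k \<in> {i..i'}"
        then show "Q k" using Q[rule_format, of "nat (k - i)"] by (simp add: i' nat_le_iff)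
      qed
    qed (simp add: i')
    have code_inj: "x = y" if "x \<in> S" "y \<in> S" "code x = code y" for x y
    proof (rule PiE_ext[of x "{i..i'}" "\<lambda>_. UNIV"])
      show "x \<in> {i..i'} \<rightarrow>\<^sub>E UNIV" "y \<in> {i..i'} \<rightarrow>\<^sub>E UNIV" using that by (auto simp: S_def)
      have "\<forall>k\<le>d. x (i + int k) = y (i + int k)"
      proof (intro allI impI)
        fix k assume k: "k \<le> d"
        have "nat \<lfloor>x (i + int k)\<rfloor> = nat \<lfloor>y (i + int k)\<rfloor>"
          using that(3) k unfolding code_def map_eq_conv set_upt by auto
        moreover have "x (i + int k) \<in> \<nat>" "y (i + int k) \<in> \<nat>" using that k by (auto simp: S_def i')
        ultimately show "x (i + int k) = y (i + int k)" by (auto elim!: Nats_cases)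
      qed
      then have "\<forall>k\<in>{i..i'}. x k = y k" unfolding ball .
      then show "x k = y k" if "k \<in> {i..i'}" for k using that by blast
    qed
    have XS: "?X l \<omega> \<in> S" for l \<omega> by (auto simp: S_def)
    have YS: "?Y \<omega> \<in> S" for \<omega>
    proof -
      have "\<forall>k\<le>d. ?Y \<omega> (i + int k) \<in> \<nat>"
      proof (intro allI impI)
        fix k assume k: "k \<le> d"
        obtain c :: nat where c: "measure (limit_process \<epsilon> P \<omega>) (zlevel i d k) = real c"
          using configuration_zlevel(2)[OF limit_process_configuration[of \<epsilon> P \<omega>], of i d k] by blast
        show "?Y \<omega> (i + int k) \<in> \<nat>" unfolding Y_eq[OF k] c by (rule of_nat_in_Nats)
      qed
      then have nats: "\<forall>k\<in>{i..i'}. ?Y \<omega> k \<in> \<nat>" unfolding ball .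
      have "?Y \<omega> \<in> {i..i'} \<rightarrow>\<^sub>E (UNIV :: real set)"
        unfolding restrict_PiE_iff by (intro ballI UNIV_I)
      from conjI[OF this nats] show ?thesis unfolding S_def mem_Collect_eq .
    qed
    show "converges_in_distribution ?T M ?X N ?Y"
    proof (rule converges_in_distribution_by_codes[where S = S and code = "\<lambda>a. code"])
      show "S \<subseteq> topspace ?T" by (auto simp: S_def)
      show "\<exists>a::nat. \<forall>s'\<in>S. code s' = code s \<longrightarrow> s' \<in> U" if "s \<in> S" "openin ?T U" "s \<in> U" for s U
        using code_inj that by blast
      show "{\<omega>\<in>space M. code (?X l \<omega>) = v} \<in> sets M" for l v unfolding codeX by (rule events_X)
      show "{\<omega>\<in>space N. code (?Y \<omega>) = v} \<in> sets N" for v unfolding codeY by (rule events_Y)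
      show "(\<lambda>l. measure M {\<omega>\<in>space M. code (?X l \<omega>) = v}) \<longlonglongrightarrow> measure N {\<omega>\<in>space N. code (?Y \<omega>) = v}" for v
        unfolding codeX codeY by (rule lim)
    qed (rule prob_space_axioms N.prob_space_axioms XS YS | assumption)+
  qed
qed

end
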